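(* Let $M$ be the toric manifold with Delzant moment polytope $P\subset\mathbb{R}^n$, and let $u$ be a symplectic potential on $P$, with corresponding $\mathbb{T}^n$-invariant complex structure $J$ on $M$. Let $\xi$ be a Higgs tensor on $P$, i.e. a smooth function on $P^\circ$ with values in complex symmetric $n\times n$ matrices. Then the deformation of complex structure on $M^\circ$ determined by $\xi$ extends to a ($\mathbb{T}^n$-invariant, smooth, first-order) deformation of the complex structure $J$ on $M$ if and only if $D^2u_P\,\xi\,D^2u_P$ extends smoothly to $P$.
   Context: $P=\{y\in\mathbb{R}^n:\ell^r(y)\ge0\ \forall r\}$ is a Delzant polytope with interior $P^\circ$, where the $\ell^r$ are the affine-linear functions defining the facets, normalized as usual to have primitive integral inward normals. $(M,\omega)$ is the corresponding compact symplectic toric manifold, and $M^\circ$ is the open set where the torus action is free, identified with $P^\circ\times\mathbb{T}^n$ with coordinates $(y,w)$ via the moment map. The canonical potential is $u_P=\sum_r\ell^r\log\ell^r$. A symplectic potential is $u=u_P+h$ with $h\in C^\infty(P)$ (smooth up to the boundary), $D^2u$ positive definite on $P^\circ$, and $\det D^2u=\left(\delta\prod_r\ell^r\right)^{-1}$ for a strictly positive $\delta\in C^0(P)$. By a result of Abreu these correspond exactly to the $\mathbb{T}^n$-invariant integrable $\omega$-compatible complex structures $J$ on $M$, with $$J=\begin{pmatrix} 0 & -(D^2u)^{-1} \\ D^2u & 0 \end{pmatrix}$$ on $P^\circ\times\mathbb{T}^n$ in the frame $(\partial_y,\partial_w)$. A first-order deformation of $J$ is a section $\dot J$ of $\mathrm{End}(TM)$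 with $J\dot J+\dot JJ=0$ and $\omega(J\cdot,\dot J\cdot)+\omega(\dot J\cdot,J\cdot)=0$ (not assumed integrable). Set $G=D^2u$. The Higgs tensor $\xi$ determines real symmetric matrix functions $A,B$ on $P^\circ$ by $A-iB=G\,\xi\,G$, and the associated deformation on $M^\circ$ is $$\dot J=\begin{pmatrix} G^{-1}A & G^{-1}BG^{-1} \\ B & -AG^{-1} \end{pmatrix}.$$ *)

theory Defs
  imports "HOL-Analysis.Analysis"
begin

section \<open>Smooth functions up to the boundary\<close>

text \<open>Used only for open sets and for convex sets with nonempty interior. There the derivative
  within \<open>S\<close> is unique, so for the polytope \<open>P\<close> this is \<open>C\<^sup>\<infinity>(P)\<close>: every partial derivative on the
  interior extends continuously to \<open>P\<close>.\<close>

primrec Ck_on :: "nat \<Rightarrow> 'a::real_normed_vector set \<Rightarrow> ('a \<Rightarrow> 'b::real_normed_vector) \<Rightarrow> bool" where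
  "Ck_on 0 S f \<longleftrightarrow> continuous_on S f"
| "Ck_on (Suc k) S f \<longleftrightarrow>
     (\<exists>f'. (\<forall>x\<in>S. (f has_derivative f' x) (at x within S)) \<and> (\<forall>v. Ck_on k S (\<lambda>x. f' x v)))"

definition smooth_on :: "'a::real_normed_vector set \<Rightarrow> ('a \<Rightarrow> 'b::real_normed_vector) \<Rightarrow> bool" where
  "smooth_on S f \<longleftrightarrow> (\<forall>k. Ck_on k S f)"

definition hessian :: "(real^'n \<Rightarrow> real) \<Rightarrow> real^'n \<Rightarrow> real^'n^'n" where
  "hessian f y = (\<chi> i j. frechet_derivative
     (\<lambda>z. frechet_derivative f (at z) (axis j 1)) (at y) (axis i 1))"

definition positive_definite :: "real^'n^'n \<Rightarrow> bool" where
  "positive_definite H \<longleftrightarrow> transpose H = H \<and> (\<forall>v. v \<noteq> 0 \<longrightarrow> v \<bullet> (H *v v) > 0)"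


section \<open>Delzant polytopes\<close>

text \<open>The datum \<open>L r = (\<nu>, c)\<close> encodes the affine function \<open>y \<mapsto> \<langle>\<nu>, y\<rangle> + c\<close> with integral
  inward conormal \<open>\<nu>\<close>.\<close>

type_synonym ('n, 'r) facet_data = "'r \<Rightarrow> (int^'n) \<times> real"

definition conormal :: "('n::finite, 'r) facet_data \<Rightarrow> 'r \<Rightarrow> real^'n" where
  "conormal L r = (\<chi> i. of_int (fst (L r) $ i))"

definition ell :: "('n::finite, 'r) facet_data \<Rightarrow> 'r \<Rightarrow> real^'n \<Rightarrow> real" where
  "ell L r y = conormal L r \<bullet> y + snd (L r)"

definition poly_P :: "('n::finite, 'r) facet_data \<Rightarrow> (real^'n) set" where
  "poly_P L = {y. \<forall>r. ell L r y \<ge> 0}"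

definition active :: "('n::finite, 'r) facet_data \<Rightarrow> real^'n \<Rightarrow> 'r set" where
  "active L y = {r. ell L r y = 0}"

definition integral_basis :: "('n::finite, 'r::finite) facet_data \<Rightarrow> 'r set \<Rightarrow> bool" where
  "integral_basis L R \<longleftrightarrow> card R = CARD('n) \<and>
     (\<forall>m :: int^'n. \<exists>!c :: 'r \<Rightarrow> int.
        (\<forall>r. r \<notin> R \<longrightarrow> c r = 0) \<and> m = (\<Sum>r\<in>R. c r *s fst (L r)))"

definition delzant :: "('n::finite, 'r::finite) facet_data \<Rightarrow> bool" where
  "delzant L \<longleftrightarrow>
     polytope (poly_P L) \<and> interior (poly_P L) \<noteq> {} \<and>
     (\<forall>r. {y \<in> poly_P L. ell L r y = 0} facet_of poly_P L) \<and>
     inj (\<lambda>r. {y \<in> poly_P L. ell L r y = 0}) \<and>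
     (\<forall>r. Gcd (range (\<lambda>i. fst (L r) $ i)) = 1) \<and>
     (\<forall>v. v extreme_point_of poly_P L \<longrightarrow> integral_basis L (active L v))"


section \<open>Symplectic potentials and Higgs tensors\<close>

definition canonical_potential :: "('n::finite, 'r::finite) facet_data \<Rightarrow> real^'n \<Rightarrow> real" where
  "canonical_potential L y = (\<Sum>r\<in>UNIV. ell L r y * ln (ell L r y))"

definition symplectic_potential ::
  "('n::finite, 'r::finite) facet_data \<Rightarrow> (real^'n \<Rightarrow> real) \<Rightarrow> bool" where
  "symplectic_potential L u \<longleftrightarrow>
     (\<exists>h. smooth_on (poly_P L) h \<and> (\<forall>y\<in>poly_P L. u y = canonical_potential L y + h y)) \<and>
     (\<forall>y\<in>interior (poly_P L). positive_definite (hessian u y)) \<and>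
     (\<exists>\<delta>. continuous_on (poly_P L) \<delta> \<and> (\<forall>y\<in>poly_P L. \<delta> y > 0) \<and>
        (\<forall>y\<in>interior (poly_P L).
           det (hessian u y) = inverse (\<delta> y * (\<Prod>r\<in>UNIV. ell L r y))))"

definition cmat :: "real^'n^'m \<Rightarrow> complex^'n^'m" where
  "cmat H = (\<chi> i j. complex_of_real (H $ i $ j))"

definition higgs_tensor ::
  "('n::finite, 'r::finite) facet_data \<Rightarrow> (real^'n \<Rightarrow> complex^'n^'n) \<Rightarrow> bool" where
  "higgs_tensor L \<xi> \<longleftrightarrow> smooth_on (interior (poly_P L)) \<xi> \<and>
     (\<forall>y\<in>interior (poly_P L). transpose (\<xi> y) = \<xi> y)"

text \<open>\<open>G \<xi> G\<close> for \<open>G = D\<^sup>2u\<close>\<close>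

definition hess_conj ::
  "(real^'n::finite \<Rightarrow> real) \<Rightarrow> (real^'n \<Rightarrow> complex^'n^'n) \<Rightarrow> real^'n \<Rightarrow> complex^'n^'n" where
  "hess_conj u \<xi> y = cmat (hessian u y) ** \<xi> y ** cmat (hessian u y)"

definition extends_smoothly ::
  "('n::finite, 'r::finite) facet_data \<Rightarrow> (real^'n \<Rightarrow> 'b::real_normed_vector) \<Rightarrow> bool" where
  "extends_smoothly L f \<longleftrightarrow>
     (\<exists>F. smooth_on (poly_P L) F \<and> (\<forall>y\<in>interior (poly_P L). F y = f y))"


section \<open>The toric manifold\<close>

text \<open>\<open>M\<close> is the quotient \<open>P \<times> \<real>\<^sup>n / \<sim>\<close>, where over \<open>y\<close> the angle \<open>w\<close> is taken modulo the period
  lattice and the span of the conormals of the facets through \<open>y\<close>. With the potential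
  \<open>\<Sum> \<ell> log \<ell>\<close> (no factor 1/2) and \<open>\<omega> = \<Sum> dy\<^sub>i \<and> dw\<^sub>i\<close>, the complex structure of a
  symplectic potential is smooth across the facets exactly when the angles have period
  \<open>4 \<pi>\<close>: for \<open>u = y log y\<close> the metric is \<open>dy\<^sup>2 / y + y dw\<^sup>2 = \<rho>\<^sup>2 (dw/2)\<^sup>2 + d\<rho>\<^sup>2\<close>, \<open>y = \<rho>\<^sup>2 / 4\<close>.\<close>

type_synonym 'n point = "(real^'n) \<times> (real^'n) set"
type_synonym 'n coords = "(real^'n) \<times> (real^'n)"

definition period_lattice :: "(real^'n) set" where
  "period_lattice = {k. \<forall>i. \<exists>m::int. k $ i = 4 * pi * of_int m}"

definition toric_point :: "('n::finite, 'r) facet_data \<Rightarrow> real^'n \<Rightarrow> real^'n \<Rightarrow> 'n point" where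
  "toric_point L y w =
     (y, {w + s + k | s k. s \<in> span (conormal L ` active L y) \<and> k \<in> period_lattice})"

definition toric_manifold :: "('n::finite, 'r) facet_data \<Rightarrow> 'n point set" where
  "toric_manifold L = {toric_point L y w | y w. y \<in> poly_P L}"

definition act :: "real^'n \<Rightarrow> 'n point \<Rightarrow> 'n point" where
  "act t p = (fst p, (+) t ` snd p)"

text \<open>The atlas of local parametrizations consists of
  \<^item> \<open>None\<close>: the coordinates \<open>(y, w)\<close> on \<open>M\<degree>\<close> (on the universal cover of \<open>P\<degree> \<times> \<T>\<^sup>n\<close>);
  \<^item> \<open>Some e\<close>, with \<open>e\<close> an enumeration of the facets through a vertex: coordinates
    \<open>z\<^sub>j = a\<^sub>j + i b\<^sub>j\<close> on an open subset of \<open>\<complex>\<^sup>n\<close>, where \<open>z\<^sub>j = 2 (\<ell>\<^sup>e\<^sup>j)\<^sup>1\<^sup>/\<^sup>2 exp (i \<theta>\<^sub>j / 2)\<close> and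
    \<open>w = \<Sum> \<theta>\<^sub>j \<nu>\<^sup>e\<^sup>j\<close>.

  All of them are Darboux: \<open>\<omega> = \<Sum> dy\<^sub>j \<and> dw\<^sub>j = \<Sum> d\<ell>\<^sup>e\<^sup>j \<and> d\<theta>\<^sub>j = \<Sum> da\<^sub>j \<and> db\<^sub>j\<close>.\<close>

type_synonym ('n, 'r) chart = "('n \<Rightarrow> 'r) option"

definition charts :: "('n::finite, 'r) facet_data \<Rightarrow> ('n, 'r) chart set" where
  "charts L = insert None
     {Some e | e. inj e \<and> (\<exists>v. v extreme_point_of poly_P L \<and> range e = active L v)}"

definition vertex_moment ::
  "('n::finite, 'r) facet_data \<Rightarrow> ('n \<Rightarrow> 'r) \<Rightarrow> 'n coords \<Rightarrow> real^'n" where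
  "vertex_moment L e p =
     inv (\<lambda>y. \<chi> j. ell L (e j) y) (\<chi> j. ((fst p $ j)\<^sup>2 + (snd p $ j)\<^sup>2) / 4)"

definition vertex_angle ::
  "('n::finite, 'r) facet_data \<Rightarrow> ('n \<Rightarrow> 'r) \<Rightarrow> 'n coords \<Rightarrow> real^'n" where
  "vertex_angle L e p =
     (\<Sum>j\<in>UNIV. (2 * Arg (Complex (fst p $ j) (snd p $ j))) *\<^sub>R conormal L (e j))"

fun param :: "('n::finite, 'r) facet_data \<Rightarrow> ('n, 'r) chart \<Rightarrow> 'n coords \<Rightarrow> 'n point" where
  "param L None p = toric_point L (fst p) (snd p)"
| "param L (Some e) p = toric_point L (vertex_moment L e p) (vertex_angle L e p)"

fun dom_chart :: "('n::finite, 'r) facet_data \<Rightarrow> ('n, 'r) chart \<Rightarrow> 'n coords set" where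
  "dom_chart L None = interior (poly_P L) \<times> UNIV"
| "dom_chart L (Some e) = {p. \<forall>r. r \<notin> range e \<longrightarrow> ell L r (vertex_moment L e p) > 0}"

lemma vertex_basis:
  fixes L :: "('n::finite,'r::finite) facet_data" and e :: "'n \<Rightarrow> 'r"
  assumes ib: "integral_basis L R" and e: "inj e" "range e = R"
  shows "bij (\<lambda>y. \<chi> j. ell L (e j) y)"
    and "\<exists>\<theta>. w = (\<Sum>j\<in>UNIV. \<theta> j *\<^sub>R conormal L (e j))"
proof -
  have "\<exists>c. \<forall>i. axis i 1 = (\<Sum>r\<in>R. c i r *s fst (L r))"
  proof -
    have "\<exists>c. m = (\<Sum>r\<in>R. c r *s fst (L r))" for m :: "int^'n"
      using ib unfolding integral_basis_def by blast
    then show ?thesis by (intro choice allI)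
  qed
  then obtain c :: "'n \<Rightarrow> 'r \<Rightarrow> int" where c: "\<And>i. axis i 1 = (\<Sum>r\<in>R. c i r *s fst (L r))" by blast
  have c2: "(axis i 1::real^'n) = (\<Sum>j\<in>UNIV. of_int (c i (e j)) *\<^sub>R conormal L (e j))" for i
  proof -
    have "axis i 1 = (\<Sum>j\<in>UNIV. c i (e j) *s fst (L (e j)))"
      unfolding c e(2)[symmetric] by (simp add: sum.reindex[OF e(1)])
    then have "(axis i 1 :: int^'n) $ k = (\<Sum>j\<in>UNIV. c i (e j) * fst (L (e j)) $ k)" for k
      by simp
    then have *: "of_int ((axis i 1 :: int^'n) $ k) = (\<Sum>j\<in>UNIV. of_int (c i (e j)) * (of_int (fst (L (e j)) $ k)::real))" for k
      by simp
    have "(axis i 1 :: real^'n) $ k = of_int ((axis i 1 :: int^'n) $ k)" for k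
      by (simp add: axis_def)
    then show ?thesis unfolding vec_eq_iff * by (simp add: conormal_def)
  qed
  define N :: "real^'n^'n" where "N = (\<chi> j. conormal L (e j))"
  define C :: "real^'n^'n" where "C = (\<chi> i j. of_int (c i (e j)))"
  have "C ** N = mat 1"
  proof -
    have "(C ** N) $ i = axis i 1" for i
      unfolding c2 by (simp add: vec_eq_iff C_def N_def matrix_matrix_mult_def)
    then show ?thesis by (simp add: vec_eq_iff mat_def axis_def eq_commute)
  qed
  then have inv: "invertible N" using invertible_def matrix_left_right_inverse by blast
  have eq: "(\<lambda>y. \<chi> j. ell L (e j) y) = (\<lambda>x. x + (\<chi> j. snd (L (e j)))) \<circ> ((*v) N)"
    by (auto simp: fun_eq_iff vec_eq_iff ell_def N_def matrix_vector_mult_def inner_vec_def)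
  have "bij ((*v) N)"
    using inv unfolding bij_def
    by (simp add: inj_matrix_vector_mult invertible_right_inverse matrix_right_invertible_surjective[symmetric])
  moreover have "bij (\<lambda>x. x + (\<chi> j. snd (L (e j))))"
    by (metis bij_plus_right)
  ultimately show "bij (\<lambda>y. \<chi> j. ell L (e j) y)" unfolding eq by (rule bij_comp)
  have "w = (\<Sum>i\<in>UNIV. w $ i *\<^sub>R axis i 1)"
    by (simp add: vec_eq_iff axis_def if_distrib cong: if_cong)
  also have "\<dots> = (\<Sum>i\<in>UNIV. \<Sum>j\<in>UNIV. (w $ i * of_int (c i (e j))) *\<^sub>R conormal L (e j))"
    unfolding c2 by (simp add: scaleR_sum_right)
  also have "\<dots> = (\<Sum>j\<in>UNIV. (\<Sum>i\<in>UNIV. w $ i * of_int (c i (e j))) *\<^sub>R conormal L (e j))"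
    by (subst sum.swap) (simp add: scaleR_sum_left)
  finally show "\<exists>\<theta>. w = (\<Sum>j\<in>UNIV. \<theta> j *\<^sub>R conormal L (e j))" by (rule exI[where x="\<lambda>j. \<Sum>i\<in>UNIV. w $ i * of_int (c i (e j))"])
qed

lemma half_angle_Arg:
  assumes "\<rho> > 0"
  shows "\<exists>m::int. \<theta> = 2 * Arg (Complex (\<rho> * cos (\<theta>/2)) (\<rho> * sin (\<theta>/2))) + 4 * pi * of_int m"
proof -
  let ?z = "Complex (\<rho> * cos (\<theta>/2)) (\<rho> * sin (\<theta>/2))"
  have z: "?z = of_real \<rho> * cis (\<theta>/2)" by (simp add: complex_eq_iff)
  have "cmod ?z = \<rho>" unfolding z using assms by (simp add: norm_mult)
  then have "?z = of_real \<rho> * cis (Arg ?z)" by (metis rcis_cmod_Arg rcis_def)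
  then have "cis (\<theta>/2) = cis (Arg ?z)" using z assms by auto
  then have "cos (\<theta>/2) = cos (Arg ?z)" "sin (\<theta>/2) = sin (Arg ?z)" by (auto simp: complex_eq_iff)
  then obtain m::int where "\<theta>/2 = Arg ?z + 2*pi*m" by (metis sin_cos_eq_iff)
  then have "\<theta> = 2 * Arg ?z + 4*pi*m" by (simp add: field_simps)
  then show ?thesis by blast
qed

lemma toric_point_cong:
  assumes "a = b + s + k" "s \<in> span (conormal L ` active L y)" "k \<in> period_lattice"
  shows "toric_point L y a = toric_point L y b"
proof -
  have neg: "- k \<in> period_lattice" if "k \<in> period_lattice" for k :: "real^'n"
    using that unfolding period_lattice_def by (auto) (metis mult_minus_right of_int_minus)
  have add: "k + k' \<in> period_lattice" if "k \<in> period_lattice" "k' \<in> period_lattice" for k k' :: "real^'n"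
    using that unfolding period_lattice_def by auto (metis distrib_left of_int_add)
  have *: "\<exists>s' k'. b + s + k + s1 + k1 = b + s' + k' \<and> s' \<in> span (conormal L ` active L y) \<and> k' \<in> period_lattice"
    if "s1 \<in> span (conormal L ` active L y)" "k1 \<in> period_lattice" for s1 k1
    using that assms add by (intro exI[of _ "s+s1"] exI[of _ "k+k1"]) (auto intro: span_add)
  have **: "\<exists>s' k'. b + s1 + k1 = b + s + k + s' + k' \<and> s' \<in> span (conormal L ` active L y) \<and> k' \<in> period_lattice"
    if "s1 \<in> span (conormal L ` active L y)" "k1 \<in> period_lattice" for s1 k1
    using that assms add[OF _ neg] by (intro exI[of _ "s1-s"] exI[of _ "k1-k"]) (auto intro: span_diff)
  show ?thesis unfolding toric_point_def assms(1) using * ** by auto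
qed

text \<open>The images of the charts cover \<open>M\<close>.\<close>

lemma charts_cover:
  fixes L :: "('n::finite,'r::finite) facet_data"
  assumes "delzant L"
  shows "(\<Union>c\<in>charts L. param L c ` dom_chart L c) = toric_manifold L"
proof (intro equalityI subsetI)
  fix q assume "q \<in> (\<Union>c\<in>charts L. param L c ` dom_chart L c)"
  then obtain c p where c: "c \<in> charts L" "p \<in> dom_chart L c" "q = param L c p" by blast
  show "q \<in> toric_manifold L"
  proof (cases c)
    case None
    then show ?thesis using c interior_subset[of "poly_P L"] by (fastforce simp: toric_manifold_def)
  next
    case (Some e)
    with c obtain v where v: "inj e" "v extreme_point_of poly_P L" "range e = active L v"
      by (auto simp: charts_def)
    then have "integral_basis L (active L v)" using assms by (auto simp: delzant_def)
    from vertex_basis(1)[OF this v(1,3)] have "surj (\<lambda>y. \<chi> j. ell L (e j) y)" by (rule bij_is_surj)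
    then have "(\<chi> j. ell L (e j) (vertex_moment L e p)) = (\<chi> j. ((fst p $ j)\<^sup>2 + (snd p $ j)\<^sup>2) / 4)"
      unfolding vertex_moment_def by (rule surj_f_inv_f)
    then have "ell L (e j) (vertex_moment L e p) = ((fst p $ j)\<^sup>2 + (snd p $ j)\<^sup>2) / 4" for j by (simp only: vec_eq_iff vec_lambda_beta)
    then have 1: "ell L (e j) (vertex_moment L e p) \<ge> 0" for j by (metis sum_power2_ge_zero divide_nonneg_nonneg zero_le_numeral)
    have "ell L r (vertex_moment L e p) \<ge> 0" for r
      using c(2) 1 Some by (cases "r \<in> range e") (auto intro: less_imp_le)
    then show ?thesis using c Some by (auto simp: toric_manifold_def poly_P_def)
  qed
next
  fix q assume "q \<in> toric_manifold L"
  then obtain y w where y: "y \<in> poly_P L" and q: "q = toric_point L y w" by (auto simp: toric_manifold_def)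
  define F where "F = {y' \<in> poly_P L. \<forall>r\<in>active L y. ell L r y' = 0}"
  have P: "compact (poly_P L)" "convex (poly_P L)"
    using assms by (auto simp: delzant_def polytope_imp_compact polytope_imp_convex)
  have aff: "ell L r ((1-t) *\<^sub>R a + t *\<^sub>R b) = (1-t) * ell L r a + t * ell L r b" for r t a b
    by (simp add: ell_def inner_add_right algebra_simps)
  have cont: "continuous_on UNIV (ell L r)" for r unfolding ell_def by (intro continuous_intros)
  have "F = poly_P L \<inter> (\<Inter>r\<in>active L y. {y'. ell L r y' = 0})" by (auto simp: F_def)
  moreover have "closed (\<Inter>r\<in>active L y. {y'. ell L r y' = 0})"
    by (intro closed_INT ballI closed_Collect_eq cont continuous_on_const)
  ultimately have "compact F" using P by (simp add: compact_Int_closed)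
  moreover have "convex F" using P(2) unfolding F_def convex_alt by (auto simp: aff)
  moreover have "y \<in> F" using y by (auto simp: F_def active_def)
  ultimately obtain v where v: "v extreme_point_of F" using extreme_point_exists_convex by blast
  have "F face_of poly_P L" unfolding face_of_def
  proof (intro conjI ballI impI)
    show "F \<subseteq> poly_P L" by (auto simp: F_def)
    show "convex F" by fact
    fix a b x assume ab: "a \<in> poly_P L" "b \<in> poly_P L" "x \<in> F" "x \<in> open_segment a b"
    then obtain t where t: "0 < t" "t < 1" "x = (1-t) *\<^sub>R a + t *\<^sub>R b" by (auto simp: in_segment)
    have "ell L r a = 0 \<and> ell L r b = 0" if "r \<in> active L y" for r
    proof -
      have "(1-t) * ell L r a + t * ell L r b = 0" using ab(3) that t by (simp add: F_def aff)
      moreover have "ell L r a \<ge> 0" "ell L r b \<ge> 0" using ab by (auto simp: poly_P_def)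
      ultimately show ?thesis using t
        by (smt (verit) mult_nonneg_nonneg mult_pos_pos)
    qed
    then show "a \<in> F" "b \<in> F" using ab by (auto simp: F_def)
  qed
  then have vP: "v extreme_point_of poly_P L" using v extreme_point_of_face by blast
  have act: "active L y \<subseteq> active L v" using v by (auto simp: extreme_point_of_def F_def active_def)
  have ib: "integral_basis L (active L v)" using vP assms by (auto simp: delzant_def)
  then have "card (UNIV::'n set) = card (active L v)" by (simp add: integral_basis_def)
  then obtain e where "bij_betw e (UNIV::'n set) (active L v)" by (metis finite_same_card_bij finite)
  then have e: "inj e" "range e = active L v" by (auto simp: bij_betw_def)
  obtain \<theta> where w: "w = (\<Sum>j\<in>UNIV. \<theta> j *\<^sub>R conormal L (e j))" using vertex_basis(2)[OF ib e] by blast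
  define p :: "'n coords" where "p = ((\<chi> j. 2 * sqrt (ell L (e j) y) * cos (\<theta> j / 2)), (\<chi> j. 2 * sqrt (ell L (e j) y) * sin (\<theta> j / 2)))"
  have nn: "ell L r y \<ge> 0" for r using y by (auto simp: poly_P_def)
  have "((fst p $ j)\<^sup>2 + (snd p $ j)\<^sup>2) / 4 = ell L (e j) y" for j
  proof -
    have "((fst p $ j)\<^sup>2 + (snd p $ j)\<^sup>2) = 4 * ell L (e j) y * ((cos (\<theta> j / 2))\<^sup>2 + (sin (\<theta> j / 2))\<^sup>2)"
      using nn by (simp add: p_def power_mult_distrib distrib_left del: sin_cos_squared_add sin_cos_squared_add2)
    then show ?thesis by simp
  qed
  then have vm: "vertex_moment L e p = y"
    unfolding vertex_moment_def using inv_f_f[OF bij_is_inj[OF vertex_basis(1)[OF ib e]], of y] by simp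
  have "p \<in> dom_chart L (Some e)" using act e(2) nn by (auto simp: vm active_def less_le)
  moreover have "Some e \<in> charts L" using e vP by (auto simp: charts_def)
  moreover have "param L (Some e) p = q"
  proof -
    have "\<exists>m. \<forall>j. ell L (e j) y > 0 \<longrightarrow> \<theta> j = 2 * Arg (Complex (fst p $ j) (snd p $ j)) + 4 * pi * of_int (m j)"
    proof -
      have "\<exists>m::int. ell L (e j) y > 0 \<longrightarrow> \<theta> j = 2 * Arg (Complex (fst p $ j) (snd p $ j)) + 4 * pi * of_int m" for j
        using half_angle_Arg[of "2 * sqrt (ell L (e j) y)" "\<theta> j"] by (auto simp: p_def)
      then show ?thesis by metis
    qed
    then obtain m :: "'n \<Rightarrow> int" where m: "\<And>j. ell L (e j) y > 0 \<Longrightarrow> \<theta> j = 2 * Arg (Complex (fst p $ j) (snd p $ j)) + 4 * pi * of_int (m j)" by blast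
    define a where "a j = 2 * Arg (Complex (fst p $ j) (snd p $ j))" for j
    define k where "k = (\<Sum>j\<in>UNIV. (if ell L (e j) y > 0 then 4 * pi * of_int (m j) else 0) *\<^sub>R conormal L (e j))"
    define s where "s = (\<Sum>j\<in>UNIV. (if ell L (e j) y > 0 then 0 else \<theta> j - a j) *\<^sub>R conormal L (e j))"
    have "w = vertex_angle L e p + s + k"
      unfolding w vertex_angle_def s_def k_def sum.distrib[symmetric]
      by (rule sum.cong) (auto simp: a_def m algebra_simps)
    moreover have "s \<in> span (conormal L ` active L y)" unfolding s_def
    proof (rule span_sum)
      fix j
      show "(if ell L (e j) y > 0 then 0 else \<theta> j - a j) *\<^sub>R conormal L (e j) \<in> span (conormal L ` active L y)"
        using nn[of "e j"] by (cases "ell L (e j) y = 0") (auto intro: span_mul[OF span_base] span_zero simp: active_def)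
    qed
    moreover have "k \<in> period_lattice" unfolding period_lattice_def k_def
    proof (intro CollectI allI)
      fix i
      have "(\<Sum>j\<in>UNIV. (if ell L (e j) y > 0 then 4 * pi * of_int (m j) else 0) *\<^sub>R conormal L (e j)) $ i
        = 4 * pi * of_int (\<Sum>j\<in>UNIV. (if ell L (e j) y > 0 then m j * fst (L (e j)) $ i else 0))"
        by (auto simp: conormal_def sum_distrib_left intro!: sum.cong)
      then show "\<exists>m'::int. (\<Sum>j\<in>UNIV. (if ell L (e j) y > 0 then 4 * pi * of_int (m j) else 0) *\<^sub>R conormal L (e j)) $ i = 4 * pi * of_int m'" by blast
    qed
    ultimately show ?thesis using toric_point_cong[of w "vertex_angle L e p" s k L y] by (simp only: q vm param.simps)
  qed
  ultimately show "q \<in> (\<Union>c\<in>charts L. param L c ` dom_chart L c)" by blast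
qed

text \<open>The constant coefficient matrix of \<open>\<omega>\<close> in every chart\<close>

definition omega :: "'n::finite coords \<Rightarrow> 'n coords \<Rightarrow> real" where
  "omega X Y = fst X \<bullet> snd Y - snd X \<bullet> fst Y"


section \<open>Sections of the endomorphism bundle\<close>

text \<open>A field is given by its local representatives, related by the transformation law of
  \<open>(1,1)\<close>-tensors. The parametrization \<open>None\<close> is a covering of its image, so the law is stated for
  every smooth local lift \<open>g\<close> (defined on an open set \<open>N\<close>) of a map \<open>f\<close> of \<open>M\<close>; the transition
  maps are the lifts of the identity.\<close>

type_synonym 'n endo = "'n coords \<Rightarrow> 'n coords"
type_synonym ('n, 'r) endo_field = "('n, 'r) chart \<Rightarrow> 'n coords \<Rightarrow> 'n endo"

definition local_lift ::
  "('n::finite, 'r) facet_data \<Rightarrow> ('n point \<Rightarrow> 'n point) \<Rightarrow> ('n, 'r) chart \<Rightarrow> ('n, 'r) chart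
     \<Rightarrow> 'n coords set \<Rightarrow> ('n coords \<Rightarrow> 'n coords) \<Rightarrow> bool" where
  "local_lift L f c c' N g \<longleftrightarrow>
     open N \<and> N \<subseteq> dom_chart L c \<and> g ` N \<subseteq> dom_chart L c' \<and> smooth_on N g \<and>
     (\<forall>p\<in>N. param L c' (g p) = f (param L c p))"

definition preserved_by ::
  "('n::finite, 'r) facet_data \<Rightarrow> ('n point \<Rightarrow> 'n point) \<Rightarrow> ('n, 'r) endo_field \<Rightarrow> bool" where
  "preserved_by L f T \<longleftrightarrow>
     (\<forall>c\<in>charts L. \<forall>c'\<in>charts L. \<forall>N g. local_lift L f c c' N g \<longrightarrow>
        (\<forall>p\<in>N. \<forall>D. (g has_derivative D) (at p) \<longrightarrow> T c' (g p) \<circ> D = D \<circ> T c p))"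

definition smooth_endo_field ::
  "('n::finite, 'r) facet_data \<Rightarrow> ('n, 'r) endo_field \<Rightarrow> bool" where
  "smooth_endo_field L T \<longleftrightarrow>
     (\<forall>c\<in>charts L. (\<forall>p\<in>dom_chart L c. linear (T c p)) \<and>
        (\<forall>X. smooth_on (dom_chart L c) (\<lambda>p. T c p X))) \<and>
     preserved_by L id T"

definition torus_invariant ::
  "('n::finite, 'r) facet_data \<Rightarrow> ('n, 'r) endo_field \<Rightarrow> bool" where
  "torus_invariant L T \<longleftrightarrow> (\<forall>t. preserved_by L (act t) T)"

definition restricts_to ::
  "('n::finite, 'r) facet_data \<Rightarrow> ('n, 'r) endo_field \<Rightarrow> (real^'n \<Rightarrow> 'n endo) \<Rightarrow> bool" where
  "restricts_to L T E \<longleftrightarrow> (\<forall>y\<in>interior (poly_P L). \<forall>w. T None (y, w) = E y)"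


section \<open>Complex structures and their first-order deformations\<close>

text \<open>Block matrices act on columns \<open>(\<eta>, \<zeta>)\<close> with respect to the frame \<open>(\<partial>\<^sub>y, \<partial>\<^sub>w)\<close>.\<close>

definition potential_J :: "(real^'n::finite \<Rightarrow> real) \<Rightarrow> real^'n \<Rightarrow> 'n endo" where
  "potential_J u y = (\<lambda>(\<eta>, \<zeta>).
     (- (matrix_inv (hessian u y) *v \<zeta>), hessian u y *v \<eta>))"

text \<open>The smooth field \<open>J\<close> on \<open>M\<close> is unique because \<open>M\<degree>\<close> is dense, and exists by Abreu's theorem.\<close>

definition complex_structure_of ::
  "('n::finite, 'r) facet_data \<Rightarrow> (real^'n \<Rightarrow> real) \<Rightarrow> ('n, 'r) endo_field \<Rightarrow> bool" where
  "complex_structure_of L u J \<longleftrightarrow>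
     smooth_endo_field L J \<and> restricts_to L J (potential_J u)"

definition deformation_of ::
  "('n::finite, 'r) facet_data \<Rightarrow> ('n, 'r) endo_field \<Rightarrow> ('n, 'r) endo_field \<Rightarrow> bool" where
  "deformation_of L J J' \<longleftrightarrow> smooth_endo_field L J' \<and>
     (\<forall>c\<in>charts L. \<forall>p\<in>dom_chart L c.
        (\<forall>X. J c p (J' c p X) + J' c p (J c p X) = 0) \<and>
        (\<forall>X Y. omega (J c p X) (J' c p Y) + omega (J' c p X) (J c p Y) = 0))"

definition higgs_A ::
  "(real^'n::finite \<Rightarrow> real) \<Rightarrow> (real^'n \<Rightarrow> complex^'n^'n) \<Rightarrow> real^'n \<Rightarrow> real^'n^'n" where
  "higgs_A u \<xi> y = (\<chi> i j. Re (hess_conj u \<xi> y $ i $ j))"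

definition higgs_B ::
  "(real^'n::finite \<Rightarrow> real) \<Rightarrow> (real^'n \<Rightarrow> complex^'n^'n) \<Rightarrow> real^'n \<Rightarrow> real^'n^'n" where
  "higgs_B u \<xi> y = (\<chi> i j. - Im (hess_conj u \<xi> y $ i $ j))"

definition higgs_deformation ::
  "(real^'n::finite \<Rightarrow> real) \<Rightarrow> (real^'n \<Rightarrow> complex^'n^'n) \<Rightarrow> real^'n \<Rightarrow> 'n endo" where
  "higgs_deformation u \<xi> y =
     (let Gi = matrix_inv (hessian u y); A = higgs_A u \<xi> y; B = higgs_B u \<xi> y in
      (\<lambda>(\<eta>, \<zeta>). ((Gi ** A) *v \<eta> + (Gi ** B ** Gi) *v \<zeta>, B *v \<eta> - (A ** Gi) *v \<zeta>)))"

end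

theory Submission
  imports Defs
begin

text \<open>Over \<open>M\<degree>\<close> a tensor given by a function of \<open>y\<close> in the frame \<open>(\<partial>\<^sub>y, \<partial>\<^sub>w)\<close> is carried to a vertex
  chart by the derivative of the explicit map \<open>(y, w) \<mapsto> z\<close>. Near a vertex, with
  \<open>Y = (\<Sum>\<^sub>j \<nu>\<^sup>e\<^sup>j (\<nu>\<^sup>e\<^sup>j)\<^sup>t / \<ell>\<^sup>e\<^sup>j)\<^sup>-\<^sup>1\<close> (smooth up to the boundary), \<open>W = D\<^sup>2u Y\<close> is smooth with invertible
  values up to the boundary: for \<open>u\<close> by the determinant condition, for \<open>u\<^sub>P\<close> by positivity. So
  \<open>D\<^sup>2u (D\<^sup>2u\<^sub>P)\<^sup>-\<^sup>1\<close> is smooth, and \<open>D\<^sup>2u \<xi> D\<^sup>2u\<close> extends if and only if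
  \<open>D\<^sup>2u\<^sub>P \<xi> D\<^sup>2u\<^sub>P\<close> does. If \<open>A\<close>, \<open>B\<close> extend, the chart expression of the deformation is
  polynomial in \<open>z\<close>, \<open>A\<close>, \<open>B\<close>, \<open>W\<^sup>-\<^sup>1\<close>, hence smooth.

  Conversely, on the slice \<open>z = a\<close> real, an entry of a smooth deformation is \<open>a\<^sub>i a\<^sub>j C\<^sub>i\<^sub>j / 4\<close> with
  \<open>C = N\<^sup>-\<^sup>t W\<^sup>-\<^sup>1 A N\<^sup>-\<^sup>1\<close> a function of \<open>a\<^sub>k\<^sup>2\<close>, where the rows of \<open>N\<close> are the \<open>\<nu>\<^sup>e\<^sup>j\<close>. Parity makes it
  divisible by \<open>a\<^sub>i a\<^sub>j\<close>; for \<open>i = j\<close> one first needs vanishing at \<open>a\<^sub>i = 0\<close>, which holds because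
  rotating \<open>z\<^sub>i\<close> by a right angle changes the sign of that entry. The quotient is even, so \<open>C\<close> is
  smooth in \<open>a\<^sub>k\<^sup>2\<close> by Whitney's theorem. Applied to \<open>J\<close> composed with the deformation, whose \<open>A\<close> is
  \<open>-B\<close>, the same argument gives the smoothness of \<open>B\<close>.\<close>

text \<open>The obstacle is that the moment coordinates are squares of the chart coordinates:
  \<open>P\<close> has corners, where \<open>sqrt\<close> is not smooth, so boundary regularity has
  to pass through one-sided derivatives and through parity. Two principles keep the geometry small.
  A tensor over the free part is described by an intertwining relation with
  \<open>chart_frame\<close> (\<open>represents\<close>), so no transition map is computed;
  identities on \<open>M\<close> (transformation law, invariance, compatibility with
  \<open>J\<close> and \<open>omega\<close>) are checked over the dense free part and extended by
  continuity. Moreover \<open>D^2u\<close> enters near a vertex as a smooth invertible factor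
  \<open>W\<close> times the explicit singular factor \<open>Y^-1\<close>; in
  \<open>(D^2u)^-1 = Y W^-1\<close> the factor \<open>Y\<close> cancels the poles
  \<open>1 / radius2\<close> of the polar frame, which is why smooth \<open>A\<close> and
  \<open>B\<close> suffice although the frame blows up at the boundary. On the algebraic side
  \<open>J\<close> multiplies \<open>A - iB\<close> by \<open>-i\<close>, which turns statements
  about \<open>B\<close> into statements about \<open>A\<close>.\<close>

section \<open>Smooth functions\<close>

text \<open>A condition that open sets and convex sets with interior both satisfy and that makes the
  derivative within the set unique. The length \<open>d\<close> may depend on the direction, so no
  uniform cone is required.\<close>

definition thick :: "'a::real_normed_vector set \<Rightarrow> bool" where
  "thick S \<longleftrightarrow> (\<forall>x\<in>S. \<exists>V. open V \<and> V \<noteq> {} \<and>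
     (\<forall>v\<in>V. \<exists>d>0. \<forall>t. 0 < t \<and> t < d \<longrightarrow> x + t *\<^sub>R v \<in> S))"

lemma thickE:
  assumes "thick S" "x \<in> S"
  obtains V where "open V" "V \<noteq> {}"
    "\<And>v. v \<in> V \<Longrightarrow> \<exists>d>0. \<forall>t. 0 < t \<and> t < d \<longrightarrow> x + t *\<^sub>R v \<in> S"
  using bspec[OF assms(1)[unfolded thick_def] assms(2)] by (elim exE conjE) (rule that, auto)

lemma thick_convex:
  assumes "convex S" "interior S \<noteq> {}"
  shows "thick S"
  unfolding thick_def
proof
  fix x assume x: "x \<in> S"
  let ?V = "(\<lambda>z. - x + z) ` interior S"
  have "\<exists>d>0. \<forall>t. 0 < t \<and> t < d \<longrightarrow> x + t *\<^sub>R v \<in> S" if "v \<in> ?V" for v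
  proof (intro exI[of _ 1] conjI allI impI)
    from that obtain z where z: "z \<in> interior S" "v = - x + z" by blast
    fix t :: real assume t: "0 < t \<and> t < 1"
    have "(1 - t) *\<^sub>R x + t *\<^sub>R z \<in> S"
      using z x t assms(1) interior_subset[of S] by (auto intro!: convexD)
    then show "x + t *\<^sub>R v \<in> S" by (simp add: z algebra_simps)
  qed simp
  moreover have "open ?V" by (rule open_translation) simp
  ultimately show "\<exists>V. open V \<and> V \<noteq> {} \<and> (\<forall>v\<in>V. \<exists>d>0. \<forall>t. 0 < t \<and> t < d \<longrightarrow> x + t *\<^sub>R v \<in> S)"
    using assms(2) by (intro exI[of _ ?V]) auto
qed

lemma thick_Int_open:
  assumes "thick S" "open U"
  shows "thick (S \<inter> U)"
  unfolding thick_def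
proof
  fix x assume x: "x \<in> S \<inter> U"
  then have "x \<in> S" by simp
  from thickE[OF assms(1) this] obtain V where V: "open V" "V \<noteq> {}"
    "\<And>v. v \<in> V \<Longrightarrow> \<exists>d>0. \<forall>t. 0 < t \<and> t < d \<longrightarrow> x + t *\<^sub>R v \<in> S" by metis
  have "\<exists>d>0. \<forall>t. 0 < t \<and> t < d \<longrightarrow> x + t *\<^sub>R v \<in> S \<inter> U" if v: "v \<in> V" for v
  proof -
    obtain d where d: "d > 0" "\<And>t. 0 < t \<and> t < d \<Longrightarrow> x + t *\<^sub>R v \<in> S" using V(3)[OF v] by blast
    have "((\<lambda>t. x + t *\<^sub>R v) \<longlongrightarrow> x + 0 *\<^sub>R v) (at_right 0)" by (intro tendsto_intros)
    then have "eventually (\<lambda>t. x + t *\<^sub>R v \<in> U) (at_right 0)"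
      using x assms(2) by (intro topological_tendstoD) auto
    then obtain b where "b > 0" "\<And>t. 0 < t \<Longrightarrow> t < b \<Longrightarrow> x + t *\<^sub>R v \<in> U"
      unfolding eventually_at_right_field by blast
    with d show ?thesis by (intro exI[of _ "min b d"]) auto
  qed
  with V(1,2) show "\<exists>V. open V \<and> V \<noteq> {} \<and> (\<forall>v\<in>V. \<exists>d>0. \<forall>t. 0 < t \<and> t < d \<longrightarrow> x + t *\<^sub>R v \<in> S \<inter> U)"
    by (intro exI[of _ V] conjI ballI)
qed

lemma thick_open: "open S \<Longrightarrow> thick S"
  using thick_Int_open[OF thick_convex[of UNIV], of S] by simp

text \<open>Rays into \<open>S\<close> determine a derivative on the open set \<open>V\<close> of
  directions. Linear maps that agree on a nonempty open set are equal, because \<open>w\<close> is a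
  multiple of the difference of \<open>v0 + (b/2) w\<close> and \<open>v0\<close>.\<close>

lemma thick_has_derivative_unique:
  assumes S: "thick S" "x \<in> S"
    and D: "(f has_derivative D) (at x within S)" and E: "(f has_derivative E) (at x within S)"
  shows "D = E"
proof -
  from thickE[OF S] obtain V where V: "open V" "V \<noteq> {}"
    "\<And>v. v \<in> V \<Longrightarrow> \<exists>d>0. \<forall>t. 0 < t \<and> t < d \<longrightarrow> x + t *\<^sub>R v \<in> S" by metis
  have linD: "linear D" "linear E"
    using D E by (auto intro: has_derivative_linear)
  have eqV: "D v = E v" if v: "v \<in> V" for v
  proof -
    obtain d where d: "d > 0" "\<And>t. 0 < t \<and> t < d \<Longrightarrow> x + t *\<^sub>R v \<in> S" using V(3)[OF v] by blast
    have sub: "(\<lambda>t. x + t *\<^sub>R v) ` {0..d/2} \<subseteq> S"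
    proof safe
      fix t assume t: "t \<in> {0..d/2}"
      show "x + t *\<^sub>R v \<in> S"
        by (cases "t = 0") (use t d S in auto)
    qed
    have der: "((\<lambda>t. f (x + t *\<^sub>R v)) has_vector_derivative F v) (at 0 within {0..d/2})"
      if F: "(f has_derivative F) (at x within S)" for F
    proof -
      have lin: "linear F" using F by (rule has_derivative_linear)
      have "((\<lambda>t. x + t *\<^sub>R v) has_derivative (\<lambda>t. t *\<^sub>R v)) (at 0 within {0..d/2})"
        by (auto intro!: derivative_eq_intros)
      moreover have "(f has_derivative F) (at (x + 0 *\<^sub>R v) within (\<lambda>t. x + t *\<^sub>R v) ` {0..d/2})"
        using F sub by (auto intro: has_derivative_subset)
      ultimately show ?thesis
        unfolding has_vector_derivative_def
        by (rule has_derivative_in_compose[THEN has_derivative_eq_rhs]) (simp add: linear_scale[OF lin])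
    qed
    show ?thesis
      using vector_derivative_unique_within_closed_interval[of 0 "d/2" 0] der[OF D] der[OF E] d(1) by force
  qed
  obtain v0 where v0: "v0 \<in> V" using V(2) by blast
  show ?thesis
  proof
    fix w
    have "((\<lambda>t. v0 + t *\<^sub>R w) \<longlongrightarrow> v0 + 0 *\<^sub>R w) (at_right 0)" by (intro tendsto_intros)
    then have "eventually (\<lambda>t. v0 + t *\<^sub>R w \<in> V) (at_right 0)"
      using v0 V(1) by (intro topological_tendstoD) auto
    then obtain b :: real where b: "b > 0" "\<And>t. 0 < t \<Longrightarrow> t < b \<Longrightarrow> v0 + t *\<^sub>R w \<in> V"
      unfolding eventually_at_right_field by blast
    then have "D (v0 + (b/2) *\<^sub>R w) = E (v0 + (b/2) *\<^sub>R w)" by (intro eqV) auto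
    then show "D w = E w"
      using eqV[OF v0] b(1) by (simp add: linear_add[OF linD(1)] linear_add[OF linD(2)]
        linear_scale[OF linD(1)] linear_scale[OF linD(2)])
  qed
qed

section \<open>Calculus of the classes \<open>Ck_on\<close>\<close>

lemma Ck_on_SucI:
  assumes "\<And>x. x \<in> S \<Longrightarrow> (f has_derivative f' x) (at x within S)" "\<And>v. Ck_on k S (\<lambda>x. f' x v)"
  shows "Ck_on (Suc k) S f"
  unfolding Ck_on.simps by (intro exI[of _ f'] conjI ballI allI assms)

lemma Ck_on_SucE:
  assumes "Ck_on (Suc k) S f"
  obtains f' where "\<And>x. x \<in> S \<Longrightarrow> (f has_derivative f' x) (at x within S)"
    "\<And>v. Ck_on k S (\<lambda>x. f' x v)"
  using assms unfolding Ck_on.simps by (elim exE conjE) (rule that, auto)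

lemma Ck_on_Suc_imp: "Ck_on (Suc k) S f \<Longrightarrow> Ck_on k S f"
proof (induction k arbitrary: f)
  case 0
  then show ?case by (auto intro: has_derivative_continuous_on)
next
  case (Suc k)
  then show ?case by (metis Ck_on.simps(2))
qed

lemma Ck_on_mono: "Ck_on m S f \<Longrightarrow> k \<le> m \<Longrightarrow> Ck_on k S f"
  by (induction m) (auto simp: le_Suc_eq Ck_on_Suc_imp simp del: Ck_on.simps)

lemma Ck_on_continuous: "Ck_on k S f \<Longrightarrow> continuous_on S f"
  using Ck_on_mono[of k S f 0] by simp

lemma Ck_on_subset: "Ck_on k S f \<Longrightarrow> T \<subseteq> S \<Longrightarrow> Ck_on k T f"
proof (induction k arbitrary: f)
  case 0
  then show ?case by (auto intro: continuous_on_subset)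
next
  case (Suc k)
  from Suc.prems(1) obtain f' where f':
    "\<And>x. x \<in> S \<Longrightarrow> (f has_derivative f' x) (at x within S)" "\<And>v. Ck_on k S (\<lambda>x. f' x v)"
    by (rule Ck_on_SucE) blast
  show ?case
    by (rule Ck_on_SucI[of T f f']) (use f' Suc.IH Suc.prems(2) has_derivative_subset in \<open>blast+\<close>)
qed

lemma Ck_on_cong:
  assumes "Ck_on k S f" and eq: "\<And>x. x \<in> S \<Longrightarrow> g x = f x"
  shows "Ck_on k S g"
proof (cases k)
  case 0
  then show ?thesis using assms continuous_on_cong[OF refl eq] by simp
next
  case (Suc m)
  from assms(1)[unfolded Suc] obtain f' where f':
    "\<And>x. x \<in> S \<Longrightarrow> (f has_derivative f' x) (at x within S)" "\<And>v. Ck_on m S (\<lambda>x. f' x v)"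
    by (rule Ck_on_SucE) blast
  show ?thesis
    unfolding Suc by (rule Ck_on_SucI[of S g f']) (use f' eq has_derivative_transform in \<open>blast+\<close>)
qed

lemma Ck_on_const [simp]: "Ck_on k S (\<lambda>x. c)"
  by (induction k arbitrary: c) (simp, rule Ck_on_SucI[where f'="\<lambda>x v. 0"], auto)

lemma Ck_on_linear: "bounded_linear f \<Longrightarrow> Ck_on k S f"
proof (cases k)
  case (Suc m)
  assume "bounded_linear f"
  then show ?thesis unfolding Suc
    by (intro Ck_on_SucI[where f'="\<lambda>x. f"] bounded_linear_imp_has_derivative) auto
qed (auto intro: linear_continuous_on)

lemma Ck_on_linear_compose:
  assumes h: "bounded_linear h"
  shows "Ck_on k S f \<Longrightarrow> Ck_on k S (\<lambda>x. h (f x))"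
proof (induction k arbitrary: f)
  case 0
  then show ?case using bounded_linear.continuous_on[OF h, of S f] by simp
next
  case (Suc k)
  from Suc.prems obtain f' where f':
    "\<And>x. x \<in> S \<Longrightarrow> (f has_derivative f' x) (at x within S)" "\<And>v. Ck_on k S (\<lambda>x. f' x v)"
    by (rule Ck_on_SucE) blast
  show ?case
    by (rule Ck_on_SucI[where f'="\<lambda>x v. h (f' x v)"])
      (auto intro: bounded_linear.has_derivative[OF h] f' Suc.IH)
qed

lemma Ck_on_add: "Ck_on k S f \<Longrightarrow> Ck_on k S g \<Longrightarrow> Ck_on k S (\<lambda>x. f x + g x)"
proof (induction k arbitrary: f g)
  case 0
  then show ?case using continuous_on_add[of S f g] by simp
next
  case (Suc k)
  from Suc.prems(1) obtain f' where f':
    "\<And>x. x \<in> S \<Longrightarrow> (f has_derivative f' x) (at x within S)" "\<And>v. Ck_on k S (\<lambda>x. f' x v)"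
    by (rule Ck_on_SucE) blast
  from Suc.prems(2) obtain g' where g':
    "\<And>x. x \<in> S \<Longrightarrow> (g has_derivative g' x) (at x within S)" "\<And>v. Ck_on k S (\<lambda>x. g' x v)"
    by (rule Ck_on_SucE) blast
  show ?case
    by (rule Ck_on_SucI[where f'="\<lambda>x v. f' x v + g' x v"])
      (auto intro: has_derivative_add f' g' Suc.IH)
qed

lemma Ck_on_bilinear:
  assumes "bounded_bilinear b"
  shows "Ck_on k S f \<Longrightarrow> Ck_on k S g \<Longrightarrow> Ck_on k S (\<lambda>x. b (f x) (g x))"
proof (induction k arbitrary: f g)
  case 0
  then show ?case using bounded_bilinear.continuous_on[OF assms, of S f g] by simp
next
  case (Suc k)
  from Suc.prems(1) obtain f' where f':
    "\<And>x. x \<in> S \<Longrightarrow> (f has_derivative f' x) (at x within S)" "\<And>v. Ck_on k S (\<lambda>x. f' x v)"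
    by (rule Ck_on_SucE) blast
  from Suc.prems(2) obtain g' where g':
    "\<And>x. x \<in> S \<Longrightarrow> (g has_derivative g' x) (at x within S)" "\<And>v. Ck_on k S (\<lambda>x. g' x v)"
    by (rule Ck_on_SucE) blast
  show ?case
    by (rule Ck_on_SucI[where f'="\<lambda>x v. b (f x) (g' x v) + b (f' x v) (g x)"])
      (intro bounded_bilinear.FDERIV[OF assms] Ck_on_add f' g' Suc.IH Ck_on_Suc_imp[OF Suc.prems(1)]
        Ck_on_Suc_imp[OF Suc.prems(2)]; assumption)+
qed

lemma Ck_on_sum: "(\<And>i. i \<in> I \<Longrightarrow> Ck_on k S (f i)) \<Longrightarrow> Ck_on k S (\<lambda>x. \<Sum>i\<in>I. f i x)"
  by (induction I rule: infinite_finite_induct) (auto intro: Ck_on_add)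

lemma Ck_on_compose:
  fixes f :: "'a::real_normed_vector \<Rightarrow> 'b::euclidean_space" and g :: "'b \<Rightarrow> 'c::real_normed_vector"
  shows "Ck_on k S f \<Longrightarrow> Ck_on k T g \<Longrightarrow> f ` S \<subseteq> T \<Longrightarrow> Ck_on k S (\<lambda>x. g (f x))"
proof (induction k arbitrary: g)
  case 0
  then show ?case by (auto intro: continuous_on_compose2)
next
  case (Suc k)
  from Suc.prems(1) obtain f' where d1:
    "\<And>x. x \<in> S \<Longrightarrow> (f has_derivative f' x) (at x within S)" "\<And>v. Ck_on k S (\<lambda>x. f' x v)"
    by (rule Ck_on_SucE) blast
  from Suc.prems(2) obtain g' where d2:
    "\<And>x. x \<in> T \<Longrightarrow> (g has_derivative g' x) (at x within T)" "\<And>v. Ck_on k T (\<lambda>x. g' x v)"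
    by (rule Ck_on_SucE) blast
  note d = d1 d2
  have f: "Ck_on k S f" by (rule Ck_on_Suc_imp[OF Suc.prems(1)])
  \<comment> \<open>\<open>Ck_on\<close> controls derivatives in constant directions only, while the
    direction \<open>f' x v\<close> in the chain rule varies with \<open>x\<close>; expanding it in
    \<open>Basis\<close> leaves constant directions with coefficients of class
    \<open>k\<close>.\<close>
  let ?D = "\<lambda>x v. \<Sum>b\<in>Basis. (f' x v \<bullet> b) *\<^sub>R g' (f x) b"
  have "((\<lambda>x. g (f x)) has_derivative ?D x) (at x within S)" if x: "x \<in> S" for x
  proof -
    have fx: "f x \<in> T" using x Suc.prems by auto
    have lin: "linear (g' (f x))" using d(3)[OF fx] by (rule has_derivative_linear)
    have "(g has_derivative g' (f x)) (at (f x) within f ` S)"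
      using d(3)[OF fx] Suc.prems(3) by (rule has_derivative_subset)
    from has_derivative_in_compose[OF d(1)[OF x] this] show ?thesis
    proof (rule has_derivative_eq_rhs)
      show "(\<lambda>v. g' (f x) (f' x v)) = ?D x"
      proof
        fix v
        have "g' (f x) (f' x v) = g' (f x) (\<Sum>b\<in>Basis. (f' x v \<bullet> b) *\<^sub>R b)"
          by (simp only: euclidean_representation)
        also have "\<dots> = ?D x v"
          by (simp only: linear_sum[OF lin] linear_scale[OF lin])
        finally show "g' (f x) (f' x v) = ?D x v" .
      qed
    qed
  qed
  moreover have "Ck_on k S (\<lambda>x. ?D x v)" for v
    by (intro Ck_on_sum Ck_on_bilinear[OF bounded_bilinear_scaleR] Suc.IH f d
        Ck_on_linear_compose[OF bounded_linear_inner_left] Suc.prems)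
  ultimately show ?case by (rule Ck_on_SucI[where f'="?D"])
qed

text \<open>Each point uses the derivative supplied by its own neighbourhood; uniqueness within a
  thick set makes these choices agree nearby, so the diagonal choice \<open>D x x\<close> is again
  locally of class \<open>k\<close>.\<close>

lemma Ck_on_local:
  assumes "thick S" "\<And>x. x \<in> S \<Longrightarrow> \<exists>U. open U \<and> x \<in> U \<and> Ck_on k (S \<inter> U) f"
  shows "Ck_on k S f"
  using assms(2)
proof (induction k arbitrary: f)
  case 0
  show ?case unfolding Ck_on.simps continuous_on_eq_continuous_within
  proof
    fix x assume x: "x \<in> S"
    from 0[OF this] obtain U where U: "open U" "x \<in> U" "continuous_on (S \<inter> U) f" by auto
    with x have "continuous (at x within (S \<inter> U)) f" by (auto simp: continuous_on_eq_continuous_within)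
    moreover have "at x within S = at x within (S \<inter> U)" by (rule at_within_nhd[OF U(2,1)]) auto
    ultimately show "continuous (at x within S) f" by simp
  qed
next
  case (Suc k)
  have "\<exists>U D. open U \<and> x \<in> U \<and> (\<forall>z\<in>S \<inter> U. (f has_derivative D z) (at z within S)) \<and>
     (\<forall>v. Ck_on k (S \<inter> U) (\<lambda>z. D z v))" if x: "x \<in> S" for x
  proof -
    from Suc.prems[OF x] obtain U where U0: "open U" "x \<in> U" "Ck_on (Suc k) (S \<inter> U) f" by blast
    from U0(3) obtain D where D:
      "\<And>z. z \<in> S \<inter> U \<Longrightarrow> (f has_derivative D z) (at z within (S \<inter> U))"
      "\<And>v. Ck_on k (S \<inter> U) (\<lambda>z. D z v)" by (rule Ck_on_SucE) blast
    note U = U0(1,2) D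
    have "(f has_derivative D z) (at z within S)" if "z \<in> S \<inter> U" for z
      using U(3)[OF that] U(1) that at_within_nhd[of z U S "S \<inter> U"] by (simp add: Int_ac)
    with U show ?thesis by blast
  qed
  then obtain U D where U: "\<And>x. x \<in> S \<Longrightarrow> open (U x)" "\<And>x. x \<in> S \<Longrightarrow> x \<in> U x"
     "\<And>x z. x \<in> S \<Longrightarrow> z \<in> S \<inter> U x \<Longrightarrow> (f has_derivative D x z) (at z within S)"
     "\<And>x v. x \<in> S \<Longrightarrow> Ck_on k (S \<inter> U x) (\<lambda>z. D x z v)" by metis
  have "(f has_derivative D x x) (at x within S)" if "x \<in> S" for x
    using U that by blast
  moreover have "Ck_on k S (\<lambda>x. D x x v)" for v
  proof (rule Suc.IH)
    fix x assume x: "x \<in> S"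
    have "D z z v = D x z v" if z: "z \<in> S \<inter> U x" for z
      using thick_has_derivative_unique[OF assms(1), of z f "D z z" "D x z"] U z x by auto
    with U(4)[OF x, of v] have "Ck_on k (S \<inter> U x) (\<lambda>z. D z z v)"
      by (rule Ck_on_cong) auto
    with U x show "\<exists>V. open V \<and> x \<in> V \<and> Ck_on k (S \<inter> V) (\<lambda>z. D z z v)" by blast
  qed
  ultimately show ?case by (rule Ck_on_SucI)
qed

named_theorems smooth_intros

lemma smooth_on_imp_Ck: "smooth_on S f \<Longrightarrow> Ck_on k S f"
  by (simp add: smooth_on_def)

lemma smooth_on_continuous: "smooth_on S f \<Longrightarrow> continuous_on S f"
  unfolding smooth_on_def by (blast intro: Ck_on_continuous)

lemma smooth_on_subset: "smooth_on S f \<Longrightarrow> T \<subseteq> S \<Longrightarrow> smooth_on T f"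
  unfolding smooth_on_def by (blast intro: Ck_on_subset)

lemma smooth_on_cong: "smooth_on S f \<Longrightarrow> (\<And>x. x \<in> S \<Longrightarrow> g x = f x) \<Longrightarrow> smooth_on S g"
  using Ck_on_cong[of _ S f g] by (simp add: smooth_on_def)

lemma smooth_on_local:
  assumes "thick S" "\<And>x. x \<in> S \<Longrightarrow> \<exists>U. open U \<and> x \<in> U \<and> smooth_on (S \<inter> U) f"
  shows "smooth_on S f"
  unfolding smooth_on_def
proof
  fix k
  show "Ck_on k S f"
  proof (rule Ck_on_local[OF assms(1)])
    fix x assume "x \<in> S"
    from assms(2)[OF this] show "\<exists>U. open U \<and> x \<in> U \<and> Ck_on k (S \<inter> U) f"
      by (auto simp: smooth_on_def)
  qed
qed

lemma smooth_on_const [smooth_intros]: "smooth_on S (\<lambda>x. c)"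
  by (simp add: smooth_on_def)

lemma smooth_on_linear: "bounded_linear f \<Longrightarrow> smooth_on S f"
  by (simp add: smooth_on_def Ck_on_linear)

lemma smooth_on_id [smooth_intros]: "smooth_on S (\<lambda>x. x)"
  by (rule smooth_on_linear) (rule bounded_linear_ident)

lemma smooth_on_linear_compose: "bounded_linear h \<Longrightarrow> smooth_on S f \<Longrightarrow> smooth_on S (\<lambda>x. h (f x))"
  by (simp add: smooth_on_def Ck_on_linear_compose)

lemma smooth_on_bilinear:
  "bounded_bilinear b \<Longrightarrow> smooth_on S f \<Longrightarrow> smooth_on S g \<Longrightarrow> smooth_on S (\<lambda>x. b (f x) (g x))"
  by (simp add: smooth_on_def Ck_on_bilinear)

lemma smooth_on_add [smooth_intros]: "smooth_on S f \<Longrightarrow> smooth_on S g \<Longrightarrow> smooth_on S (\<lambda>x. f x + g x)"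
  by (simp add: smooth_on_def Ck_on_add)

lemma smooth_on_sum [smooth_intros]:
  "(\<And>i. i \<in> I \<Longrightarrow> smooth_on S (f i)) \<Longrightarrow> smooth_on S (\<lambda>x. \<Sum>i\<in>I. f i x)"
  by (simp add: smooth_on_def Ck_on_sum)

lemmas smooth_on_scaleR [smooth_intros] = smooth_on_bilinear[OF bounded_bilinear_scaleR]
lemmas smooth_on_inner [smooth_intros] = smooth_on_bilinear[OF bounded_bilinear_inner]
lemmas smooth_on_fst [smooth_intros] = smooth_on_linear_compose[OF bounded_linear_fst]
lemmas smooth_on_snd [smooth_intros] = smooth_on_linear_compose[OF bounded_linear_snd]
lemmas smooth_on_nth [smooth_intros] = smooth_on_linear_compose[OF bounded_linear_vec_nth]
lemmas smooth_on_minus [smooth_intros] = smooth_on_linear_compose[OF bounded_linear_minus[OF bounded_linear_ident]]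
lemmas smooth_on_Re [smooth_intros] = smooth_on_linear_compose[OF bounded_linear_Re]
lemmas smooth_on_Im [smooth_intros] = smooth_on_linear_compose[OF bounded_linear_Im]
lemmas smooth_on_of_real [smooth_intros] = smooth_on_linear_compose[OF bounded_linear_of_real]

lemma smooth_on_mult [smooth_intros]:
  fixes f g :: "'a::real_normed_vector \<Rightarrow> 'b::real_normed_algebra"
  shows "smooth_on S f \<Longrightarrow> smooth_on S g \<Longrightarrow> smooth_on S (\<lambda>x. f x * g x)"
  by (rule smooth_on_bilinear[OF bounded_bilinear_mult])

lemma smooth_on_diff [smooth_intros]: "smooth_on S f \<Longrightarrow> smooth_on S g \<Longrightarrow> smooth_on S (\<lambda>x. f x - g x)"
  using smooth_on_add[OF _ smooth_on_minus, of S f g] by simp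

lemma smooth_on_divide_const [smooth_intros]:
  fixes f :: "'a::real_normed_vector \<Rightarrow> real"
  shows "smooth_on S f \<Longrightarrow> smooth_on S (\<lambda>x. f x / c)"
  by (rule smooth_on_linear_compose[OF bounded_linear_divide])

lemma smooth_on_power [smooth_intros]:
  fixes f :: "'a::real_normed_vector \<Rightarrow> real"
  shows "smooth_on S f \<Longrightarrow> smooth_on S (\<lambda>x. f x ^ n)"
  by (induction n) (simp_all add: smooth_on_const smooth_on_mult)

lemma smooth_on_prod [smooth_intros]:
  fixes f :: "'i \<Rightarrow> 'a::real_normed_vector \<Rightarrow> real"
  shows "(\<And>i. i \<in> I \<Longrightarrow> smooth_on S (f i)) \<Longrightarrow> smooth_on S (\<lambda>x. \<Prod>i\<in>I. f i x)"
  by (induction I rule: infinite_finite_induct) (simp_all add: smooth_on_const smooth_on_mult)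

lemma smooth_on_compose:
  fixes f :: "'a::real_normed_vector \<Rightarrow> 'b::euclidean_space"
  shows "smooth_on T g \<Longrightarrow> smooth_on S f \<Longrightarrow> f ` S \<subseteq> T \<Longrightarrow> smooth_on S (\<lambda>x. g (f x))"
  unfolding smooth_on_def by (blast intro: Ck_on_compose)

lemma smooth_on_Pair [smooth_intros]:
  assumes "smooth_on S f" "smooth_on S g"
  shows "smooth_on S (\<lambda>x. (f x, g x))"
proof -
  have "smooth_on S (\<lambda>x. (f x, 0) + (0, g x))"
    by (intro smooth_on_add smooth_on_linear_compose[OF _ assms(1)] smooth_on_linear_compose[OF _ assms(2)]
        bounded_linear_Pair bounded_linear_ident bounded_linear_zero)
  then show ?thesis by simp
qed

lemma smooth_on_vec_lambda [smooth_intros]: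
  fixes f :: "'a::real_normed_vector \<Rightarrow> 'n::finite \<Rightarrow> 'b::real_normed_vector"
  assumes "\<And>i. smooth_on S (\<lambda>x. f x i)"
  shows "smooth_on S (\<lambda>x. \<chi> i. f x i)"
proof -
  have ax: "bounded_linear (axis i :: 'b \<Rightarrow> 'b^'n)" for i
  proof (rule bounded_linear_intro[where K=1])
    show "norm (axis i x :: 'b^'n) \<le> norm x * 1" for x
    proof -
      have "norm (axis i x :: 'b^'n) = L2_set (\<lambda>j. norm ((axis i x :: 'b^'n) $ j)) UNIV" by (simp add: norm_vec_def)
      also have "\<dots> = sqrt (\<Sum>j\<in>UNIV. if j = i then (norm x)\<^sup>2 else 0)"
        unfolding L2_set_def by (intro arg_cong[where f=sqrt] sum.cong) (auto simp: axis_def)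
      finally show ?thesis by simp
    qed
  qed (auto simp: axis_def vec_eq_iff)
  have "smooth_on S (\<lambda>x. \<Sum>i\<in>UNIV. axis i (f x i))"
    by (intro smooth_on_sum smooth_on_linear_compose[OF ax] assms)
  moreover have "(\<Sum>i\<in>UNIV. axis i (f x i)) = (\<chi> i. f x i)" for x
    by (simp add: vec_eq_iff axis_def sum.delta)
  ultimately show ?thesis by (simp only:)
qed

lemma smooth_on_vecI:
  fixes f :: "'a::real_normed_vector \<Rightarrow> 'b::real_normed_vector^'n::finite"
  shows "(\<And>i. smooth_on S (\<lambda>x. f x $ i)) \<Longrightarrow> smooth_on S f"
  using smooth_on_vec_lambda[of S "\<lambda>x i. f x $ i"] by simp

lemma smooth_on_matrix_matrix_mult [smooth_intros]:
  fixes f :: "'a::real_normed_vector \<Rightarrow> 'b::real_normed_algebra_1^'m^'n" and g :: "'a \<Rightarrow> 'b^'l^'m"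
  assumes "smooth_on S f" "smooth_on S g"
  shows "smooth_on S (\<lambda>x. f x ** g x)"
  unfolding matrix_matrix_mult_def by (intro smooth_intros assms)

lemma smooth_on_matrix_vector_mult [smooth_intros]:
  fixes f :: "'a::real_normed_vector \<Rightarrow> real^'m^'n" and g :: "'a \<Rightarrow> real^'m"
  assumes "smooth_on S f" "smooth_on S g"
  shows "smooth_on S (\<lambda>x. f x *v g x)"
  unfolding matrix_vector_mult_def by (intro smooth_intros assms)

lemma smooth_on_transpose [smooth_intros]:
  fixes f :: "'a::real_normed_vector \<Rightarrow> real^'m^'n"
  assumes "smooth_on S f"
  shows "smooth_on S (\<lambda>x. transpose (f x))"
  unfolding transpose_def by (intro smooth_intros assms)

section \<open>Elementary functions, determinants and matrix inverses\<close>

lemma Ck_on_inverse_real: "Ck_on k (- {0::real}) inverse"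
proof (induction k)
  case 0
  then show ?case by (auto intro: continuous_intros)
next
  case (Suc k)
  have "(inverse has_derivative (\<lambda>v. - (inverse x * v * inverse x))) (at x within - {0})" if "x \<in> - {0}" for x :: real
    using that by (auto intro!: derivative_eq_intros)
  moreover have "Ck_on k (- {0}) (\<lambda>x::real. - (inverse x * v * inverse x))" for v
    by (intro Ck_on_linear_compose[OF bounded_linear_minus[OF bounded_linear_ident]]
        Ck_on_bilinear[OF bounded_bilinear_mult] Suc Ck_on_const)
  ultimately show ?case by (rule Ck_on_SucI)
qed

lemma smooth_on_inverse [smooth_intros]:
  fixes f :: "'a::real_normed_vector \<Rightarrow> real"
  assumes "smooth_on S f" "\<And>x. x \<in> S \<Longrightarrow> f x \<noteq> 0"
  shows "smooth_on S (\<lambda>x. inverse (f x))"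
  by (rule smooth_on_compose[of "- {0}" inverse, OF _ assms(1)]) (use assms in \<open>auto simp: smooth_on_def Ck_on_inverse_real\<close>)

lemma smooth_on_divide [smooth_intros]:
  fixes f g :: "'a::real_normed_vector \<Rightarrow> real"
  assumes "smooth_on S f" "smooth_on S g" "\<And>x. x \<in> S \<Longrightarrow> g x \<noteq> 0"
  shows "smooth_on S (\<lambda>x. f x / g x)"
  unfolding divide_inverse by (intro smooth_intros assms)

lemma Ck_on_sqrt: "Ck_on k {0<..} sqrt"
proof (induction k)
  case 0
  then show ?case by (auto intro: continuous_intros)
next
  case (Suc k)
  have "(sqrt has_derivative (\<lambda>v. v * inverse (2 * sqrt x))) (at x within {0<..})" if "x \<in> {0<..}" for x
    using that by (auto intro!: derivative_eq_intros simp: field_simps)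
  moreover have "Ck_on k {0<..} (\<lambda>x::real. v * inverse (2 * sqrt x))" for v
    by (intro Ck_on_bilinear[OF bounded_bilinear_mult] Ck_on_const
      Ck_on_compose[OF _ Ck_on_inverse_real, where S="{0<..}"] Suc) auto
  ultimately show ?case by (rule Ck_on_SucI)
qed

lemma smooth_on_sqrt [smooth_intros]:
  fixes f :: "'a::real_normed_vector \<Rightarrow> real"
  assumes "smooth_on S f" "\<And>x. x \<in> S \<Longrightarrow> f x > 0"
  shows "smooth_on S (\<lambda>x. sqrt (f x))"
  by (rule smooth_on_compose[of "{0<..}" sqrt, OF _ assms(1)]) (use assms in \<open>auto simp: smooth_on_def Ck_on_sqrt\<close>)

lemma Ck_on_sin_cos: "Ck_on k S (sin :: real \<Rightarrow> real) \<and> Ck_on k S (cos :: real \<Rightarrow> real)"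
proof (induction k)
  case 0
  then show ?case by (auto intro: continuous_intros)
next
  case (Suc k)
  have "Ck_on k S (\<lambda>x. v * cos x)" "Ck_on k S (\<lambda>x. v * - sin x)" for v :: real
    using Suc by (auto intro!: Ck_on_bilinear[OF bounded_bilinear_mult]
        Ck_on_linear_compose[OF bounded_linear_minus[OF bounded_linear_ident]])
  then show ?case
    by (intro conjI Ck_on_SucI[where f'="\<lambda>x v. v * cos x"] Ck_on_SucI[where f'="\<lambda>x v. v * - sin x"])
      (auto intro!: derivative_eq_intros)
qed

lemma smooth_on_sin [smooth_intros]:
  fixes f :: "'a::real_normed_vector \<Rightarrow> real"
  shows "smooth_on S f \<Longrightarrow> smooth_on S (\<lambda>x. sin (f x))"
  by (rule smooth_on_compose[of UNIV sin]) (auto simp: smooth_on_def Ck_on_sin_cos)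

lemma smooth_on_cos [smooth_intros]:
  fixes f :: "'a::real_normed_vector \<Rightarrow> real"
  shows "smooth_on S f \<Longrightarrow> smooth_on S (\<lambda>x. cos (f x))"
  by (rule smooth_on_compose[of UNIV cos]) (auto simp: smooth_on_def Ck_on_sin_cos)

lemma smooth_on_det [smooth_intros]:
  fixes f :: "'a::real_normed_vector \<Rightarrow> real^'n^'n"
  assumes "smooth_on S f"
  shows "smooth_on S (\<lambda>x. det (f x))"
  unfolding det_def by (intro smooth_intros assms)

lemma matrix_inv_right: "det A \<noteq> 0 \<Longrightarrow> A ** matrix_inv A = mat 1"
  for A :: "real^'n^'n"
  unfolding matrix_inv_def invertible_det_nz[symmetric] invertible_def by (erule someI2_ex) simp

lemma matrix_inv_left: "det A \<noteq> 0 \<Longrightarrow> matrix_inv A ** A = mat 1"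
  for A :: "real^'n^'n"
  unfolding matrix_inv_def invertible_det_nz[symmetric] invertible_def by (erule someI2_ex) simp

text \<open>Cramer's rule for the columns of the inverse. It exhibits the entries as quotients of
  polynomials, hence the smoothness of inversion where the determinant does not vanish.\<close>

lemma matrix_inv_nth:
  fixes A :: "real^'n^'n"
  assumes "det A \<noteq> 0"
  shows "matrix_inv A $ k $ l = det (\<chi> i j. if j = k then axis l 1 $ i else A $ i $ j) / det A"
proof -
  have "A *v (matrix_inv A *v axis l 1) = axis l 1"
    by (simp add: matrix_vector_mul_assoc matrix_inv_right[OF assms])
  then have "matrix_inv A *v axis l 1 = (\<chi> k. det (\<chi> i j. if j = k then axis l 1 $ i else A $ i $ j) / det A)"
    using cramer[OF assms] by blast
  then show ?thesis
    by (simp add: matrix_vector_mult_basis column_def vec_eq_iff)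
qed

lemma smooth_on_matrix_inv [smooth_intros]:
  fixes f :: "'a::real_normed_vector \<Rightarrow> real^'n^'n"
  assumes "smooth_on S f" "\<And>x. x \<in> S \<Longrightarrow> det (f x) \<noteq> 0"
  shows "smooth_on S (\<lambda>x. matrix_inv (f x))"
proof (intro smooth_on_vecI)
  fix k l
  have "smooth_on S (\<lambda>x. if j = k then axis l 1 $ i else f x $ i $ j)" for i j
    by (cases "j = k") (auto intro!: smooth_intros assms)
  then have "smooth_on S (\<lambda>x. det (\<chi> i j. if j = k then axis l 1 $ i else f x $ i $ j) / det (f x))"
    by (intro smooth_intros assms)
  then show "smooth_on S (\<lambda>x. matrix_inv (f x) $ k $ l)"
    by (rule smooth_on_cong) (use assms(2) matrix_inv_nth in auto)
qed

text \<open>Smoothness provides one derivative for each order; on a thick set they coincide, so a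
  single \<open>f'\<close> is smooth in every direction.\<close>

lemma smooth_on_derivative:
  assumes "thick S" "smooth_on S f"
  obtains f' where "\<And>x. x \<in> S \<Longrightarrow> (f has_derivative f' x) (at x within S)"
    "\<And>v. smooth_on S (\<lambda>x. f' x v)"
proof -
  have "\<exists>f'. (\<forall>x\<in>S. (f has_derivative f' x) (at x within S)) \<and> (\<forall>v. Ck_on k S (\<lambda>x. f' x v))" for k
    using smooth_on_imp_Ck[OF assms(2), of "Suc k"] by simp
  then obtain F where F: "\<And>k x. x \<in> S \<Longrightarrow> (f has_derivative F k x) (at x within S)"
    "\<And>k v. Ck_on k S (\<lambda>x. F k x v)" by metis
  have "Ck_on k S (\<lambda>x. F 0 x v)" for k v
    by (rule Ck_on_cong[OF F(2)[of k v]]) (metis F(1) assms(1) thick_has_derivative_unique)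
  then show thesis using that[of "F 0"] F(1) by (auto simp: smooth_on_def)
qed

text \<open>For identities known only off the boundary, off the coordinate hyperplanes or over the
  free part; uniqueness of limits extends them.\<close>

lemma continuous_on_eq_on_dense:
  fixes f g :: "'a::topological_space \<Rightarrow> 'b::t2_space"
  assumes "continuous_on S f" "continuous_on S g" "\<And>x. x \<in> S \<inter> D \<Longrightarrow> f x = g x"
    and "S \<subseteq> closure (S \<inter> D)" "x \<in> S"
  shows "f x = g x"
proof (cases "x \<in> D")
  case False
  then have "x islimpt (S \<inter> D)" using assms(4,5) by (auto simp: closure_def)
  then have nt: "at x within (S \<inter> D) \<noteq> bot" by (simp add: trivial_limit_within)
  have "(f \<longlongrightarrow> f x) (at x within (S \<inter> D))" "(g \<longlongrightarrow> g x) (at x within (S \<inter> D))"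
    using assms(1,2,5) by (auto simp: continuous_on_def intro: tendsto_within_subset)
  moreover have "(f \<longlongrightarrow> g x) (at x within (S \<inter> D)) = (g \<longlongrightarrow> g x) (at x within (S \<inter> D))"
    by (intro filterlim_cong refl) (auto simp: eventually_at_filter assms(3))
  ultimately show ?thesis using tendsto_unique[OF nt] by blast
qed (use assms in auto)


section \<open>Whitney's theorem on even functions\<close>

lemma linear_real_expand:
  fixes F :: "real^'n \<Rightarrow> real"
  assumes "linear F"
  shows "F v = (\<Sum>i\<in>UNIV. v $ i * F (axis i 1))"
proof -
  have "F v = F (\<Sum>i\<in>UNIV. v $ i *\<^sub>R axis i 1)"
    using basis_expansion[of v] by (simp add: scalar_mult_eq_scaleR)
  then show ?thesis by (simp add: linear_sum[OF assms] linear_scale[OF assms])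
qed

text \<open>For functions of \<open>sqrt\<close> the chain rule fails at the boundary and only
  derivatives along segments are available. By the mean value theorem on the segment, continuity of
  the candidate \<open>F\<close> upgrades them to a derivative within \<open>S\<close>.\<close>

lemma has_derivative_within_convexI:
  fixes f :: "'a::euclidean_space \<Rightarrow> real"
  assumes S: "convex S" "x \<in> S" and f: "continuous_on S f"
    and lin: "linear (F x)" "\<And>z. z \<in> S \<Longrightarrow> linear (F z)"
    and cont: "\<And>v. continuous_on S (\<lambda>z. F z v)"
    and der: "\<And>y s. y \<in> S \<Longrightarrow> 0 < s \<Longrightarrow> s < 1 \<Longrightarrow>
      ((\<lambda>s. f (x + s *\<^sub>R (y - x))) has_real_derivative F (x + s *\<^sub>R (y - x)) (y - x)) (at s)"
  shows "(f has_derivative F x) (at x within S)"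
  unfolding has_derivative_within_alt
proof (intro conjI allI impI)
  show "bounded_linear (F x)" using lin(1) by (simp add: linear_conv_bounded_linear)
  fix e :: real assume e: "e > 0"
  \<comment> \<open>The increment of \<open>F\<close> is a sum over \<open>Basis\<close>; each of
    its \<open>DIM('a)\<close> terms gets an equal share of \<open>e\<close>.\<close>
  define c where "c = e / DIM('a)"
  have c: "c > 0" using e by (simp add: c_def)
  have "eventually (\<lambda>z. \<forall>b\<in>Basis. dist (F z b) (F x b) < c) (at x within S)"
  proof (rule eventually_ball_finite)
    show "\<forall>b\<in>Basis. eventually (\<lambda>z. dist (F z b) (F x b) < c) (at x within S)"
      using cont S(2) c by (auto simp: continuous_on_def intro!: tendstoD)
  qed simp
  then obtain d where d: "d > 0"
    "\<And>z. z \<in> S \<Longrightarrow> z \<noteq> x \<Longrightarrow> dist z x < d \<Longrightarrow> \<forall>b\<in>Basis. dist (F z b) (F x b) < c"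
    unfolding eventually_at by blast
  have "norm (f y - f x - F x (y - x)) \<le> e * norm (y - x)" if y: "y \<in> S" "norm (y - x) < d" for y
  proof (cases "y = x")
    case True
    then show ?thesis by (simp add: linear_0[OF lin(1)])
  next
    case False
    let ?p = "\<lambda>s. x + s *\<^sub>R (y - x)"
    have pS: "?p s \<in> S" if "0 \<le> s" "s \<le> 1" for s
    proof -
      have "(1 - s) *\<^sub>R x + s *\<^sub>R y \<in> S" using S y that by (intro convexD) auto
      then show ?thesis by (simp add: algebra_simps)
    qed
    obtain s where "0 < s" "s < 1" "f (?p 1) - f (?p 0) = (\<lambda>h. F (?p s) (y - x) * h) (1 - 0)"
    proof (rule mvt[of 0 1 "\<lambda>s. f (?p s)" "\<lambda>s h. F (?p s) (y - x) * h"])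
      show "continuous_on {0..1} (\<lambda>s. f (?p s))"
        by (rule continuous_on_compose2[OF f]) (use pS in \<open>auto intro!: continuous_intros\<close>)
      fix s :: real assume "0 < s" "s < 1"
      from der[OF y(1) this] show "((\<lambda>s. f (?p s)) has_derivative (\<lambda>h. F (?p s) (y - x) * h)) (at s)"
        by (simp add: has_field_derivative_def)
    qed auto
    then have s: "0 < s" "s < 1" "f y - f x = F (?p s) (y - x)" by auto
    let ?z = "?p s" and ?w = "y - x"
    have z: "?z \<in> S" using pS s by simp
    have "dist ?z x < d"
    proof -
      have "s * norm ?w \<le> norm ?w" using s by (simp add: mult_left_le_one_le)
      then show ?thesis using y(2) s by (simp add: dist_norm)
    qed
    moreover have "?z \<noteq> x" using s False by simp
    ultimately have close: "\<forall>b\<in>Basis. \<bar>F ?z b - F x b\<bar> \<le> c"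
      using d(2)[OF z] by (auto simp: dist_real_def intro: less_imp_le)
    have expand: "F a ?w = (\<Sum>b\<in>Basis. (?w \<bullet> b) * F a b)" if a: "a \<in> S" for a
    proof -
      have "F a ?w = F a (\<Sum>b\<in>Basis. (?w \<bullet> b) *\<^sub>R b)" by (simp only: euclidean_representation)
      then show ?thesis by (simp only: linear_sum[OF lin(2)[OF a]] linear_scale[OF lin(2)[OF a]] real_scaleR_def)
    qed
    have "F ?z ?w - F x ?w = (\<Sum>b\<in>Basis. (?w \<bullet> b) * (F ?z b - F x b))"
      unfolding expand[OF z] expand[OF S(2)] by (simp add: sum_subtractf right_diff_distrib)
    then have "\<bar>F ?z ?w - F x ?w\<bar> \<le> (\<Sum>b\<in>Basis. \<bar>(?w \<bullet> b) * (F ?z b - F x b)\<bar>)"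
      by (simp only: sum_abs)
    also have "\<dots> \<le> (\<Sum>b\<in>(Basis::'a set). norm ?w * c)"
      using close Basis_le_norm[of _ ?w]
      by (intro sum_mono) (auto simp: abs_mult intro!: mult_mono)
    also have "\<dots> = e * norm ?w" by (simp add: c_def)
    finally show ?thesis using s by simp
  qed
  with d(1) show "\<exists>d>0. \<forall>y\<in>S. norm (y - x) < d \<longrightarrow> norm (f y - f x - F x (y - x)) \<le> e * norm (y - x)"
    by blast
qed

section \<open>Division by a coordinate\<close>

definition shrink :: "'n \<Rightarrow> real \<Rightarrow> real^'n \<Rightarrow> real^'n" where
  "shrink j t a = (\<chi> k. if k = j then t * a $ k else a $ k)"

lemma bounded_linear_shrink: "bounded_linear (shrink j t :: real^'n::finite \<Rightarrow> _)"
  unfolding linear_conv_bounded_linear[symmetric]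
  by (rule linearI) (auto simp: shrink_def vec_eq_iff algebra_simps)

lemma shrink_axis: "shrink j t (axis i 1) = (if i = j then t else 1) *\<^sub>R axis i 1"
  by (auto simp: shrink_def vec_eq_iff axis_def)

lemma continuous_on_shrink: "continuous_on UNIV (\<lambda>(a, t). shrink j t a :: real^'n::finite)"
  unfolding shrink_def case_prod_beta
proof (intro continuous_on_vec_lambda)
  fix k
  show "continuous_on UNIV (\<lambda>x. if k = j then snd x * fst x $ k else (fst x $ k :: real))"
    by (cases "k = j") (auto intro!: continuous_intros)
qed

text \<open>The weights \<open>t ^ m\<close> make the induction go through: differentiating in direction \<open>j\<close>
  produces an additional factor \<open>t\<close>.\<close>

lemma Ck_on_integral_shrink:
  fixes B :: "(real^'n::finite) set" and \<phi> :: "real^'n \<Rightarrow> real"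
  assumes B: "open B" "convex B" "\<And>a t. a \<in> B \<Longrightarrow> 0 \<le> t \<Longrightarrow> t \<le> 1 \<Longrightarrow> shrink j t a \<in> B"
  shows "smooth_on B \<phi> \<Longrightarrow> Ck_on k B (\<lambda>a. integral (cbox 0 1) (\<lambda>t. t ^ m * \<phi> (shrink j t a)))"
proof (induction k arbitrary: \<phi> m)
  case 0
  have "continuous_on (B \<times> cbox 0 1) (\<lambda>(a, t). t ^ m * \<phi> (shrink j t a))"
    unfolding case_prod_beta
    by (intro continuous_intros continuous_on_compose2[OF smooth_on_continuous[OF 0(1)]]
        continuous_on_subset[OF continuous_on_shrink[unfolded case_prod_beta]]) (auto intro: B)
  then show ?case by (simp only: Ck_on.simps integral_continuous_on_param)
next
  case (Suc k)
  obtain \<phi>' where \<phi>': "\<And>x. x \<in> B \<Longrightarrow> (\<phi> has_derivative \<phi>' x) (at x within B)"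
    "\<And>v. smooth_on B (\<lambda>x. \<phi>' x v)"
    using smooth_on_derivative[OF thick_open[OF B(1)] Suc.prems] by blast
  let ?m = "\<lambda>i. if i = j then Suc m else m"
  let ?h = "\<lambda>i a t. t ^ ?m i * \<phi>' (shrink j t a) (axis i 1)"
  \<comment> \<open>The derivative of the integrand as a combination of coordinate functionals,
    since \<open>leibniz_rule\<close> needs it with values in the bounded linear functions.\<close>
  define fx where "fx a t = (\<Sum>i\<in>UNIV. ?h i a t *\<^sub>R blinfun_inner_right (axis i 1 :: real^'n))" for a t
  have cont: "continuous_on (B \<times> cbox 0 1) (\<lambda>x. \<phi>' (shrink j (snd x) (fst x)) (axis i 1))" for i
    by (intro continuous_on_compose2[OF smooth_on_continuous[OF \<phi>'(2)]]
        continuous_on_subset[OF continuous_on_shrink[unfolded case_prod_beta]]) (auto intro: B)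
  have int: "(\<lambda>t. ?h i a t) integrable_on cbox 0 1" if "a \<in> B" for i a
    by (intro integrable_continuous continuous_intros
        continuous_on_compose2[OF cont[of i], where f="Pair a", unfolded snd_conv fst_conv]) (use that in auto)
  have "((\<lambda>a. integral (cbox 0 1) (\<lambda>t. t ^ m * \<phi> (shrink j t a))) has_derivative
      (\<lambda>v. \<Sum>i\<in>UNIV. v $ i * integral (cbox 0 1) (?h i a))) (at a within B)" if a: "a \<in> B" for a
  proof (rule has_derivative_eq_rhs, rule leibniz_rule[where fx=fx])
    fix x t assume x: "x \<in> B" and t: "t \<in> cbox (0::real) 1"
    have s: "shrink j t x \<in> B" using x t B by auto
    have lin: "linear (\<phi>' (shrink j t x))" using \<phi>'(1)[OF s] by (rule has_derivative_linear)
    have "((\<lambda>x. \<phi> (shrink j t x)) has_derivative (\<lambda>v. \<phi>' (shrink j t x) (shrink j t v))) (at x within B)"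
    proof (rule has_derivative_in_compose[where f="shrink j t"])
      show "(\<phi> has_derivative \<phi>' (shrink j t x)) (at (shrink j t x) within shrink j t ` B)"
        by (rule has_derivative_subset[OF \<phi>'(1)[OF s]]) (use t B in auto)
    qed (rule bounded_linear_imp_has_derivative[OF bounded_linear_shrink])
    then have "((\<lambda>x. t ^ m * \<phi> (shrink j t x)) has_derivative
        (\<lambda>v. t ^ m * \<phi>' (shrink j t x) (shrink j t v))) (at x within B)"
      by (rule has_derivative_mult_right)
    moreover have "(\<lambda>v. t ^ m * \<phi>' (shrink j t x) (shrink j t v)) = blinfun_apply (fx x t)"
    proof
      fix v
      have "linear (\<lambda>v. \<phi>' (shrink j t x) (shrink j t v))"
        using linear_compose[OF bounded_linear.linear[OF bounded_linear_shrink] lin] by (simp add: o_def)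
      from linear_real_expand[OF this, of v]
      show "t ^ m * \<phi>' (shrink j t x) (shrink j t v) = fx x t v"
        unfolding fx_def blinfun.sum_left blinfun.scaleR_left blinfun_inner_right.rep_eq shrink_axis
        by (auto simp: sum_distrib_left linear_scale[OF lin] inner_axis' intro!: sum.cong)
    qed
    ultimately show "((\<lambda>x. t ^ m * \<phi> (shrink j t x)) has_derivative blinfun_apply (fx x t)) (at x within B)"
      by (simp only:)
  next
    fix x assume x: "x \<in> B"
    have "continuous_on (cbox 0 1) (\<lambda>t. shrink j t x)"
      by (rule continuous_on_compose2[OF continuous_on_shrink, where f="Pair x", unfolded prod.case])
        (auto intro!: continuous_intros)
    then show "(\<lambda>t. t ^ m * \<phi> (shrink j t x)) integrable_on cbox 0 1"
      by (intro integrable_continuous continuous_intros continuous_on_compose2[OF smooth_on_continuous[OF Suc.prems]])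
        (auto intro: B x)
  next
    show "continuous_on (B \<times> cbox 0 1) (\<lambda>(x, t). fx x t)"
      unfolding fx_def case_prod_beta by (intro continuous_intros cont)
  next
    have fxint: "fx a integrable_on cbox 0 1"
      unfolding fx_def
      by (intro integrable_continuous continuous_intros
        continuous_on_compose2[OF cont, where f="Pair a", unfolded snd_conv fst_conv]) (use a in auto)
    show "blinfun_apply (integral (cbox 0 1) (fx a)) = (\<lambda>v. \<Sum>i\<in>UNIV. v $ i * integral (cbox 0 1) (?h i a))"
    proof
      fix v
      have "blinfun_apply (integral (cbox 0 1) (fx a)) v = integral (cbox 0 1) (\<lambda>t. fx a t v)"
        by (rule blinfun_apply_integral[OF fxint])
      also have "\<dots> = integral (cbox 0 1) (\<lambda>t. \<Sum>i\<in>UNIV. v $ i * ?h i a t)"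
        unfolding fx_def blinfun.sum_left blinfun.scaleR_left blinfun_inner_right.rep_eq
        by (simp add: inner_axis' mult.commute)
      also have "\<dots> = (\<Sum>i\<in>UNIV. integral (cbox 0 1) (\<lambda>t. v $ i * ?h i a t))"
        by (intro integral_sum integrable_on_mult_right int a) simp
      finally show "blinfun_apply (integral (cbox 0 1) (fx a)) v =
          (\<Sum>i\<in>UNIV. v $ i * integral (cbox 0 1) (?h i a))"
        by simp
    qed
  qed (use a B in auto)
  then show ?case
    by (rule Ck_on_SucI)
      (assumption, intro Ck_on_sum Ck_on_bilinear[OF bounded_bilinear_mult] Ck_on_const Suc.IH \<phi>')
qed

text \<open>The centre lies on the hyperplane \<open>a $ j = 0\<close>, so scaling coordinate
  \<open>j\<close> towards 0 does not enlarge any component of \<open>a - a0\<close>.\<close>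

lemma shrink_ball:
  fixes a0 :: "real^'n::finite"
  assumes "a0 $ j = 0" "a \<in> ball a0 r" "0 \<le> t" "t \<le> 1"
  shows "shrink j t a \<in> ball a0 r"
proof -
  have "norm (shrink j t a - a0) \<le> norm (a - a0)"
    by (rule norm_le_componentwise_cart)
      (use assms in \<open>auto simp: shrink_def abs_mult mult_left_le_one_le\<close>)
  then show ?thesis using assms(2) by (simp add: dist_norm norm_minus_commute)
qed

text \<open>Hadamard's lemma: as \<open>h\<close> vanishes on the hyperplane, integrating its
  derivative along \<open>t \<mapsto> shrink j t a\<close> from the hyperplane to \<open>a\<close>
  gives \<open>a $ j\<close> times the integral of the \<open>j\<close>-th partial derivative, which
  is smooth in \<open>a\<close>.\<close>

lemma smooth_division:
  fixes h :: "real^'n::finite \<Rightarrow> real"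
  assumes D: "open D" and h: "smooth_on D h" and zero: "\<And>a. a \<in> D \<Longrightarrow> a $ j = 0 \<Longrightarrow> h a = 0"
  obtains q where "smooth_on D q" "\<And>a. a \<in> D \<Longrightarrow> h a = a $ j * q a"
proof -
  obtain h' where h': "\<And>x. x \<in> D \<Longrightarrow> (h has_derivative h' x) (at x within D)"
    "\<And>v. smooth_on D (\<lambda>x. h' x v)"
    using smooth_on_derivative[OF thick_open[OF D] h] by blast
  \<comment> \<open>On the hyperplane the quotient is forced to be the partial derivative; the
    integral formula yields this value too, as \<open>shrink\<close> fixes such points.\<close>
  define q where "q a = (if a $ j = 0 then h' a (axis j 1) else h a / a $ j)" for a
  have "smooth_on D q"
  proof (rule smooth_on_local[OF thick_open[OF D]])
    fix a0 assume a0: "a0 \<in> D"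
    show "\<exists>U. open U \<and> a0 \<in> U \<and> smooth_on (D \<inter> U) q"
    proof (cases "a0 $ j = 0")
      case False
      let ?U = "{a::real^'n. a $ j \<noteq> 0}"
      have "open ?U" by (intro open_Collect_neq continuous_intros)
      moreover have "smooth_on (D \<inter> ?U) (\<lambda>a. h a / a $ j)"
        by (intro smooth_intros smooth_on_subset[OF h]) auto
      then have "smooth_on (D \<inter> ?U) q"
        by (rule smooth_on_cong) (auto simp: q_def)
      ultimately show ?thesis using False by blast
    next
      case True
      obtain r where r: "r > 0" "ball a0 r \<subseteq> D" using D a0 open_contains_ball by blast
      let ?B = "ball a0 r"
      let ?I = "\<lambda>a. integral (cbox 0 1) (\<lambda>t. t ^ 0 * h' (shrink j t a) (axis j 1))"
      have eq: "q a = ?I a" if a: "a \<in> ?B" for a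
      proof (cases "a $ j = 0")
        case True
        then have "shrink j t a = a" for t by (auto simp: shrink_def vec_eq_iff)
        then show ?thesis by (simp add: q_def True)
      next
        case False
        have sB: "shrink j t a \<in> ?B" if "0 \<le> t" "t \<le> 1" for t using shrink_ball[OF True a that] .
        have "((\<lambda>t. a $ j * h' (shrink j t a) (axis j 1)) has_integral h (shrink j 1 a) - h (shrink j 0 a)) {0..1}"
        proof (rule fundamental_theorem_of_calculus)
          fix t :: real assume t: "t \<in> {0..1}"
          have s: "shrink j t a \<in> D" using sB t r by auto
          have lin: "linear (h' (shrink j t a))" using h'(1)[OF s] by (rule has_derivative_linear)
          have eq: "(\<lambda>t. shrink j t a) = (\<lambda>t. shrink j 0 a + t *\<^sub>R (a $ j *\<^sub>R axis j 1))"
            by (auto simp: fun_eq_iff vec_eq_iff shrink_def axis_def)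
          have "((\<lambda>t. shrink j t a) has_derivative (\<lambda>t. t *\<^sub>R (a $ j *\<^sub>R axis j 1))) (at t within {0..1})"
            unfolding eq by (auto intro!: derivative_eq_intros)
          moreover have "(h has_derivative h' (shrink j t a)) (at (shrink j t a) within (\<lambda>t. shrink j t a) ` {0..1})"
            by (rule has_derivative_subset[OF h'(1)[OF s]]) (use sB r in auto)
          ultimately have "((\<lambda>t. h (shrink j t a)) has_derivative (\<lambda>s. h' (shrink j t a) (s *\<^sub>R (a $ j *\<^sub>R axis j 1)))) (at t within {0..1})"
            by (rule has_derivative_in_compose)
          then show "((\<lambda>t. h (shrink j t a)) has_vector_derivative a $ j * h' (shrink j t a) (axis j 1)) (at t within {0..1})"
            unfolding has_vector_derivative_def by (simp add: linear_scale[OF lin] mult.assoc)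
        qed simp
        moreover have "shrink j 1 a = a" by (auto simp: shrink_def vec_eq_iff)
        moreover have "h (shrink j 0 a) = 0"
          using sB[of 0] r by (intro zero) (auto simp: shrink_def)
        ultimately have "((\<lambda>t. a $ j * h' (shrink j t a) (axis j 1)) has_integral h a) {0..1}" by simp
        from integral_unique[OF this] show ?thesis
          using False by (simp add: q_def field_simps)
      qed
      have "smooth_on ?B (\<lambda>a. h' a (axis j 1))" by (rule smooth_on_subset[OF h'(2) r(2)])
      then have "smooth_on ?B ?I"
        unfolding smooth_on_def
        by (intro allI Ck_on_integral_shrink) (auto intro!: shrink_ball[OF True] simp: smooth_on_def simp del: mem_ball)
      then have "smooth_on ?B q" by (rule smooth_on_cong) (rule eq)
      then have "smooth_on (D \<inter> ?B) q" by (rule smooth_on_subset) auto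
      then show ?thesis using r by (intro exI[of _ ?B]) auto
    qed
  qed
  moreover have "h a = a $ j * q a" if "a \<in> D" for a
    using zero[OF that] by (auto simp: q_def)
  ultimately show thesis by (rule that)
qed

section \<open>Reflections in the coordinate hyperplanes\<close>

definition nonvanishing :: "(real^'n) set" where
  "nonvanishing = {a. \<forall>k. a $ k \<noteq> 0}"

lemma closure_nonvanishing: "closure (nonvanishing :: (real^'n::finite) set) = UNIV"
proof -
  have "\<exists>y\<in>nonvanishing. dist y a < e" if e: "e > 0" for a :: "real^'n" and e
  proof -
    define b :: "real^'n" where "b = (\<chi> k. if a $ k = 0 then 1 else 0)"
    define d where "d = e / (norm b + 1)"
    have d: "d > 0" unfolding d_def using e by (intro divide_pos_pos add_nonneg_pos) auto
    have "a + d *\<^sub>R b \<in> nonvanishing" using d by (auto simp: nonvanishing_def b_def)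
    moreover have "dist (a + d *\<^sub>R b) a < e"
    proof -
      have "d * norm b < d * (norm b + 1)" using d by simp
      also have "\<dots> = e" by (simp add: d_def add_nonneg_eq_0_iff)
      finally show ?thesis using d by (simp add: dist_norm)
    qed
    ultimately show ?thesis by blast
  qed
  then show ?thesis by (auto simp: closure_approachable)
qed

lemma nonvanishing_dense: "open D \<Longrightarrow> D \<subseteq> closure (D \<inter> (nonvanishing :: (real^'n::finite) set))"
  using open_Int_closure_subset[of D nonvanishing] by (simp add: closure_nonvanishing)

definition flip :: "real^'n \<Rightarrow> real^'n \<Rightarrow> real^'n" where
  "flip \<sigma> a = (\<chi> k. \<sigma> $ k * a $ k)"

definition signs :: "(real^'n) set" where
  "signs = {\<sigma>. \<forall>k. \<sigma> $ k = 1 \<or> \<sigma> $ k = -1}"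

text \<open>On the real slice \<open>b = 0\<close> of a vertex chart this gives the facet
  coordinates \<open>|z|^2 / 4\<close>; \<open>double_root\<close> is its nonnegative section over
  the closed orthant.\<close>

definition half_square :: "real^'n \<Rightarrow> real^'n" where
  "half_square a = (\<chi> k. (a $ k)\<^sup>2 / 4)"

definition double_root :: "real^'n \<Rightarrow> real^'n" where
  "double_root x = (\<chi> k. 2 * sqrt (x $ k))"

lemma bounded_linear_flip: "bounded_linear (flip \<sigma> :: real^'n::finite \<Rightarrow> _)"
  unfolding linear_conv_bounded_linear[symmetric]
  by (rule linearI) (auto simp: flip_def vec_eq_iff algebra_simps)

lemma half_square_flip: "\<sigma> \<in> signs \<Longrightarrow> half_square (flip \<sigma> a) = half_square a"
  by (auto simp: signs_def half_square_def flip_def vec_eq_iff power_mult_distrib power2_eq_1_iff)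

lemma half_square_double_root: "(\<And>k. x $ k \<ge> 0) \<Longrightarrow> half_square (double_root x) = x"
  by (simp add: half_square_def double_root_def vec_eq_iff power_mult_distrib)

lemma flip_nonvanishing: "\<sigma> \<in> signs \<Longrightarrow> a \<in> nonvanishing \<Longrightarrow> flip \<sigma> a \<in> nonvanishing"
  by (simp add: signs_def nonvanishing_def flip_def) (metis neg_equal_0_iff_equal zero_neq_one)

text \<open>Parity extends to all of \<open>D\<close> by density; then \<open>h\<close> vanishes on
  the hyperplane \<open>a $ j = 0\<close>, which the reflection fixes pointwise.\<close>

lemma smooth_odd_division:
  fixes h :: "real^'n::finite \<Rightarrow> real"
  assumes D: "open D" "\<And>a. a \<in> D \<Longrightarrow> flip (\<chi> k. if k = j then -1 else 1) a \<in> D" and h: "smooth_on D h"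
    and odd: "\<And>a. a \<in> D \<Longrightarrow> a \<in> nonvanishing \<Longrightarrow> h (flip (\<chi> k. if k = j then -1 else 1) a) = - h a"
  obtains q where "smooth_on D q" "\<And>a. a \<in> D \<Longrightarrow> h a = a $ j * q a"
proof -
  let ?\<rho> = "flip (\<chi> k. if k = j then -1 else 1)"
  have c: "continuous_on D h" using h by (rule smooth_on_continuous)
  have odd': "h (?\<rho> a) = - h a" if a: "a \<in> D" for a
    by (rule continuous_on_eq_on_dense[OF _ _ _ nonvanishing_dense[OF D(1)] a, where f="\<lambda>a. h (?\<rho> a)"])
      (use D(2) odd in \<open>auto intro!: continuous_intros c continuous_on_compose2[OF c]
        bounded_linear.continuous_on[OF bounded_linear_flip]\<close>)
  have "h a = 0" if "a \<in> D" "a $ j = 0" for a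
  proof -
    have "?\<rho> a = a" using that by (auto simp: flip_def vec_eq_iff)
    then show ?thesis using odd'[OF that(1)] by simp
  qed
  from smooth_division[OF D(1) h this] that show thesis by blast
qed

text \<open>\<open>S\<close> is later the neighbourhood of a vertex in its facet coordinates, with
  corners, and \<open>R\<close> the corresponding real slice of the chart, which is open. Functions
  on \<open>S\<close> are studied as even functions on \<open>R\<close>.\<close>

locale orthant_domain =
  fixes S :: "(real^'n::finite) set"
  assumes S_convex: "convex S" and S_nonneg: "x \<in> S \<Longrightarrow> x $ k \<ge> 0"
    and S_open: "open {a. half_square a \<in> S}"
begin

abbreviation "R \<equiv> {a. half_square a \<in> S}"

lemma flip_R: "\<sigma> \<in> signs \<Longrightarrow> a \<in> R \<Longrightarrow> flip \<sigma> a \<in> R"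
  by (simp add: half_square_flip)

lemma double_root_R: "x \<in> S \<Longrightarrow> double_root x \<in> R"
  using S_nonneg by (simp add: half_square_double_root)

lemma continuous_double_root: "continuous_on S double_root"
  unfolding double_root_def by (intro continuous_on_vec_lambda continuous_intros)

definition sign_even :: "(real^'n \<Rightarrow> real) \<Rightarrow> bool" where
  "sign_even f \<longleftrightarrow> (\<forall>a\<in>R. \<forall>\<sigma>\<in>signs. f (flip \<sigma> a) = f a)"

lemma even_on_dense:
  assumes "smooth_on R f" "\<And>a \<sigma>. a \<in> R \<Longrightarrow> a \<in> nonvanishing \<Longrightarrow> \<sigma> \<in> signs \<Longrightarrow> f (flip \<sigma> a) = f a"
  shows "sign_even f"
  unfolding sign_even_def
proof (intro ballI)
  fix a \<sigma> assume a: "a \<in> R" and \<sigma>: "(\<sigma> :: real^'n) \<in> signs"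
  note c = smooth_on_continuous[OF assms(1)]
  show "f (flip \<sigma> a) = f a"
    by (rule continuous_on_eq_on_dense[OF _ c _ nonvanishing_dense[OF S_open] a, where f="\<lambda>a. f (flip \<sigma> a)"])
      (use flip_R \<sigma> assms(2) in \<open>auto intro!: continuous_on_compose2[OF c]
        bounded_linear.continuous_on[OF bounded_linear_flip]\<close>)
qed

text \<open>Differentiating \<open>f (flip \<sigma> a) = f a\<close> shows that the
  \<open>j\<close>-th partial derivative is odd in \<open>a $ j\<close> and even in the other
  coordinates. Its quotient by \<open>a $ j\<close> is therefore smooth and even again, which feeds
  the induction of \<open>Ck_on_even\<close>.\<close>

lemma even_derivative:
  assumes f: "smooth_on R f" "sign_even f"
    and f': "\<And>a. a \<in> R \<Longrightarrow> (f has_derivative f' a) (at a within R)" "\<And>v. smooth_on R (\<lambda>a. f' a v)"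
  obtains q where "smooth_on R q" "sign_even q" "\<And>a. a \<in> R \<Longrightarrow> f' a (axis j 1) = a $ j * q a"
proof -
  let ?g = "\<lambda>a. f' a (axis j 1)"
  have tr: "?g (flip \<sigma> a) * \<sigma> $ j = ?g a" if a: "a \<in> R" and \<sigma>: "\<sigma> \<in> signs" for a \<sigma>
  proof -
    have lin: "linear (f' (flip \<sigma> a))"
      using f'(1)[OF flip_R[OF \<sigma> a]] by (rule has_derivative_linear)
    have "((\<lambda>a. f (flip \<sigma> a)) has_derivative (\<lambda>v. f' (flip \<sigma> a) (flip \<sigma> v))) (at a within R)"
    proof (rule has_derivative_in_compose[where f="flip \<sigma>"])
      show "(f has_derivative f' (flip \<sigma> a)) (at (flip \<sigma> a) within flip \<sigma> ` R)"
        by (rule has_derivative_subset[OF f'(1)[OF flip_R[OF \<sigma> a]]]) (use flip_R[OF \<sigma>] in blast)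
    qed (rule bounded_linear_imp_has_derivative[OF bounded_linear_flip])
    then have "(f has_derivative (\<lambda>v. f' (flip \<sigma> a) (flip \<sigma> v))) (at a within R)"
      by (rule has_derivative_transform[rotated 2]) (use a \<sigma> f(2) in \<open>auto simp: sign_even_def\<close>)
    from thick_has_derivative_unique[OF thick_open[OF S_open] a this f'(1)[OF a]]
    have "f' (flip \<sigma> a) (flip \<sigma> (axis j 1)) = ?g a" by metis
    moreover have "flip \<sigma> (axis j 1) = \<sigma> $ j *\<^sub>R axis j 1"
      by (auto simp: flip_def axis_def vec_eq_iff)
    ultimately show ?thesis by (simp add: linear_scale[OF lin] mult.commute)
  qed
  have sg: "(\<chi> k. if k = j then -1 else 1) \<in> signs" by (simp add: signs_def)
  obtain q where q: "smooth_on R q" "\<And>a. a \<in> R \<Longrightarrow> ?g a = a $ j * q a"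
  proof (rule smooth_odd_division[OF S_open _ f'(2), of j "axis j 1"])
    fix a assume a: "a \<in> R"
    show "flip (\<chi> k. if k = j then -1 else 1) a \<in> R" using flip_R[OF sg a] .
    show "?g (flip (\<chi> k. if k = j then -1 else 1) a) = - ?g a" using tr[OF a sg] by simp
  qed blast
  moreover have "sign_even q"
  proof (rule even_on_dense[OF q(1)])
    fix a \<sigma> assume a: "a \<in> R" "a \<in> nonvanishing" and \<sigma>: "(\<sigma> :: real^'n) \<in> signs"
    have "\<sigma> $ j * \<sigma> $ j = 1" using \<sigma> by (auto simp: signs_def) (metis minus_mult_minus mult_1)
    moreover have "flip \<sigma> a $ j * q (flip \<sigma> a) * \<sigma> $ j = a $ j * q a"
      using tr[OF a(1) \<sigma>] q(2)[OF a(1)] q(2)[OF flip_R[OF \<sigma> a(1)]] by simp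
    then have "(\<sigma> $ j * \<sigma> $ j) * a $ j * q (flip \<sigma> a) = a $ j * q a"
      by (simp add: flip_def mult_ac)
    ultimately show "q (flip \<sigma> a) = q a" using a(2) by (simp add: nonvanishing_def)
  qed
  ultimately show thesis using that by blast
qed

text \<open>Along a segment of \<open>S\<close> the root \<open>double_root\<close> is differentiable: a coordinate that vanishes
  in the interior of the segment vanishes identically.\<close>

lemma double_root_segment_derivative:
  assumes x: "x \<in> S" "y \<in> S" and s: "0 < s" "s < 1"
    and f: "smooth_on R f"
    and f': "\<And>a. a \<in> R \<Longrightarrow> (f has_derivative f' a) (at a within R)"
    and q: "\<And>j a. a \<in> R \<Longrightarrow> f' a (axis j 1) = a $ j * q j a"
  shows "((\<lambda>s. f (double_root (x + s *\<^sub>R (y - x)))) has_real_derivative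
     (\<Sum>j\<in>UNIV. (y - x) $ j * (2 * q j (double_root (x + s *\<^sub>R (y - x)))))) (at s)"
proof -
  let ?p = "\<lambda>s. x + s *\<^sub>R (y - x)"
  have pS: "?p s \<in> S"
  proof -
    have "(1 - s) *\<^sub>R x + s *\<^sub>R y \<in> S" using S_convex x s by (intro convexD) auto
    then show ?thesis by (simp add: algebra_simps)
  qed
  let ?a = "double_root (?p s)"
  have aR: "?a \<in> R" using double_root_R[OF pS] .
  \<comment> \<open>The velocity of \<open>double_root\<close> along the segment. The value 0 is
    right where the root vanishes, since that coordinate is then 0 on the whole segment.\<close>
  define w where "w = (\<chi> j. if ?a $ j = 0 then 0 else 2 * (y - x) $ j / ?a $ j)"
  have w: "?a $ j * w $ j = 2 * (y - x) $ j"
    and dw: "((\<lambda>s. 2 * sqrt (?p s $ j)) has_real_derivative w $ j) (at s)" for j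
  proof -
    have "?a $ j * w $ j = 2 * (y - x) $ j \<and> ((\<lambda>s. 2 * sqrt (?p s $ j)) has_real_derivative w $ j) (at s)"
    proof (cases "?a $ j = 0")
      case True
      then have "?p s $ j = 0" by (simp add: double_root_def)
      then have 0: "(1 - s) * x $ j + s * y $ j = 0" by (simp add: algebra_simps)
      moreover have "(1 - s) * x $ j \<ge> 0" "s * y $ j \<ge> 0" using S_nonneg x s by simp_all
      ultimately have "(1 - s) * x $ j = 0" "s * y $ j = 0" by linarith+
      then have "x $ j = 0" "y $ j = 0" using s by auto
      then show ?thesis by (simp add: w_def True)
    next
      case False
      have "?p s $ j \<noteq> 0" using False by (simp add: double_root_def)
      moreover have "?p s $ j \<ge> 0" using S_nonneg[OF pS] .
      ultimately have pos: "?p s $ j > 0" by linarith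
      then have "x $ j + s * (y $ j - x $ j) > 0" by simp
      then have "((\<lambda>s. 2 * sqrt (?p s $ j)) has_real_derivative w $ j) (at s)"
        using False by (auto intro!: derivative_eq_intros simp: w_def double_root_def field_simps)
      then show ?thesis using False by (simp add: w_def)
    qed
    then show "?a $ j * w $ j = 2 * (y - x) $ j" "((\<lambda>s. 2 * sqrt (?p s $ j)) has_real_derivative w $ j) (at s)"
      by blast+
  qed
  have "((\<lambda>s. double_root (?p s)) has_derivative (\<lambda>h. h *\<^sub>R w)) (at s)"
  proof (rule has_derivative_componentwise_within[THEN iffD2], rule ballI)
    fix i :: "real^'n" assume "i \<in> Basis"
    then obtain j where i: "i = axis j 1" by (auto simp: Basis_vec_def)
    show "((\<lambda>s. double_root (?p s) \<bullet> i) has_derivative (\<lambda>h. (h *\<^sub>R w) \<bullet> i)) (at s)"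
      using dw[of j] by (simp add: i inner_axis double_root_def has_field_derivative_def mult.commute[of _ "w $ j"])
  qed
  moreover have "(f has_derivative f' ?a) (at ?a)"
    using f'[OF aR] at_within_open[OF aR S_open] by simp
  ultimately have "((\<lambda>s. f (double_root (?p s))) has_derivative (\<lambda>h. f' ?a (h *\<^sub>R w))) (at s)"
    by (rule has_derivative_compose)
  moreover have lin: "linear (f' ?a)" using f'[OF aR] by (rule has_derivative_linear)
  \<comment> \<open>Each partial derivative carries a factor \<open>?a $ j\<close>, so only the
    products \<open>?a $ j * w $ j\<close> enter, and these are free of divisions.\<close>
  moreover have "f' ?a w = (\<Sum>j\<in>UNIV. (y - x) $ j * (2 * q j ?a))"
    unfolding linear_real_expand[OF lin, of w]
  proof (rule sum.cong)
    fix j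
    have "w $ j * f' ?a (axis j 1) = (?a $ j * w $ j) * q j ?a" using q[OF aR, of j] by simp
    then show "w $ j * f' ?a (axis j 1) = (y - x) $ j * (2 * q j ?a)" unfolding w by simp
  qed simp
  ultimately show ?thesis
    unfolding has_field_derivative_def
    by (elim has_derivative_eq_rhs) (simp add: fun_eq_iff linear_scale[OF lin])
qed

text \<open>From \<open>x = a^2 / 4\<close> one has \<open>da / dx = 2 / a\<close>. The factor
  \<open>a $ j\<close> of the partial derivative cancels this pole and leaves \<open>2 * q j\<close>
  with \<open>q j\<close> even, so the induction hypothesis applies to the derivative.\<close>

lemma Ck_on_even:
  "smooth_on R f \<Longrightarrow> sign_even f \<Longrightarrow> Ck_on k S (\<lambda>x. f (double_root x))"
proof (induction k arbitrary: f)
  case 0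
  have "continuous_on S (\<lambda>x. f (double_root x))"
    by (rule continuous_on_compose2[OF smooth_on_continuous[OF 0(1)] continuous_double_root])
      (use double_root_R in blast)
  then show ?case by simp
next
  case (Suc k)
  obtain f' where f': "\<And>a. a \<in> R \<Longrightarrow> (f has_derivative f' a) (at a within R)"
    "\<And>v. smooth_on R (\<lambda>a. f' a v)"
    using smooth_on_derivative[OF thick_open[OF S_open] Suc.prems(1)] by blast
  have "\<exists>q. smooth_on R q \<and> sign_even q \<and> (\<forall>a\<in>R. f' a (axis j 1) = a $ j * q a)" for j
    using even_derivative[OF Suc.prems f', of j] by metis
  then obtain q where q: "\<And>j. smooth_on R (q j)" "\<And>j. sign_even (q j)"
    "\<And>j a. a \<in> R \<Longrightarrow> f' a (axis j 1) = a $ j * q j a" by metis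
  let ?F = "\<lambda>x v. \<Sum>j\<in>UNIV. v $ j * (2 * q j (double_root x))"
  have Ck: "Ck_on k S (\<lambda>x. ?F x v)" for v
    by (intro Ck_on_sum Ck_on_bilinear[OF bounded_bilinear_mult] Ck_on_const Suc.IH q)
  show ?case
  proof (rule Ck_on_SucI[where f'="?F"])
    fix x assume x: "x \<in> S"
    show "((\<lambda>x. f (double_root x)) has_derivative ?F x) (at x within S)"
    proof (rule has_derivative_within_convexI[OF S_convex x])
      show "continuous_on S (\<lambda>x. f (double_root x))"
        by (rule continuous_on_compose2[OF smooth_on_continuous[OF Suc.prems(1)] continuous_double_root])
          (use double_root_R in blast)
      show "continuous_on S (\<lambda>z. ?F z v)" for v
        using Ck by (rule Ck_on_continuous)
      show lin: "linear (?F z)" "linear (?F x)" for z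
        by (rule linearI; simp add: algebra_simps sum.distrib sum_distrib_left)+
      show "((\<lambda>s. f (double_root (x + s *\<^sub>R (y - x)))) has_real_derivative ?F (x + s *\<^sub>R (y - x)) (y - x)) (at s)"
        if "y \<in> S" "0 < s" "s < 1" for y s
        using double_root_segment_derivative[OF x that Suc.prems(1) f'(1) q(3)] .
    qed
  qed (rule Ck)
qed

text \<open>Two divisions by parity. For \<open>i \<noteq> j\<close>, \<open>t\<close> is odd in
  \<open>a $ i\<close> and the quotient is odd in \<open>a $ j\<close>. For \<open>i = j\<close>,
  \<open>t\<close> is even and parity gives no zero, which is why \<open>diag\<close> is required;
  afterwards \<open>a $ i * C\<close> is odd.\<close>

lemma smooth_factor_through_square:
  assumes t: "smooth_on R t"
    and C: "\<And>a. a \<in> R \<Longrightarrow> a \<in> nonvanishing \<Longrightarrow> t a = a $ i * a $ j * C (half_square a)"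
    and diag: "\<And>a. a \<in> R \<Longrightarrow> i = j \<Longrightarrow> a $ i = 0 \<Longrightarrow> t a = 0"
  obtains c where "smooth_on S c"
    "\<And>x. x \<in> S \<Longrightarrow> (\<And>k. x $ k > 0) \<Longrightarrow> c x = C x"
proof -
  let ?\<rho> = "\<lambda>j::'n. \<chi> k. if k = j then -1 else (1::real)"
  have sg: "?\<rho> j \<in> signs" for j by (simp add: signs_def)
  obtain q1 where q1: "smooth_on R q1" "\<And>a. a \<in> R \<Longrightarrow> t a = a $ i * q1 a"
  proof (cases "i = j")
    case True
    from smooth_division[OF S_open t diag[OF _ True]] that show thesis by blast
  next
    case False
    show thesis
    proof (rule smooth_odd_division[OF S_open _ t])
      fix a assume a: "a \<in> R"
      show "flip (?\<rho> i) a \<in> R" using flip_R[OF sg a] .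
      assume nz: "a \<in> nonvanishing"
      show "t (flip (?\<rho> i) a) = - t a"
        unfolding C[OF a nz] C[OF flip_R[OF sg a] flip_nonvanishing[OF sg nz]] half_square_flip[OF sg]
        using False by (simp add: flip_def)
    qed (rule that)
  qed
  have q1': "q1 a = a $ j * C (half_square a)" if "a \<in> R" "a \<in> nonvanishing" for a
    using C[OF that] q1(2)[OF that(1)] that(2) by (simp add: nonvanishing_def)
  obtain q where q: "smooth_on R q" "\<And>a. a \<in> R \<Longrightarrow> q1 a = a $ j * q a"
  proof (rule smooth_odd_division[OF S_open _ q1(1)])
    fix a assume a: "a \<in> R"
    show "flip (?\<rho> j) a \<in> R" using flip_R[OF sg a] .
    assume nz: "a \<in> nonvanishing"
    show "q1 (flip (?\<rho> j) a) = - q1 a"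
      unfolding q1'[OF a nz] q1'[OF flip_R[OF sg a] flip_nonvanishing[OF sg nz]] half_square_flip[OF sg]
      by (simp add: flip_def)
  qed blast
  have qC: "q a = C (half_square a)" if "a \<in> R" "a \<in> nonvanishing" for a
    using q1'[OF that] q(2)[OF that(1)] that(2) by (simp add: nonvanishing_def)
  have "sign_even q"
    by (rule even_on_dense[OF q(1)])
      (use qC flip_R flip_nonvanishing half_square_flip in metis)
  then have "smooth_on S (\<lambda>x. q (double_root x))"
    using Ck_on_even[OF q(1)] by (simp add: smooth_on_def)
  moreover have "q (double_root x) = C x" if "x \<in> S" "\<And>k. x $ k > 0" for x
  proof -
    have "double_root x \<in> nonvanishing" using that(2) by (simp add: nonvanishing_def double_root_def less_imp_neq[symmetric])
    with qC[OF double_root_R[OF that(1)]] show ?thesis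
      using half_square_double_root[of x] that(2) by (simp add: less_imp_le)
  qed
  ultimately show thesis by (rule that)
qed

end


section \<open>Vertex charts\<close>

lemma has_derivative_vec_lambda:
  fixes f :: "'a::real_normed_vector \<Rightarrow> 'n::finite \<Rightarrow> real"
  assumes "\<And>j. ((\<lambda>x. f x j) has_derivative (\<lambda>v. f' v j)) (at x within S)"
  shows "((\<lambda>x. \<chi> j. f x j) has_derivative (\<lambda>v. \<chi> j. f' v j)) (at x within S)"
proof (rule has_derivative_componentwise_within[THEN iffD2], rule ballI)
  fix i :: "real^'n" assume "i \<in> Basis"
  then obtain j where i: "i = axis j 1" by (auto simp: Basis_vec_def)
  show "((\<lambda>x. (\<chi> j. f x j) \<bullet> i) has_derivative (\<lambda>v. (\<chi> j. f' v j) \<bullet> i)) (at x within S)"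
    using assms[of j] by (simp add: i inner_axis)
qed

declare transpose_matrix_vector [simp del]

fun chart_moment :: "('n::finite, 'r) facet_data \<Rightarrow> ('n, 'r) chart \<Rightarrow> 'n coords \<Rightarrow> real^'n" where
  "chart_moment L None p = fst p"
| "chart_moment L (Some e) p = vertex_moment L e p"

definition facet_matrix :: "('n::finite, 'r) facet_data \<Rightarrow> ('n \<Rightarrow> 'r) \<Rightarrow> real^'n^'n" where
  "facet_matrix L e = (\<chi> j. conormal L (e j))"

definition facet_coords :: "('n::finite, 'r) facet_data \<Rightarrow> ('n \<Rightarrow> 'r) \<Rightarrow> real^'n \<Rightarrow> real^'n" where
  "facet_coords L e y = (\<chi> j. ell L (e j) y)"

abbreviation facet_inv :: "('n::finite, 'r) facet_data \<Rightarrow> ('n \<Rightarrow> 'r) \<Rightarrow> real^'n^'n" where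
  "facet_inv L e \<equiv> matrix_inv (facet_matrix L e)"

text \<open>\<open>chart_lift\<close> expresses the identity of \<open>M\<degree>\<close> from the coordinates \<open>(y, w)\<close> to a chart;
  \<open>chart_frame\<close> is its derivative as a function of the point of the chart.\<close>

fun chart_lift :: "('n::finite, 'r) facet_data \<Rightarrow> ('n, 'r) chart \<Rightarrow> 'n coords \<Rightarrow> 'n coords" where
  "chart_lift L None q = q"
| "chart_lift L (Some e) q =
    ((\<chi> j. 2 * sqrt (facet_coords L e (fst q) $ j) * cos ((transpose (facet_inv L e) *v snd q) $ j / 2)),
     (\<chi> j. 2 * sqrt (facet_coords L e (fst q) $ j) * sin ((transpose (facet_inv L e) *v snd q) $ j / 2)))"

definition radius2 :: "'n::finite coords \<Rightarrow> 'n \<Rightarrow> real" where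
  "radius2 p j = (fst p $ j)\<^sup>2 + (snd p $ j)\<^sup>2"

fun chart_frame :: "('n::finite, 'r) facet_data \<Rightarrow> ('n, 'r) chart \<Rightarrow> 'n coords \<Rightarrow> 'n endo" where
  "chart_frame L None p X = X"
| "chart_frame L (Some e) p X =
    ((\<chi> j. 2 * fst p $ j / radius2 p j * (facet_matrix L e *v fst X) $ j
        - snd p $ j / 2 * (transpose (facet_inv L e) *v snd X) $ j),
     (\<chi> j. 2 * snd p $ j / radius2 p j * (facet_matrix L e *v fst X) $ j
        + fst p $ j / 2 * (transpose (facet_inv L e) *v snd X) $ j))"

section \<open>Fibres of the moment map and the period lattice\<close>

lemma act_toric_point: "act t (toric_point L y w) = toric_point L y (w + t)"
proof -
  have "(+) t ` {w + s + k | s k. s \<in> span (conormal L ` active L y) \<and> k \<in> period_lattice} =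
     {w + t + s + k | s k. s \<in> span (conormal L ` active L y) \<and> k \<in> period_lattice}"
    (is "(+) t ` ?A = ?B")
  proof
    show "?B \<subseteq> (+) t ` ?A"
    proof
      fix x assume "x \<in> ?B"
      then obtain s k where "x = w + t + s + k" "s \<in> span (conormal L ` active L y)" "k \<in> period_lattice"
        by blast
      then show "x \<in> (+) t ` ?A" by (intro image_eqI[of _ _ "w + s + k"]) (simp add: add_ac, blast)
    qed
  qed (simp add: image_subset_iff, intro allI impI, elim exE conjE, simp add: add_ac, blast)
  then show ?thesis by (simp add: act_def toric_point_def)
qed

lemma act_0: "act 0 = (id :: 'n::finite point \<Rightarrow> 'n point)"
  by (auto simp: act_def fun_eq_iff)

lemma fst_toric_point [simp]: "fst (toric_point L y w) = y"
  by (simp add: toric_point_def)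

lemma fst_param: "fst (param L c p) = chart_moment L c p"
  by (cases c) auto

lemma zero_in_period_lattice: "0 \<in> period_lattice"
  by (auto simp: period_lattice_def intro: exI[of _ 0])

text \<open>Without active facets the span of collapsed directions is 0, so the angle is determined
  up to periods.\<close>

lemma toric_point_eq_interior:
  assumes "toric_point L y w = toric_point L y w'" "active L y = {}"
  shows "w - w' \<in> period_lattice"
proof -
  have "w \<in> snd (toric_point L y w)"
    unfolding toric_point_def snd_conv
    by (intro CollectI exI[of _ 0]) (simp add: zero_in_period_lattice span_zero)
  then have "w \<in> snd (toric_point L y w')" by (simp only: assms)
  then show ?thesis by (auto simp: toric_point_def assms(2))
qed

text \<open>Nonzero entries of periods are at least \<open>4 * pi\<close> in absolute value. A
  continuous function with values in the lattice is thus locally constant, as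
  \<open>lift_frame\<close> needs.\<close>

lemma period_lattice_discrete:
  assumes "k \<in> period_lattice" "norm k < 4 * pi"
  shows "k = 0"
proof -
  have "k $ i = 0" for i
  proof -
    obtain m :: int where m: "k $ i = 4 * pi * m" using assms(1) by (auto simp: period_lattice_def)
    have "\<bar>k $ i\<bar> < 4 * pi" using component_le_norm_cart[of k i] assms(2) by linarith
    then have "\<bar>real_of_int m\<bar> < 1" by (simp add: m abs_mult)
    then show ?thesis by (simp add: m)
  qed
  then show ?thesis by (simp add: vec_eq_iff)
qed

lemma period_lattice_diff: "k \<in> period_lattice \<Longrightarrow> l \<in> period_lattice \<Longrightarrow> k - l \<in> period_lattice"
  unfolding period_lattice_def by auto (metis of_int_diff right_diff_distrib)

lemma smooth_on_ell [smooth_intros]: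
  "smooth_on S f \<Longrightarrow> smooth_on S (\<lambda>x. ell L r (f x))"
  unfolding ell_def by (intro smooth_intros)

lemma continuous_on_ell [continuous_intros]:
  "continuous_on S f \<Longrightarrow> continuous_on S (\<lambda>x. ell L r (f x))"
  unfolding ell_def by (intro continuous_intros)

section \<open>The interior of the polytope\<close>

locale delzant_polytope =
  fixes L :: "('n::finite, 'r::finite) facet_data"
  assumes delzant: "delzant L"
begin

abbreviation "P \<equiv> poly_P L"
abbreviation "Po \<equiv> interior (poly_P L)"

lemma convex_P: "convex P"
  using delzant by (simp add: delzant_def polytope_imp_convex)

lemma Po_nonempty: "Po \<noteq> {}"
  using delzant by (simp add: delzant_def)

lemma thick_P: "thick P"
  by (rule thick_convex[OF convex_P Po_nonempty])

lemma conormal_nonzero: "conormal L r \<noteq> 0"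
proof
  assume "conormal L r = 0"
  then have "range (\<lambda>i. fst (L r) $ i) = {0}" by (auto simp: conormal_def vec_eq_iff)
  moreover have "Gcd (range (\<lambda>i. fst (L r) $ i)) = 1" using delzant by (simp add: delzant_def)
  ultimately show False by simp
qed

text \<open>From an interior point a short move against the nonzero conormal stays in
  \<open>P\<close> and strictly decreases \<open>ell\<close>, which must therefore be positive at
  the start.\<close>

lemma Po_iff: "y \<in> Po \<longleftrightarrow> (\<forall>r. ell L r y > 0)"
proof
  assume y: "y \<in> Po"
  show "\<forall>r. ell L r y > 0"
  proof
    fix r
    obtain d where d: "d > 0" "ball y d \<subseteq> P" using y by (auto simp: mem_interior)
    define s where "s = d / (2 * norm (conormal L r))"
    have n: "norm (conormal L r) > 0" using conormal_nonzero by simp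
    then have s: "s > 0" using d by (simp add: s_def)
    have "norm (s *\<^sub>R conormal L r) < d" using n d s by (simp add: s_def)
    then have "y - s *\<^sub>R conormal L r \<in> P" using d(2) by (auto simp: dist_norm)
    then have "ell L r (y - s *\<^sub>R conormal L r) \<ge> 0" by (simp add: poly_P_def)
    moreover have "ell L r (y - s *\<^sub>R conormal L r) = ell L r y - s * (conormal L r \<bullet> conormal L r)"
      by (simp add: ell_def inner_diff_right)
    moreover have "s * (conormal L r \<bullet> conormal L r) > 0" using s conormal_nonzero by simp
    ultimately show "ell L r y > 0" by linarith
  qed
next
  assume "\<forall>r. ell L r y > 0"
  then have "y \<in> (\<Inter>r. {y. ell L r y > 0})" by simp
  moreover have "open (\<Inter>r. {y. ell L r y > 0})"
    by (intro open_INT ballI open_Collect_less continuous_intros) simp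
  moreover have "(\<Inter>r. {y. ell L r y > 0}) \<subseteq> P" by (auto simp: poly_P_def intro: less_imp_le)
  ultimately show "y \<in> Po" by (meson interiorI)
qed

lemma active_Po: "y \<in> Po \<Longrightarrow> active L y = {}"
  by (auto simp: Po_iff active_def less_irrefl) (metis less_irrefl)

end

section \<open>Polar coordinates at a vertex\<close>

locale vertex_chart = delzant_polytope L
  for L :: "('n::finite, 'r::finite) facet_data" +
  fixes e :: "'n \<Rightarrow> 'r"
  assumes chart: "Some e \<in> charts L"
begin

abbreviation "N \<equiv> facet_matrix L e"
abbreviation "Ni \<equiv> facet_inv L e"
abbreviation "xc \<equiv> facet_coords L e"
abbreviation "D \<equiv> dom_chart L (Some e)"

text \<open>The Delzant condition expands each standard basis vector in the conormals with integer
  coefficients, and these form a left inverse of \<open>N\<close>. Integrality is what converts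
  periods of \<open>w\<close> into full turns of the chart coordinates in
  \<open>param_inj\<close>.\<close>

lemma facet_inverse_exists:
  obtains C :: "real^'n^'n" where "C ** N = mat 1" "\<And>i j. C $ i $ j \<in> \<int>"
proof -
  obtain v where v: "inj e" "v extreme_point_of P" "range e = active L v"
    using chart by (auto simp: charts_def)
  have ib: "integral_basis L (range e)" using v delzant by (auto simp: delzant_def)
  have "\<exists>c. m = (\<Sum>r\<in>range e. c r *s fst (L r))" for m :: "int^'n"
  proof -
    from ib have "\<exists>!c. (\<forall>r. r \<notin> range e \<longrightarrow> c r = 0) \<and> m = (\<Sum>r\<in>range e. c r *s fst (L r))"
      unfolding integral_basis_def by (elim conjE allE)
    from ex1_implies_ex[OF this] show ?thesis by (elim exE conjE) (rule exI)
  qed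
  then have "\<forall>i. \<exists>c. axis i 1 = (\<Sum>r\<in>range e. c r *s fst (L r))" by blast
  from choice[OF this] obtain c :: "'n \<Rightarrow> 'r \<Rightarrow> int" where
    "\<And>i. axis i 1 = (\<Sum>r\<in>range e. c i r *s fst (L r))" by (elim exE) (rule that, simp)
  then have c: "(axis i 1 :: int^'n) = (\<Sum>j\<in>UNIV. c i (e j) *s fst (L (e j)))" for i
    by (simp add: sum.reindex[OF v(1)])
  define C :: "real^'n^'n" where "C = (\<chi> i j. of_int (c i (e j)))"
  have "(C ** N) $ i $ k = mat 1 $ i $ k" for i k
  proof -
    have "(axis i 1 :: int^'n) $ k = (\<Sum>j\<in>UNIV. c i (e j) * fst (L (e j)) $ k)" by (simp add: c)
    then have "real_of_int ((axis i 1 :: int^'n) $ k) = (\<Sum>j\<in>UNIV. of_int (c i (e j)) * of_int (fst (L (e j)) $ k))"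
      by simp
    then show ?thesis
      by (auto simp: C_def facet_matrix_def matrix_matrix_mult_def conormal_def mat_def axis_def split: if_splits)
  qed
  then have "C ** N = mat 1" by (simp add: vec_eq_iff)
  moreover have "C $ i $ j \<in> \<int>" for i j by (simp add: C_def)
  ultimately show thesis by (rule that)
qed

lemma det_N: "det N \<noteq> 0"
proof -
  obtain C where "C ** N = mat 1" by (rule facet_inverse_exists) blast
  then have "det C * det N = 1" by (metis det_I det_mul)
  then show ?thesis by auto
qed

lemma NNi: "N ** Ni = mat 1" and NiN: "Ni ** N = mat 1"
  using matrix_inv_right[OF det_N] matrix_inv_left[OF det_N] .

lemma NtNit: "transpose N ** transpose Ni = mat 1" and NitNt: "transpose Ni ** transpose N = mat 1"
  by (simp_all add: matrix_transpose_mul[symmetric] NNi NiN transpose_mat)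

lemma Ni_integral: "Ni $ i $ j \<in> \<int>"
proof -
  obtain C where C: "C ** N = mat 1" "\<And>i j. C $ i $ j \<in> \<int>" by (rule facet_inverse_exists) blast
  have "C = C ** (N ** Ni)" by (simp add: NNi)
  then have "C = Ni" by (simp add: matrix_mul_assoc C(1))
  then show ?thesis using C(2) by simp
qed

lemma xc_eq: "xc y = N *v y + (\<chi> j. snd (L (e j)))"
  by (simp add: facet_coords_def facet_matrix_def matrix_vector_mult_def vec_eq_iff ell_def inner_vec_def)

definition mu :: "real^'n \<Rightarrow> real^'n" where
  "mu x = Ni *v (x - (\<chi> j. snd (L (e j))))"

lemma xc_mu [simp]: "xc (mu x) = x"
  by (simp add: xc_eq mu_def matrix_vector_mul_assoc NNi)

lemma mu_xc [simp]: "mu (xc y) = y"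
  by (simp add: xc_eq mu_def matrix_vector_mul_assoc NiN)

lemma vertex_moment_eq: "vertex_moment L e p = mu (\<chi> j. radius2 p j / 4)"
proof -
  have "vertex_moment L e p = inv xc (xc (mu (\<chi> j. radius2 p j / 4)))"
    unfolding xc_mu by (simp only: vertex_moment_def radius2_def facet_coords_def[abs_def])
  also have "\<dots> = mu (\<chi> j. radius2 p j / 4)"
    by (rule inv_f_f) (metis injI mu_xc)
  finally show ?thesis .
qed

lemma xc_moment: "xc (vertex_moment L e p) $ j = radius2 p j / 4"
  by (simp add: vertex_moment_eq)

lemma smooth_on_mu [smooth_intros]: "smooth_on S f \<Longrightarrow> smooth_on S (\<lambda>x. mu (f x))"
  unfolding mu_def by (intro smooth_intros)

lemma smooth_on_xc [smooth_intros]: "smooth_on S f \<Longrightarrow> smooth_on S (\<lambda>x. xc (f x))"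
  unfolding facet_coords_def by (intro smooth_intros)

lemma smooth_on_moment: "smooth_on S (vertex_moment L e)"
  unfolding vertex_moment_eq[abs_def] radius2_def by (intro smooth_intros)

text \<open>The relatively open part of \<open>P\<close> that avoids the facets not through the
  vertex; the chart lives exactly over it, see \<open>D_iff\<close>.\<close>

definition Pe :: "(real^'n) set" where
  "Pe = {y \<in> P. \<forall>r. r \<notin> range e \<longrightarrow> ell L r y > 0}"

lemma Po_Pe: "Po \<subseteq> Pe"
  using Po_iff interior_subset[of P] by (auto simp: Pe_def)

lemma Pe_P: "Pe \<subseteq> P"
  by (auto simp: Pe_def)

lemma Po_xc: "y \<in> Po \<longleftrightarrow> y \<in> Pe \<and> (\<forall>j. xc y $ j > 0)"
proof -
  have "(\<forall>r. ell L r y > 0) \<longleftrightarrow> (\<forall>r. r \<notin> range e \<longrightarrow> ell L r y > 0) \<and> (\<forall>j. ell L (e j) y > 0)"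
    by (metis rangeE rangeI)
  moreover have "(\<forall>r. ell L r y > 0) \<Longrightarrow> y \<in> P" by (auto simp: poly_P_def intro: less_imp_le)
  ultimately show ?thesis by (auto simp: Po_iff Pe_def facet_coords_def)
qed

lemma Pe_nonneg: "y \<in> Pe \<Longrightarrow> xc y $ j \<ge> 0"
  by (auto simp: Pe_def poly_P_def facet_coords_def)

lemma Pe_relopen: "\<exists>U. open U \<and> Pe = P \<inter> U"
proof (intro exI conjI)
  let ?U = "\<Inter>r\<in>- range e. {y. ell L r y > 0}"
  show "open ?U" by (intro open_INT ballI open_Collect_less continuous_intros) simp
  show "Pe = P \<inter> ?U" by (auto simp: Pe_def)
qed

lemma convex_Pe: "convex Pe"
proof -
  have "Pe = P \<inter> (\<Inter>r\<in>- range e. {y. conormal L r \<bullet> y > - snd (L r)})"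
    by (auto simp: Pe_def ell_def algebra_simps minus_less_iff) (metis ComplI add.commute less_add_same_cancel1 minus_less_iff neg_less_iff_less real_0_less_add_iff)+
  then show ?thesis
    using convex_P by (auto intro!: convex_Int convex_INT convex_halfspace_gt)
qed

lemma Pe_dense: "Pe \<subseteq> closure (Pe \<inter> Po)"
proof -
  obtain U where U: "open U" "Pe = P \<inter> U" using Pe_relopen by blast
  have "Pe \<subseteq> U \<inter> closure Po"
    using convex_closure_interior[OF convex_P Po_nonempty] closure_subset[of P] U by auto
  also have "\<dots> \<subseteq> closure (U \<inter> Po)" by (rule open_Int_closure_subset[OF U(1)])
  also have "U \<inter> Po \<subseteq> Pe \<inter> Po" using Po_Pe U by auto
  finally show ?thesis using closure_mono by blast
qed

lemma D_iff: "p \<in> D \<longleftrightarrow> vertex_moment L e p \<in> Pe"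
proof -
  have "ell L (e j) (vertex_moment L e p) \<ge> 0" for j
  proof -
    have "radius2 p j \<ge> 0" by (simp add: radius2_def)
    then show ?thesis using xc_moment[of p j] by (simp add: facet_coords_def)
  qed
  then have "(\<forall>r. r \<notin> range e \<longrightarrow> ell L r (vertex_moment L e p) > 0) \<Longrightarrow> ell L r (vertex_moment L e p) \<ge> 0" for r
    by (cases "r \<in> range e") (auto intro: less_imp_le)
  then show ?thesis by (auto simp: Pe_def poly_P_def)
qed

lemma open_D: "open D"
proof -
  have "D = (\<Inter>r\<in>- range e. {p. ell L r (vertex_moment L e p) > 0})" by auto
  moreover have "continuous_on UNIV (vertex_moment L e)"
    by (rule smooth_on_continuous[OF smooth_on_moment])
  ultimately show ?thesis
    by (auto intro!: open_INT open_Collect_less continuous_intros)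
qed

lemma moment_Po_iff: "p \<in> D \<Longrightarrow> vertex_moment L e p \<in> Po \<longleftrightarrow> (\<forall>j. radius2 p j \<noteq> 0)"
  unfolding Po_xc D_iff xc_moment
  by (simp add: radius2_def sum_power2_gt_zero_iff sum_power2_eq_zero_iff)

text \<open>Points whose real parts are all nonzero have nonzero radii and are already
  dense.\<close>

lemma dense_Po:
  assumes "open V" "V \<subseteq> D"
  shows "V \<subseteq> closure (V \<inter> {p. vertex_moment L e p \<in> Po})"
proof -
  have "closure ((nonvanishing :: (real^'n) set) \<times> (UNIV :: (real^'n) set)) = UNIV"
    by (simp add: closure_Times closure_nonvanishing)
  then have "V \<subseteq> closure (V \<inter> (nonvanishing \<times> UNIV))"
    using open_Int_closure_subset[OF assms(1), of "nonvanishing \<times> UNIV"] by simp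
  also have "V \<inter> (nonvanishing \<times> UNIV) \<subseteq> V \<inter> {p. vertex_moment L e p \<in> Po}"
    using assms(2) by (auto simp: moment_Po_iff nonvanishing_def radius2_def sum_power2_eq_zero_iff
        simp del: dom_chart.simps)
  finally show ?thesis using closure_mono by blast
qed

lemma vertex_angle_eq:
  "vertex_angle L e p = transpose N *v (\<chi> j. 2 * Arg (Complex (fst p $ j) (snd p $ j)))"
  by (simp add: vertex_angle_def facet_matrix_def matrix_vector_mult_def vec_eq_iff transpose_def mult.commute)

lemma radius2_lift: "y \<in> Pe \<Longrightarrow> radius2 (chart_lift L (Some e) (y, w)) j = 4 * xc y $ j"
proof -
  assume "y \<in> Pe"
  then have "(sqrt (xc y $ j))\<^sup>2 = xc y $ j" using Pe_nonneg by simp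
  moreover have "radius2 (chart_lift L (Some e) (y, w)) j =
    4 * (sqrt (xc y $ j))\<^sup>2 * ((cos ((transpose Ni *v w) $ j / 2))\<^sup>2 + (sin ((transpose Ni *v w) $ j / 2))\<^sup>2)"
    by (simp add: radius2_def power_mult_distrib algebra_simps del: sin_cos_squared_add sin_cos_squared_add2)
  ultimately show ?thesis by simp
qed

lemma moment_lift: "y \<in> Pe \<Longrightarrow> vertex_moment L e (chart_lift L (Some e) (y, w)) = y"
  using mu_xc[of y] by (simp add: vertex_moment_eq radius2_lift del: chart_lift.simps mu_xc)

lemma lift_D: "y \<in> Pe \<Longrightarrow> chart_lift L (Some e) (y, w) \<in> D"
  by (simp only: D_iff moment_lift)

lemma period_lattice_integral: "(transpose N *v (\<chi> j. 4 * pi * of_int (m j))) \<in> period_lattice"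
  unfolding period_lattice_def
proof (intro CollectI allI)
  fix i
  have "(transpose N *v (\<chi> j. 4 * pi * of_int (m j))) $ i = 4 * pi * of_int (\<Sum>j\<in>UNIV. m j * fst (L (e j)) $ i)"
    by (simp add: facet_matrix_def transpose_def matrix_vector_mult_def conormal_def sum_distrib_left mult_ac)
  then show "\<exists>m'::int. (transpose N *v (\<chi> j. 4 * pi * of_int (m j))) $ i = 4 * pi * of_int m'" by blast
qed

text \<open>\<open>Arg\<close> recovers \<open>\<theta> $ j / 2\<close> up to multiples of
  \<open>2 * pi\<close>, hence \<open>\<theta> $ j\<close> up to multiples of \<open>4 * pi\<close>;
  combining the conormals with such coefficients gives a period, so the point of \<open>M\<close> is
  unaffected.\<close>

lemma param_lift:
  assumes y: "y \<in> Po"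
  shows "param L (Some e) (chart_lift L (Some e) (y, w)) = toric_point L y w"
proof -
  let ?p = "chart_lift L (Some e) (y, w)" and ?\<theta> = "transpose Ni *v w"
  have "\<exists>m::int. ?\<theta> $ j = 2 * Arg (Complex (fst ?p $ j) (snd ?p $ j)) + 4 * pi * of_int m" for j
  proof -
    have "2 * sqrt (xc y $ j) > 0" using y by (simp add: Po_xc)
    from half_angle_Arg[OF this, of "?\<theta> $ j"] show ?thesis by simp
  qed
  then obtain m :: "'n \<Rightarrow> int" where
    m: "\<And>j. ?\<theta> $ j = 2 * Arg (Complex (fst ?p $ j) (snd ?p $ j)) + 4 * pi * of_int (m j)" by metis
  let ?k = "transpose N *v (\<chi> j. 4 * pi * of_int (m j))"
  have "w = transpose N *v ?\<theta>" by (simp add: matrix_vector_mul_assoc NtNit)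
  also have "?\<theta> = (\<chi> j. 2 * Arg (Complex (fst ?p $ j) (snd ?p $ j))) + (\<chi> j. 4 * pi * of_int (m j))"
    by (simp only: vec_eq_iff vector_add_component vec_lambda_beta m) simp
  finally have "w = vertex_angle L e ?p + 0 + ?k"
    by (simp only: vertex_angle_eq matrix_vector_right_distrib add_0_right)
  from toric_point_cong[OF this span_zero period_lattice_integral]
  have "toric_point L y (vertex_angle L e ?p) = toric_point L y w" by metis
  moreover have "vertex_moment L e ?p = y" using y Po_Pe by (intro moment_lift) auto
  ultimately show ?thesis by (simp only: param.simps)
qed

lemma lift_surj:
  assumes p: "p \<in> D"
  obtains w where "chart_lift L (Some e) (vertex_moment L e p, w) = p"
proof
  let ?\<theta> = "\<chi> j. 2 * Arg (Complex (fst p $ j) (snd p $ j))"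
  let ?w = "transpose N *v ?\<theta>"
  have \<theta>: "transpose Ni *v ?w = ?\<theta>" by (simp add: matrix_vector_mul_assoc NitNt)
  have z: "2 * sqrt (radius2 p j / 4) * cos (Arg (Complex (fst p $ j) (snd p $ j))) = fst p $ j"
     "2 * sqrt (radius2 p j / 4) * sin (Arg (Complex (fst p $ j) (snd p $ j))) = snd p $ j" for j
  proof -
    let ?z = "Complex (fst p $ j) (snd p $ j)"
    have n: "2 * sqrt (radius2 p j / 4) = cmod ?z" by (simp add: radius2_def cmod_def real_sqrt_divide)
    have "?z = rcis (cmod ?z) (Arg ?z)" by (simp add: rcis_cmod_Arg)
    then have "Re ?z = cmod ?z * cos (Arg ?z)" "Im ?z = cmod ?z * sin (Arg ?z)"
      by (metis Re_rcis, metis Im_rcis)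
    then show "2 * sqrt (radius2 p j / 4) * cos (Arg ?z) = fst p $ j"
       "2 * sqrt (radius2 p j / 4) * sin (Arg ?z) = snd p $ j" unfolding n by simp_all
  qed
  show "chart_lift L (Some e) (vertex_moment L e p, ?w) = p"
    by (rule prod_eqI) (simp_all add: \<theta> vec_eq_iff xc_moment z)
qed

text \<open>Equal images have equal radii and angles that differ by a period. As \<open>Ni\<close>
  is integral, each \<open>2 * Arg\<close> differs by a multiple of \<open>4 * pi\<close>, so the
  complex coordinates coincide.\<close>

lemma param_inj:
  assumes p: "p \<in> D" "q \<in> D" and Po: "vertex_moment L e p \<in> Po"
    and eq: "param L (Some e) p = param L (Some e) q"
  shows "p = q"
proof -
  have m: "vertex_moment L e p = vertex_moment L e q"
    using arg_cong[OF eq, of fst] by (simp add: fst_param)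
  have "vertex_angle L e p - vertex_angle L e q \<in> period_lattice"
    using toric_point_eq_interior[of L "vertex_moment L e q"] eq active_Po[OF Po] by (simp add: m)
  then obtain k :: "'n \<Rightarrow> int" where "\<And>i. (vertex_angle L e p - vertex_angle L e q) $ i = 4 * pi * of_int (k i)"
    unfolding period_lattice_def by (auto simp del: vector_minus_component) metis
  then have k: "vertex_angle L e p - vertex_angle L e q = (\<chi> i. 4 * pi * of_int (k i))"
    by (simp only: vec_eq_iff vec_lambda_beta) simp
  let ?A = "\<lambda>p::'n coords. \<chi> j. 2 * Arg (Complex (fst p $ j) (snd p $ j))"
  have "transpose N *v (?A p - ?A q) = (\<chi> i. 4 * pi * of_int (k i))"
    unfolding k[symmetric] vertex_angle_eq by (simp add: matrix_vector_mult_diff_distrib)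
  then have "transpose Ni *v (transpose N *v (?A p - ?A q)) = transpose Ni *v (\<chi> i. 4 * pi * of_int (k i))"
    by simp
  then have A: "?A p - ?A q = transpose Ni *v (\<chi> i. 4 * pi * of_int (k i))"
    by (simp only: matrix_vector_mul_assoc NitNt matrix_vector_mul_lid)
  have z: "Complex (fst p $ j) (snd p $ j) = Complex (fst q $ j) (snd q $ j)" for j
  proof -
    let ?z = "Complex (fst p $ j) (snd p $ j)" and ?z' = "Complex (fst q $ j) (snd q $ j)"
    have "(\<Sum>i\<in>UNIV. Ni $ i $ j * of_int (k i)) \<in> \<int>"
      by (intro Ints_sum Ints_mult Ni_integral Ints_of_int)
    then obtain n where n: "(\<Sum>i\<in>UNIV. Ni $ i $ j * of_int (k i)) = of_int n" by (auto elim: Ints_cases)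
    have "2 * Arg ?z - 2 * Arg ?z' = (\<Sum>i\<in>UNIV. Ni $ i $ j * (4 * pi * of_int (k i)))"
      using arg_cong[OF A, of "\<lambda>v. v $ j"] by (simp add: matrix_vector_mult_def transpose_def)
    also have "\<dots> = 4 * pi * (\<Sum>i\<in>UNIV. Ni $ i $ j * of_int (k i))"
      by (simp add: sum_distrib_left mult_ac)
    finally have "Arg ?z = Arg ?z' + 2 * pi * of_int n" by (simp add: n)
    then have "cis (Arg ?z) = cis (Arg ?z')"
      by (simp add: complex_eq_iff) (metis cis.sel(1,2) cis_mult cis_multiple_2pi Ints_of_int mult.right_neutral)
    moreover have "cmod ?z = cmod ?z'"
      using xc_moment[of p j] xc_moment[of q j] by (simp add: m radius2_def cmod_def)
    ultimately show ?thesis by (metis rcis_cmod_Arg rcis_def)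
  qed
  have "fst p $ j = fst q $ j \<and> snd p $ j = snd q $ j" for j using z[of j] by simp
  then show ?thesis by (simp add: prod_eq_iff vec_eq_iff)
qed

lemma smooth_on_lift: "smooth_on (Po \<times> UNIV) (chart_lift L (Some e))"
  unfolding chart_lift.simps[abs_def] by (intro smooth_intros) (auto simp: Po_xc)

text \<open>With \<open>a = 2 sqrt x cos (\<theta>/2)\<close>,
  \<open>b = 2 sqrt x sin (\<theta>/2)\<close> and \<open>radius2 = 4 x\<close> one finds
  \<open>da = 2 a / radius2 dx - b / 2 d\<theta>\<close> and
  \<open>db = 2 b / radius2 dx + a / 2 d\<theta>\<close>: the angle itself disappears from the
  derivative.\<close>

lemma has_derivative_lift:
  assumes q: "fst q \<in> Po"
  shows "(chart_lift L (Some e) has_derivative chart_frame L (Some e) (chart_lift L (Some e) q)) (at q)"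
proof -
  define y w where "y = fst q" and "w = snd q"
  have yq: "q = (y, w)" by (simp add: y_def w_def)
  have y: "y \<in> Po" "y \<in> Pe" using q Po_Pe by (auto simp: y_def)
  let ?\<theta> = "\<lambda>j. (transpose Ni *v w) $ j" and ?p = "chart_lift L (Some e) q"
  have x: "xc y $ j > 0" for j using y Po_xc by simp
  have r: "radius2 ?p j = 4 * xc y $ j" for j using radius2_lift[OF y(2)] by (simp only: yq)
  have dx: "((\<lambda>q. xc (fst q) $ j) has_derivative (\<lambda>X. (N *v fst X) $ j)) (at q)" for j
  proof -
    have "bounded_linear (\<lambda>X::'n coords. (N *v fst X) $ j)"
      using bounded_linear_compose[OF bounded_linear_compose[OF bounded_linear_vec_nth matrix_vector_mul_bounded_linear] bounded_linear_fst] .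
    then show ?thesis unfolding xc_eq
      by (auto intro!: derivative_eq_intros bounded_linear_imp_has_derivative)
  qed
  have dw: "((\<lambda>q. (transpose Ni *v snd q) $ j / 2) has_derivative (\<lambda>X. (transpose Ni *v snd X) $ j / 2)) (at q)" for j
  proof -
    have "bounded_linear (\<lambda>X::'n coords. (transpose Ni *v snd X) $ j)"
      using bounded_linear_compose[OF bounded_linear_compose[OF bounded_linear_vec_nth matrix_vector_mul_bounded_linear] bounded_linear_snd] .
    then show ?thesis
      by (intro bounded_linear_imp_has_derivative bounded_linear_compose[OF bounded_linear_divide])
  qed
  have ds: "((\<lambda>q. 2 * sqrt (xc (fst q) $ j)) has_derivative (\<lambda>X. (N *v fst X) $ j / sqrt (xc y $ j))) (at q)" for j
    using has_derivative_real_sqrt[OF _ dx[of j]] x[of j]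
    by (auto intro!: derivative_eq_intros dx[unfolded yq] simp: yq field_simps)
  have dA: "((\<lambda>q. \<chi> j. 2 * sqrt (xc (fst q) $ j) * cos ((transpose Ni *v snd q) $ j / 2)) has_derivative
      (\<lambda>X. fst (chart_frame L (Some e) ?p X))) (at q)"
    unfolding chart_frame.simps fst_conv
  proof (rule has_derivative_vec_lambda)
    fix j
    have s: "sqrt (xc y $ j) * sqrt (xc y $ j) = xc y $ j" "sqrt (xc y $ j) \<noteq> 0" using x[of j] by auto
    show "((\<lambda>q. 2 * sqrt (xc (fst q) $ j) * cos ((transpose Ni *v snd q) $ j / 2)) has_derivative
      (\<lambda>X. 2 * fst ?p $ j / radius2 ?p j * (N *v fst X) $ j
        - snd ?p $ j / 2 * (transpose Ni *v snd X) $ j)) (at q)"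
      unfolding r
      by (rule has_derivative_eq_rhs[OF has_derivative_mult[OF ds has_derivative_cos[OF dw]]])
        (use s in \<open>simp add: fun_eq_iff yq field_simps\<close>)
  qed
  have dB: "((\<lambda>q. \<chi> j. 2 * sqrt (xc (fst q) $ j) * sin ((transpose Ni *v snd q) $ j / 2)) has_derivative
      (\<lambda>X. snd (chart_frame L (Some e) ?p X))) (at q)"
    unfolding chart_frame.simps snd_conv
  proof (rule has_derivative_vec_lambda)
    fix j
    have s: "sqrt (xc y $ j) * sqrt (xc y $ j) = xc y $ j" "sqrt (xc y $ j) \<noteq> 0" using x[of j] by auto
    show "((\<lambda>q. 2 * sqrt (xc (fst q) $ j) * sin ((transpose Ni *v snd q) $ j / 2)) has_derivative
      (\<lambda>X. 2 * snd ?p $ j / radius2 ?p j * (N *v fst X) $ j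
        + fst ?p $ j / 2 * (transpose Ni *v snd X) $ j)) (at q)"
      unfolding r
      by (rule has_derivative_eq_rhs[OF has_derivative_mult[OF ds has_derivative_sin[OF dw]]])
        (use s in \<open>simp add: fun_eq_iff yq field_simps\<close>)
  qed
  have eq: "chart_lift L (Some e) = (\<lambda>q. (\<chi> j. 2 * sqrt (xc (fst q) $ j) * cos ((transpose Ni *v snd q) $ j / 2),
      \<chi> j. 2 * sqrt (xc (fst q) $ j) * sin ((transpose Ni *v snd q) $ j / 2)))"
    by (rule ext) simp
  from has_derivative_Pair[OF dA dB]
  have "(chart_lift L (Some e) has_derivative
      (\<lambda>X. (fst (chart_frame L (Some e) ?p X), snd (chart_frame L (Some e) ?p X)))) (at q)"
    by (simp only: eq)
  then show ?thesis by (simp only: prod.collapse)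
qed

lemma frame_surj:
  assumes "\<And>j. radius2 p j \<noteq> 0"
  obtains Y where "chart_frame L (Some e) p Y = X"
proof
  \<comment> \<open>Inverse polar formulas: \<open>dx = (a da + b db) / 2\<close> and
    \<open>d\<theta> = 2 (a db - b da) / radius2\<close>.\<close>
  define \<alpha> where "\<alpha> = (\<chi> j. (fst p $ j * fst X $ j + snd p $ j * snd X $ j) / 2)"
  define \<beta> where "\<beta> = (\<chi> j. 2 * (fst p $ j * snd X $ j - snd p $ j * fst X $ j) / radius2 p j)"
  have *: "N *v (Ni *v \<alpha>) = \<alpha>" "transpose Ni *v (transpose N *v \<beta>) = \<beta>"
    by (simp_all add: matrix_vector_mul_assoc NNi NitNt)
  have r: "radius2 p j = fst p $ j * fst p $ j + snd p $ j * snd p $ j" for j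
    by (simp add: radius2_def power2_eq_square)
  have "2 * fst p $ j / radius2 p j * \<alpha> $ j - snd p $ j / 2 * \<beta> $ j = fst X $ j"
     "2 * snd p $ j / radius2 p j * \<alpha> $ j + fst p $ j / 2 * \<beta> $ j = snd X $ j" for j
  proof -
    have "2 * fst p $ j / radius2 p j * \<alpha> $ j - snd p $ j / 2 * \<beta> $ j = radius2 p j * fst X $ j / radius2 p j"
      unfolding \<alpha>_def \<beta>_def using assms[of j] by (simp add: divide_simps) (simp add: r algebra_simps)
    then show "2 * fst p $ j / radius2 p j * \<alpha> $ j - snd p $ j / 2 * \<beta> $ j = fst X $ j" using assms[of j] by simp
    have "2 * snd p $ j / radius2 p j * \<alpha> $ j + fst p $ j / 2 * \<beta> $ j = radius2 p j * snd X $ j / radius2 p j"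
      unfolding \<alpha>_def \<beta>_def using assms[of j] by (simp add: divide_simps) (simp add: r algebra_simps)
    then show "2 * snd p $ j / radius2 p j * \<alpha> $ j + fst p $ j / 2 * \<beta> $ j = snd X $ j" using assms[of j] by simp
  qed
  then show "chart_frame L (Some e) p (Ni *v \<alpha>, transpose N *v \<beta>) = X"
    by (simp add: * prod_eq_iff vec_eq_iff)
qed

text \<open>The vertex coordinates are Darboux: \<open>dx \<and> d\<theta> = da \<and> db\<close>
  holds coordinate by coordinate, and \<open>N\<close> and \<open>transpose Ni\<close> are dual
  changes of frame.\<close>

lemma frame_omega:
  assumes "\<And>j. radius2 p j \<noteq> 0"
  shows "omega (chart_frame L (Some e) p X) (chart_frame L (Some e) p Y) = omega X Y"
proof -
  have pair: "(N *v v) \<bullet> (transpose Ni *v w) = v \<bullet> w" for v w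
  proof -
    have "(N *v v) \<bullet> (transpose Ni *v w) = v \<bullet> (transpose N *v (transpose Ni *v w))"
      by (metis dot_lmul_matrix inner_commute transpose_matrix_vector)
    then show ?thesis by (simp add: matrix_vector_mul_assoc NtNit)
  qed
  have r: "radius2 p j = fst p $ j * fst p $ j + snd p $ j * snd p $ j" for j
    by (simp add: radius2_def power2_eq_square)
  let ?F = "chart_frame L (Some e) p"
  have "fst (?F X) $ j * snd (?F Y) $ j - snd (?F X) $ j * fst (?F Y) $ j =
     (N *v fst X) $ j * (transpose Ni *v snd Y) $ j - (transpose Ni *v snd X) $ j * (N *v fst Y) $ j" for j
  proof -
    define a b n n' t t' where "a = fst p $ j" "b = snd p $ j" "n = (N *v fst X) $ j" "n' = (N *v fst Y) $ j"
      "t = (transpose Ni *v snd X) $ j" "t' = (transpose Ni *v snd Y) $ j"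
    define R where "R = radius2 p j"
    have R: "R \<noteq> 0" "R = a * a + b * b" using assms[of j] r[of j] by (auto simp: R_def a_b_n_n'_t_t'_def)
    have "(2 * a / R * n - b / 2 * t) * (2 * b / R * n' + a / 2 * t') - (2 * b / R * n + a / 2 * t) * (2 * a / R * n' - b / 2 * t')
      = (a * a + b * b) / R * (n * t' - t * n')"
      using R(1) by (simp add: field_simps)
    moreover have "(a * a + b * b) / R = 1" using R by simp
    ultimately show ?thesis
      unfolding chart_frame.simps fst_conv snd_conv vec_lambda_beta
      by (simp only: a_b_n_n'_t_t'_def R_def mult_1)
  qed
  then have "(\<Sum>j\<in>UNIV. fst (?F X) $ j * snd (?F Y) $ j - snd (?F X) $ j * fst (?F Y) $ j) =
     (N *v fst X) \<bullet> (transpose Ni *v snd Y) - (transpose Ni *v snd X) \<bullet> (N *v fst Y)"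
    by (simp add: inner_vec_def sum_subtractf del: chart_frame.simps)
  then show ?thesis
    by (simp add: omega_def inner_vec_def[of "fst (?F X)"] inner_vec_def[of "snd (?F X)"] sum_subtractf
        pair inner_commute[of "transpose Ni *v snd X"] inner_commute[of "snd X"] del: chart_frame.simps)
qed

end


section \<open>Tensors in the charts\<close>

text \<open>Smoothness of fields is stated for constant arguments \<open>X\<close>; linearity
  extends it to arguments that vary smoothly, as in compositions of tensors.\<close>

lemma smooth_on_linear_family:
  fixes F :: "'a::real_normed_vector \<Rightarrow> 'b::euclidean_space \<Rightarrow> 'c::real_normed_vector"
  assumes "\<And>p. p \<in> S \<Longrightarrow> linear (F p)" "\<And>X. smooth_on S (\<lambda>p. F p X)" "smooth_on S v"
  shows "smooth_on S (\<lambda>p. F p (v p))"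
proof -
  have "smooth_on S (\<lambda>p. \<Sum>b\<in>Basis. (v p \<bullet> b) *\<^sub>R F p b)"
    by (intro smooth_intros assms)
  then show ?thesis
  proof (rule smooth_on_cong)
    fix p assume p: "p \<in> S"
    have "F p (v p) = F p (\<Sum>b\<in>Basis. (v p \<bullet> b) *\<^sub>R b)" by (simp only: euclidean_representation)
    then show "F p (v p) = (\<Sum>b\<in>Basis. (v p \<bullet> b) *\<^sub>R F p b)"
      by (simp only: linear_sum[OF assms(1)[OF p]] linear_scale[OF assms(1)[OF p]])
  qed
qed

context delzant_polytope
begin

lemma vertex_chartI: "Some e \<in> charts L \<Longrightarrow> vertex_chart L e"
  by unfold_locales

lemma open_dom_chart: "c \<in> charts L \<Longrightarrow> open (dom_chart L c)"
  by (cases c) (auto intro!: open_Times vertex_chart.open_D[OF vertex_chartI] simp del: dom_chart.simps(2))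

lemma dom_dense:
  assumes "c \<in> charts L" "open V" "V \<subseteq> dom_chart L c"
  shows "V \<subseteq> closure (V \<inter> {p. chart_moment L c p \<in> Po})"
proof (cases c)
  case None
  then have "V \<inter> {p. chart_moment L c p \<in> Po} = V" using assms by auto
  then show ?thesis using closure_subset by simp
next
  case (Some e)
  then show ?thesis using vertex_chart.dense_Po[OF vertex_chartI, of e V] assms by simp
qed

lemma radius2_nonzero:
  "Some e \<in> charts L \<Longrightarrow> p \<in> dom_chart L (Some e) \<Longrightarrow> vertex_moment L e p \<in> Po \<Longrightarrow> radius2 p j \<noteq> 0"
  using vertex_chart.moment_Po_iff[OF vertex_chartI] by blast

lemma chart_frame_surj:
  assumes "c \<in> charts L" "p \<in> dom_chart L c" "chart_moment L c p \<in> Po"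
  obtains Y where "chart_frame L c p Y = X"
proof (cases c)
  case (Some e)
  then have "\<And>j. radius2 p j \<noteq> 0" using assms radius2_nonzero[of e p] by simp
  from vertex_chart.frame_surj[OF vertex_chartI this, of e X] show thesis
    using that assms Some by metis
qed (simp add: that)

lemma chart_frame_omega:
  assumes "c \<in> charts L" "p \<in> dom_chart L c" "chart_moment L c p \<in> Po"
  shows "omega (chart_frame L c p X) (chart_frame L c p Y) = omega X Y"
proof (cases c)
  case (Some e)
  then have "\<And>j. radius2 p j \<noteq> 0" using assms radius2_nonzero[of e p] by simp
  from vertex_chart.frame_omega[OF vertex_chartI this, of e X Y] show ?thesis
    using assms Some by simp
qed simp

lemma has_derivative_chart_lift:
  assumes "c \<in> charts L" "fst q \<in> Po"
  shows "(chart_lift L c has_derivative chart_frame L c (chart_lift L c q)) (at q)"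
proof (cases c)
  case None
  have "chart_lift L None = (\<lambda>q. q)" "chart_frame L None q = (\<lambda>X. X)" by (simp_all add: fun_eq_iff)
  then show ?thesis by (simp add: None)
next
  case (Some e)
  then show ?thesis using vertex_chart.has_derivative_lift[OF vertex_chartI] assms by simp
qed

lemma chart_lift_surj:
  assumes "c \<in> charts L" "p \<in> dom_chart L c"
  obtains w where "chart_lift L c (chart_moment L c p, w) = p"
proof (cases c)
  case None
  then show thesis using that[of "snd p"] by simp
next
  case (Some e)
  with assms have "Some e \<in> charts L" "p \<in> dom_chart L (Some e)" by auto
  from vertex_chart.lift_surj[OF vertex_chartI[OF this(1)] this(2)] show thesis
    using that Some by (metis chart_moment.simps(2))
qed

lemma chart_lift_interior:
  assumes "c \<in> charts L" "fst q \<in> Po"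
  shows "chart_lift L c q \<in> dom_chart L c" "chart_moment L c (chart_lift L c q) = fst q"
    "param L c (chart_lift L c q) = toric_point L (fst q) (snd q)"
proof -
  have "chart_lift L c q \<in> dom_chart L c \<and> chart_moment L c (chart_lift L c q) = fst q \<and>
    param L c (chart_lift L c q) = toric_point L (fst q) (snd q)"
  proof (cases c)
    case None
    then show ?thesis using assms by (cases q) auto
  next
    case (Some e)
    with assms interpret vertex_chart L e by unfold_locales simp
    have "fst q \<in> Pe" using assms Po_Pe by auto
    from lift_D[OF this, of "snd q"] moment_lift[OF this, of "snd q"] param_lift[OF assms(2), of "snd q"]
    show ?thesis unfolding Some chart_moment.simps prod.collapse by blast
  qed
  then show "chart_lift L c q \<in> dom_chart L c" "chart_moment L c (chart_lift L c q) = fst q"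
    "param L c (chart_lift L c q) = toric_point L (fst q) (snd q)" by blast+
qed

lemma smooth_on_chart_lift: "c \<in> charts L \<Longrightarrow> smooth_on (Po \<times> UNIV) (chart_lift L c)"
proof (cases c)
  case None
  have "smooth_on (Po \<times> UNIV) (\<lambda>q. q)" by (rule smooth_on_id)
  then show ?thesis by (rule smooth_on_cong) (simp add: None)
next
  case (Some e)
  assume "c \<in> charts L"
  then show ?thesis using vertex_chart.smooth_on_lift[OF vertex_chartI] by (simp only: Some)
qed

section \<open>Lifts of translations over the free part\<close>

lemma lift_moment:
  assumes "local_lift L (act t) c c' N g" "p \<in> N"
  shows "chart_moment L c' (g p) = chart_moment L c p"
proof -
  have "param L c' (g p) = act t (param L c p)" using assms by (simp add: local_lift_def)
  from arg_cong[OF this, of fst] show ?thesis by (simp add: fst_param act_def)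
qed

text \<open>Over \<open>M\<degree>\<close> every local lift of a translation is, up to the period lattice, the translation
  in the coordinates \<open>(y, w)\<close>.\<close>

lemma lift_frame:
  assumes c: "c \<in> charts L" "c' \<in> charts L" and g: "local_lift L (act t) c c' N g"
    and p: "p \<in> N" "chart_moment L c p \<in> Po" and D: "(g has_derivative D) (at p)"
  shows "chart_frame L c' (g p) = D \<circ> chart_frame L c p"
proof -
  have N: "open N" "N \<subseteq> dom_chart L c" "g ` N \<subseteq> dom_chart L c'"
    "\<And>p. p \<in> N \<Longrightarrow> param L c' (g p) = act t (param L c p)"
    using g by (auto simp: local_lift_def)
  obtain w where w: "chart_lift L c (chart_moment L c p, w) = p"
    using chart_lift_surj c(1) p(1) N(2) by blast
  define q0 where "q0 = (chart_moment L c p, w)"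
  have q0: "chart_lift L c q0 = p" "fst q0 \<in> Po" using w p by (auto simp: q0_def)
  define V where "V = (Po \<times> UNIV) \<inter> chart_lift L c -` N"
  have "open V" unfolding V_def
    by (rule continuous_open_preimage[OF smooth_on_continuous[OF smooth_on_chart_lift[OF c(1)]]])
      (auto intro: open_Times N)
  have q0V: "q0 \<in> V" using q0 p by (cases q0) (auto simp: V_def)
  \<comment> \<open>\<open>g\<close> seen from the coordinates \<open>(y, w)\<close>. Near
    \<open>q0\<close> it is identified with an explicit map, and the two derivatives are
    compared.\<close>
  define k where "k q = g (chart_lift L c q)" for q
  have dk: "(k has_derivative (D \<circ> chart_frame L c p)) (at q0)"
    unfolding k_def[abs_def] o_def
    using has_derivative_compose[OF has_derivative_chart_lift[OF c(1) q0(2)]] D q0 by simp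
  have pk: "param L c' (k q) = toric_point L (fst q) (snd q + t)"
    and kN: "k q \<in> dom_chart L c'" and qPo: "fst q \<in> Po" if "q \<in> V" for q
  proof -
    have q: "fst q \<in> Po" "chart_lift L c q \<in> N" using that by (auto simp: V_def)
    then show "param L c' (k q) = toric_point L (fst q) (snd q + t)"
      by (simp add: k_def N chart_lift_interior(3)[OF c(1)] act_toric_point)
    show "k q \<in> dom_chart L c'" "fst q \<in> Po" using q N by (auto simp: k_def)
  qed
  show ?thesis
  proof (cases c')
    case (Some e)
    with c interpret vertex_chart L e by unfold_locales simp
    \<comment> \<open>Into a vertex chart \<open>k\<close> is forced, because \<open>param\<close>
      is injective over the interior.\<close>
    have eq: "chart_lift L c' (q + (0, t)) = k q" if q: "q \<in> V" for q
    proof -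
      have q': "fst (q + (0, t)) \<in> Po" using qPo[OF q] by simp
      note l = chart_lift_interior[OF c(2) q']
      have "chart_lift L (Some e) (q + (0, t)) = k q"
        by (rule param_inj)
          (use l pk[OF q] kN[OF q] qPo[OF q] in \<open>simp_all only: Some chart_moment.simps, simp_all\<close>)
      then show ?thesis by (simp only: Some)
    qed
    have "((\<lambda>q. chart_lift L c' (q + (0, t))) has_derivative
        (\<lambda>X. chart_frame L c' (chart_lift L c' (q0 + (0, t))) X)) (at q0)"
    proof (rule has_derivative_compose[of "\<lambda>q. q + (0, t)" "\<lambda>X. X"])
      show "((\<lambda>q. q + (0, t)) has_derivative (\<lambda>X. X)) (at q0)"
        by (auto intro!: derivative_eq_intros)
      show "(chart_lift L c' has_derivative chart_frame L c' (chart_lift L c' (q0 + (0, t)))) (at (q0 + (0, t)))"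
        using q0(2) by (intro has_derivative_chart_lift c) simp
    qed
    then have "(k has_derivative chart_frame L c' (k q0)) (at q0)"
      unfolding eq[OF q0V]
      by (rule has_derivative_transform_within_open[OF _ \<open>open V\<close> q0V]) (rule eq)
    then have "chart_frame L c' (k q0) = D \<circ> chart_frame L c p"
      using dk by (rule has_derivative_unique)
    then show ?thesis by (simp only: k_def q0(1))
  next
    case None
    \<comment> \<open>Into \<open>(y, w)\<close> the lift is determined only up to periods. The
      discrepancy \<open>d\<close> is continuous with values in the lattice, hence constant near
      \<open>q0\<close>.\<close>
    define d where "d q = k q - q - (0, t)" for q
    have d: "fst (d q) = 0" "snd (d q) \<in> period_lattice" if q: "q \<in> V" for q
    proof -
      have tp: "toric_point L (fst (k q)) (snd (k q)) = toric_point L (fst q) (snd q + t)"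
        using pk[OF q] by (simp add: None)
      from arg_cong[OF this, of fst] have f: "fst (k q) = fst q" by simp
      then show "fst (d q) = 0" by (simp add: d_def)
      have "snd (k q) - (snd q + t) \<in> period_lattice"
        using toric_point_eq_interior[OF tp[unfolded f] active_Po[OF qPo[OF q]]] .
      then show "snd (d q) \<in> period_lattice" by (simp add: d_def algebra_simps)
    qed
    have "isCont d q0"
      unfolding d_def using has_derivative_continuous[OF dk] by (intro continuous_intros) auto
    then have "eventually (\<lambda>q. dist (d q) (d q0) < 4 * pi) (nhds q0)"
      using tendstoD[of d "d q0" "at q0" "4 * pi"] by (auto simp: isCont_def eventually_nhds_conv_at)
    then obtain W where W: "open W" "q0 \<in> W" "\<And>q. q \<in> W \<Longrightarrow> dist (d q) (d q0) < 4 * pi"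
      unfolding eventually_nhds by blast
    have eq: "q + (d q0 + (0, t)) = k q" if q: "q \<in> V \<inter> W" for q
    proof -
      have "norm (snd (d q) - snd (d q0)) \<le> norm (d q - d q0)"
        using norm_snd_le[of "snd (d q - d q0)" "fst (d q - d q0)", unfolded prod.collapse]
        by (simp only: snd_diff)
      also have "\<dots> < 4 * pi" using W(3)[of q] q by (simp add: dist_norm)
      finally have "snd (d q) - snd (d q0) = 0"
        using d q q0V by (intro period_lattice_discrete period_lattice_diff) auto
      then have "d q = d q0" using d q q0V by (auto simp: prod_eq_iff)
      then show ?thesis by (simp add: d_def algebra_simps)
    qed
    have "((\<lambda>q. q + (d q0 + (0, t))) has_derivative (\<lambda>X. X)) (at q0)"
      by (auto intro!: derivative_eq_intros)
    then have "(k has_derivative (\<lambda>X. X)) (at q0)"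
      by (rule has_derivative_transform_within_open[of _ _ _ _ "V \<inter> W"])
        (use \<open>open V\<close> W q0V eq in auto)
    then have "(\<lambda>X. X) = D \<circ> chart_frame L c p" using dk by (rule has_derivative_unique)
    then show ?thesis by (simp add: None fun_eq_iff)
  qed
qed

text \<open>An intertwining relation instead of a conjugation, so that \<open>chart_frame\<close>
  need not be inverted. As \<open>E\<close> depends on \<open>y\<close> alone, torus invariance over
  the free part is built in.\<close>

definition represents :: "('n, 'r) endo_field \<Rightarrow> (real^'n \<Rightarrow> 'n endo) \<Rightarrow> bool" where
  "represents T E \<longleftrightarrow> (\<forall>c\<in>charts L. \<forall>p\<in>dom_chart L c. chart_moment L c p \<in> Po \<longrightarrow>
     T c p \<circ> chart_frame L c p = chart_frame L c p \<circ> E (chart_moment L c p))"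

definition smooth_reps :: "('n, 'r) endo_field \<Rightarrow> bool" where
  "smooth_reps T \<longleftrightarrow> (\<forall>c\<in>charts L. (\<forall>p\<in>dom_chart L c. linear (T c p)) \<and>
     (\<forall>X. smooth_on (dom_chart L c) (\<lambda>p. T c p X)))"

text \<open>\<open>chart_lift\<close> is itself a local lift of the identity from
  \<open>(y, w)\<close> to the chart, so the relation is an instance of the transformation
  law.\<close>

lemma represents_restriction:
  assumes "preserved_by L id T" "restricts_to L T E"
  shows "represents T E"
  unfolding represents_def
proof (intro ballI impI)
  fix c p assume c: "c \<in> charts L" and p: "p \<in> dom_chart L c" "chart_moment L c p \<in> Po"
  obtain w where w: "chart_lift L c (chart_moment L c p, w) = p"
    using chart_lift_surj c p(1) by blast
  have "local_lift L id None c (Po \<times> UNIV) (chart_lift L c)"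
    unfolding local_lift_def
    using chart_lift_interior[OF c] by (auto intro!: open_Times smooth_on_chart_lift c)
  moreover have "None \<in> charts L" by (simp add: charts_def)
  ultimately have "T c (chart_lift L c (chart_moment L c p, w)) \<circ> D = D \<circ> T None (chart_moment L c p, w)"
    if "(chart_lift L c has_derivative D) (at (chart_moment L c p, w))" for D
    using assms(1) c p(2) that unfolding preserved_by_def by (metis SigmaI UNIV_I)
  from this[OF has_derivative_chart_lift[OF c]] show "T c p \<circ> chart_frame L c p = chart_frame L c p \<circ> E (chart_moment L c p)"
    using p(2) assms(2) by (simp add: w restricts_to_def)
qed

lemma smooth_linear_eq_on_dense:
  fixes F H :: "'n coords \<Rightarrow> 'b::real_normed_vector"
  assumes "c \<in> charts L" "open V" "V \<subseteq> dom_chart L c" "smooth_on V F" "smooth_on V H"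
    "\<And>p. p \<in> V \<Longrightarrow> chart_moment L c p \<in> Po \<Longrightarrow> F p = H p" "p \<in> V"
  shows "F p = H p"
  by (rule continuous_on_eq_on_dense[OF smooth_on_continuous[OF assms(4)] smooth_on_continuous[OF assms(5)] _
        dom_dense[OF assms(1-3)] assms(7)]) (use assms(6) in auto)

text \<open>By \<open>lift_frame\<close> the derivative of a lift carries one frame to the other,
  while the same \<open>E\<close> stands behind both charts; this gives the law over the free part.
  Both sides are smooth, so density gives the rest.\<close>

lemma represents_preserved:
  assumes T: "smooth_reps T" "represents T E"
  shows "preserved_by L (act t) T"
  unfolding preserved_by_def
proof (intro ballI allI impI)
  fix c c' N g p D
  assume c: "c \<in> charts L" "c' \<in> charts L" and g: "local_lift L (act t) c c' N g"
    and p: "p \<in> N" and D: "(g has_derivative D) (at p)"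
  have N: "open N" "N \<subseteq> dom_chart L c" "g ` N \<subseteq> dom_chart L c'" "smooth_on N g"
    using g by (auto simp: local_lift_def)
  obtain g' where g': "\<And>q. q \<in> N \<Longrightarrow> (g has_derivative g' q) (at q within N)"
    "\<And>v. smooth_on N (\<lambda>q. g' q v)"
    using smooth_on_derivative[OF thick_open[OF N(1)] N(4)] by blast
  have g'at: "(g has_derivative g' q) (at q)" if "q \<in> N" for q
    using g'(1)[OF that] at_within_open[OF that N(1)] by simp
  have "D = g' p" using D g'at[OF p] by (rule has_derivative_unique)
  have lin: "linear (g' q)" if "q \<in> N" for q using g'at[OF that] by (rule has_derivative_linear)
  have interior: "T c' (g q) (g' q X) = g' q (T c q X)" if q: "q \<in> N" "chart_moment L c q \<in> Po" for q X
  proof -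
    have qd: "q \<in> dom_chart L c" "g q \<in> dom_chart L c'" using N q by auto
    have m: "chart_moment L c' (g q) = chart_moment L c q" using lift_moment[OF g q(1)] .
    note fr = lift_frame[OF c g q g'at[OF q(1)]]
    obtain Y where Y: "chart_frame L c q Y = X" using chart_frame_surj[OF c(1) qd(1) q(2)] by blast
    let ?E = "E (chart_moment L c q)"
    have 1: "T c q (chart_frame L c q Y) = chart_frame L c q (?E Y)"
      using T(2) c(1) qd(1) q(2) unfolding represents_def by (metis comp_apply)
    have 2: "T c' (g q) (chart_frame L c' (g q) Y) = chart_frame L c' (g q) (?E Y)"
      using T(2) c(2) qd(2) q(2) m unfolding represents_def by (metis comp_apply)
    show ?thesis using 1 2 by (simp add: fr Y)
  qed
  have "T c' (g p) (g' p X) = g' p (T c p X)" for X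
  proof (rule smooth_linear_eq_on_dense[OF c(1) N(1,2) _ _ interior p])
    have lin': "linear (T c' (g q))" if "q \<in> N" for q using T(1) c(2) N(3) that unfolding smooth_reps_def by blast
    have sm: "smooth_on N (\<lambda>q. T c' (g q) X)" for X
      using T(1) c(2) unfolding smooth_reps_def by (intro smooth_on_compose[OF _ N(4,3)]) blast
    show "smooth_on N (\<lambda>q. T c' (g q) (g' q X))"
      by (rule smooth_on_linear_family[OF lin' sm g'(2)])
    have "smooth_on N (\<lambda>q. T c q X)"
      using T(1) c(1) N(2) unfolding smooth_reps_def by (blast intro: smooth_on_subset)
    from smooth_on_linear_family[OF lin g'(2) this] show "smooth_on N (\<lambda>q. g' q (T c q X))" .
  qed
  then show "T c' (g p) \<circ> D = D \<circ> T c p" by (simp add: fun_eq_iff \<open>D = g' p\<close>)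
qed

lemma smooth_on_omega:
  "smooth_on S f \<Longrightarrow> smooth_on S g \<Longrightarrow> smooth_on S (\<lambda>p. omega (f p :: 'n coords) (g p))"
  unfolding omega_def by (intro smooth_intros)

text \<open>Over the free part the frame is onto and preserves \<open>omega\<close>, so both
  identities reduce to \<open>anti\<close> and \<open>om\<close> for functions of \<open>y\<close>;
  elsewhere they hold by continuity.\<close>

lemma represents_deformation:
  assumes J: "smooth_reps J" "represents J I" and T: "smooth_reps T" "represents T E"
    and anti: "\<And>y X. y \<in> Po \<Longrightarrow> I y (E y X) + E y (I y X) = 0"
    and om: "\<And>y X Y. y \<in> Po \<Longrightarrow> omega (I y X) (E y Y) + omega (E y X) (I y Y) = 0"
    and c: "c \<in> charts L" and p: "p \<in> dom_chart L c"
  shows "J c p (T c p X) + T c p (J c p X) = 0"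
    and "omega (J c p X) (T c p Y) + omega (T c p X) (J c p Y) = 0"
proof -
  let ?V = "dom_chart L c"
  have lin: "\<And>q. q \<in> ?V \<Longrightarrow> linear (J c q)" "\<And>q. q \<in> ?V \<Longrightarrow> linear (T c q)"
    and sm: "\<And>X. smooth_on ?V (\<lambda>q. J c q X)" "\<And>X. smooth_on ?V (\<lambda>q. T c q X)"
    using J(1) T(1) c unfolding smooth_reps_def by blast+
  have rep: "J c q (chart_frame L c q Y) = chart_frame L c q (I (chart_moment L c q) Y)"
    "T c q (chart_frame L c q Y) = chart_frame L c q (E (chart_moment L c q) Y)"
    if "q \<in> ?V" "chart_moment L c q \<in> Po" for q Y
    using J(2) T(2) c that unfolding represents_def by (metis comp_apply)+
  have frlin: "linear (chart_frame L c q)" if q: "q \<in> ?V" "chart_moment L c q \<in> Po" for q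
  proof -
    obtain w where w: "chart_lift L c (chart_moment L c q, w) = q" using chart_lift_surj[OF c q(1)] by blast
    show ?thesis
      using has_derivative_linear[OF has_derivative_chart_lift[OF c, of "(chart_moment L c q, w)"]] q by (simp add: w)
  qed
  show "J c p (T c p X) + T c p (J c p X) = 0"
  proof (rule smooth_linear_eq_on_dense[OF c open_dom_chart[OF c] subset_refl _ smooth_on_const _ p])
    show "smooth_on ?V (\<lambda>q. J c q (T c q X) + T c q (J c q X))"
      by (rule smooth_on_add[OF smooth_on_linear_family[OF lin(1) sm(1) sm(2)]
          smooth_on_linear_family[OF lin(2) sm(2) sm(1)]])
    fix q assume q: "q \<in> ?V" "chart_moment L c q \<in> Po"
    obtain X' where "chart_frame L c q X' = X" by (rule chart_frame_surj[OF c q])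
    then have X': "X = chart_frame L c q X'" by simp
    have "J c q (T c q X) + T c q (J c q X) = chart_frame L c q (I (chart_moment L c q) (E (chart_moment L c q) X')
        + E (chart_moment L c q) (I (chart_moment L c q) X'))"
      by (simp only: X' rep[OF q] linear_add[OF frlin[OF q]])
    then show "J c q (T c q X) + T c q (J c q X) = 0"
      by (simp only: anti[OF q(2)] linear_0[OF frlin[OF q]])
  qed
  show "omega (J c p X) (T c p Y) + omega (T c p X) (J c p Y) = 0"
  proof (rule smooth_linear_eq_on_dense[OF c open_dom_chart[OF c] subset_refl _ smooth_on_const _ p])
    show "smooth_on ?V (\<lambda>q. omega (J c q X) (T c q Y) + omega (T c q X) (J c q Y))"
      by (intro smooth_on_add smooth_on_omega sm)
    fix q assume q: "q \<in> ?V" "chart_moment L c q \<in> Po"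
    obtain X' where X': "chart_frame L c q X' = X" by (rule chart_frame_surj[OF c q])
    obtain Y' where Y': "chart_frame L c q Y' = Y" by (rule chart_frame_surj[OF c q])
    show "omega (J c q X) (T c q Y) + omega (T c q X) (J c q Y) = 0"
      by (simp only: X'[symmetric] Y'[symmetric] rep[OF q] chart_frame_omega[OF c q] om[OF q(2)])
  qed
qed

end


section \<open>Hessians and deformations near a vertex\<close>

lemma hessian_eqI:
  fixes f :: "real^'n \<Rightarrow> real"
  assumes U: "open U" "y \<in> U" and f': "\<And>z. z \<in> U \<Longrightarrow> (f has_derivative f' z) (at z)"
    and f'': "\<And>j. ((\<lambda>z. f' z (axis j 1)) has_derivative f'' j) (at y)"
  shows "hessian f y = (\<chi> i j. f'' j (axis i 1))"
proof -
  have "((\<lambda>z. frechet_derivative f (at z) (axis j 1)) has_derivative f'' j) (at y)" for j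
    by (rule has_derivative_transform_within_open[OF f'' U])
      (simp add: frechet_derivative_at[OF f', symmetric])
  from frechet_derivative_at[OF this] show ?thesis by (simp add: hessian_def)
qed

context delzant_polytope
begin

lemma hessian_canonical_aux:
  fixes y :: "real^'n"
  assumes "y \<in> Po"
  shows "(canonical_potential L has_derivative
      (\<lambda>v. \<Sum>r\<in>UNIV. (ln (ell L r y) + 1) * (conormal L r \<bullet> v))) (at y)"
    and "((\<lambda>z. \<Sum>r\<in>UNIV. (ln (ell L r z) + 1) * (conormal L r \<bullet> w)) has_derivative
      (\<lambda>v. \<Sum>r\<in>UNIV. (conormal L r \<bullet> v) * (conormal L r \<bullet> w) / ell L r y)) (at y)"
proof -
  have pos: "ell L r y > 0" for r using assms Po_iff by blast
  have d: "(ell L r has_derivative (\<lambda>v. conormal L r \<bullet> v)) (at y)" for r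
    unfolding ell_def[abs_def] by (auto intro!: derivative_eq_intros)
  have ln: "((\<lambda>z. ln (ell L r z)) has_derivative (\<lambda>v. (conormal L r \<bullet> v) / ell L r y)) (at y)" for r
    using has_derivative_ln[OF pos d] by (simp add: divide_inverse)
  have "((\<lambda>z. ell L r z * ln (ell L r z)) has_derivative (\<lambda>v. (ln (ell L r y) + 1) * (conormal L r \<bullet> v))) (at y)" for r
    by (rule has_derivative_eq_rhs[OF has_derivative_mult[OF d ln]])
      (use pos[of r] in \<open>auto simp: fun_eq_iff field_simps\<close>)
  then show "(canonical_potential L has_derivative
      (\<lambda>v. \<Sum>r\<in>UNIV. (ln (ell L r y) + 1) * (conormal L r \<bullet> v))) (at y)"
    unfolding canonical_potential_def[abs_def] by (intro has_derivative_sum)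
  have "((\<lambda>z. (ln (ell L r z) + 1) * (conormal L r \<bullet> w)) has_derivative
      (\<lambda>v. (conormal L r \<bullet> v) * (conormal L r \<bullet> w) / ell L r y)) (at y)" for r
    by (rule has_derivative_eq_rhs[OF has_derivative_mult_left[OF has_derivative_add[OF ln has_derivative_const]]])
      simp
  then show "((\<lambda>z. \<Sum>r\<in>UNIV. (ln (ell L r z) + 1) * (conormal L r \<bullet> w)) has_derivative
      (\<lambda>v. \<Sum>r\<in>UNIV. (conormal L r \<bullet> v) * (conormal L r \<bullet> w) / ell L r y)) (at y)"
    by (intro has_derivative_sum)
qed

text \<open>For \<open>Q = UNIV\<close> the Hessian of the canonical potential, for
  \<open>Q = range e\<close> its singular part at a vertex, and for the complement of
  \<open>range e\<close> a part that stays smooth near the vertex.\<close>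

definition facet_hessian :: "'r set \<Rightarrow> real^'n \<Rightarrow> real^'n^'n" where
  "facet_hessian Q y = (\<chi> i j. \<Sum>r\<in>Q. conormal L r $ i * conormal L r $ j / ell L r y)"

lemma hessian_canonical: "y \<in> Po \<Longrightarrow> hessian (canonical_potential L) y = facet_hessian UNIV y"
  by (subst hessian_eqI[OF open_interior _ hessian_canonical_aux])
    (auto simp: facet_hessian_def inner_axis)

text \<open>The second derivatives of \<open>h\<close> within \<open>P\<close> are smooth up to the
  boundary and coincide in the interior with the ordinary ones used by
  \<open>hessian\<close>.\<close>

lemma hessian_symplectic:
  assumes h: "smooth_on P h" and u: "\<And>y. y \<in> P \<Longrightarrow> u y = canonical_potential L y + h y"
  obtains H where "smooth_on P H" "\<And>y. y \<in> Po \<Longrightarrow> hessian u y = facet_hessian UNIV y + H y"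
proof -
  obtain h' where h': "\<And>x. x \<in> P \<Longrightarrow> (h has_derivative h' x) (at x within P)"
    "\<And>v. smooth_on P (\<lambda>x. h' x v)"
    using smooth_on_derivative[OF thick_P h] by blast
  have "\<forall>v. \<exists>k. (\<forall>x\<in>P. ((\<lambda>x. h' x v) has_derivative k x) (at x within P)) \<and> (\<forall>w. smooth_on P (\<lambda>x. k x w))"
    using smooth_on_derivative[OF thick_P h'(2)] by metis
  then obtain h'' where h'': "\<And>v x. x \<in> P \<Longrightarrow> ((\<lambda>x. h' x v) has_derivative h'' v x) (at x within P)"
    "\<And>v w. smooth_on P (\<lambda>x. h'' v x w)" by metis
  have at: "at x within P = at x" if "x \<in> Po" for x
    using that by (rule at_within_interior)
  have P: "x \<in> P" if "x \<in> Po" for x using that interior_subset by blast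
  let ?H = "\<lambda>y. \<chi> i j. h'' (axis j 1) y (axis i 1)"
  have "hessian u y = facet_hessian UNIV y + ?H y" if y: "y \<in> Po" for y
  proof -
    have "(u has_derivative (\<lambda>v. (\<Sum>r\<in>UNIV. (ln (ell L r z) + 1) * (conormal L r \<bullet> v)) + h' z v)) (at z)"
      if z: "z \<in> Po" for z
      by (rule has_derivative_transform_within_open[OF has_derivative_add[OF hessian_canonical_aux(1)[OF z]
            h'(1)[OF P[OF z], unfolded at[OF z]]] open_interior z]) (use u P in auto)
    from hessian_eqI[OF open_interior y this has_derivative_add[OF hessian_canonical_aux(2)[OF y]
          h''(1)[OF P[OF y], unfolded at[OF y]]]]
    show ?thesis by (simp add: facet_hessian_def inner_axis vec_eq_iff)
  qed
  moreover have "smooth_on P ?H" by (intro smooth_intros h'')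
  ultimately show thesis using that by blast
qed

end

text \<open>The matrices are independent parameters so that the composition with \<open>J\<close> is
  again of this form, with \<open>(- B, A)\<close> in place of \<open>(A, B)\<close>.\<close>

definition block_endo :: "real^'n^'n \<Rightarrow> real^'n^'n \<Rightarrow> real^'n^'n \<Rightarrow> 'n::finite endo" where
  "block_endo Gi A B X = ((Gi ** A) *v fst X + (Gi ** B ** Gi) *v snd X, B *v fst X - (A ** Gi) *v snd X)"

lemma higgs_deformation_eq:
  "higgs_deformation u \<xi> y = block_endo (matrix_inv (hessian u y)) (higgs_A u \<xi> y) (higgs_B u \<xi> y)"
  by (simp add: higgs_deformation_def block_endo_def Let_def fun_eq_iff)

lemma matrix_add_rdistrib: "(A + B) ** C = A ** C + B ** C" for A B :: "real^'m^'n"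
  by (simp add: matrix_matrix_mult_def vec_eq_iff sum.distrib distrib_right)

lemma matrix_vector_mult_uminus: "A *v (- x) = - (A *v x)" for A :: "real^'m^'n"
  by (simp add: matrix_vector_mult_def vec_eq_iff sum_negf)

definition diag_matrix :: "real^'n \<Rightarrow> real^'n^'n" where
  "diag_matrix x = (\<chi> i j. if i = j then x $ i else 0)"

lemma diag_matrix_vector: "diag_matrix x *v v = (\<chi> i. x $ i * v $ i)" for x :: "real^'n::finite"
  by (simp add: diag_matrix_def matrix_vector_mult_def vec_eq_iff mult_delta_left)

lemma transpose_diag_matrix: "transpose (diag_matrix x) = diag_matrix x"
  by (simp add: diag_matrix_def transpose_def vec_eq_iff)

lemma det_diag_matrix: "det (diag_matrix x) = (\<Prod>i\<in>UNIV. x $ i)" for x :: "real^'n::finite"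
  by (subst det_diagonal) (simp_all add: diag_matrix_def)

lemma inner_matrix_vector: "v \<bullet> (A *v w) = (transpose A *v v) \<bullet> w" for A :: "real^'n^'m"
  by (metis dot_lmul_matrix transpose_matrix_vector)

context vertex_chart
begin

text \<open>\<open>ginv\<close> is the inverse of \<open>\<Sum> \<nu>\<^sup>e\<^sup>j (\<nu>\<^sup>e\<^sup>j)\<^sup>t / \<ell>\<^sup>e\<^sup>j\<close>, the singular part of \<open>D\<^sup>2u\<close> near the vertex.\<close>

definition ginv :: "real^'n \<Rightarrow> real^'n^'n" where
  "ginv y = Ni ** diag_matrix (xc y) ** transpose Ni"

text \<open>What \<open>u\<close> and the canonical potential have in common near a vertex; one set
  of lemmas then serves both.\<close>

definition regular_hessian :: "(real^'n \<Rightarrow> real^'n^'n) \<Rightarrow> (real^'n \<Rightarrow> real^'n^'n) \<Rightarrow> bool" where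
  "regular_hessian G W \<longleftrightarrow> smooth_on Pe W \<and> (\<forall>y\<in>Pe. det (W y) \<noteq> 0) \<and>
     (\<forall>y\<in>Po. transpose (G y) = G y \<and> G y ** ginv y = W y)"

lemma smooth_on_ginv: "smooth_on S ginv"
  unfolding ginv_def[abs_def] diag_matrix_def
proof (intro smooth_intros)
  show "smooth_on S (\<lambda>x. if i = j then xc x $ i else 0)" for i j
    by (cases "i = j") (auto intro!: smooth_intros)
qed

lemma transpose_ginv: "transpose (ginv y) = ginv y"
  by (simp add: ginv_def matrix_transpose_mul transpose_diag_matrix matrix_mul_assoc)

lemma N_ginv: "N *v (ginv y *v v) = (\<chi> i. xc y $ i * (transpose Ni *v v) $ i)"
proof -
  have "N *v (ginv y *v v) = (N ** Ni) *v (diag_matrix (xc y) *v (transpose Ni *v v))"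
    by (simp add: ginv_def matrix_vector_mul_assoc matrix_mul_assoc)
  then show ?thesis by (simp add: NNi diag_matrix_vector)
qed

lemma det_ginv: "det (ginv y) = det Ni * det Ni * (\<Prod>j\<in>UNIV. xc y $ j)"
  by (simp add: ginv_def det_mul det_transpose det_diag_matrix)

text \<open>The sum is \<open>N^t diag(1/x) N\<close>, whose inverse \<open>ginv\<close> is explicit
  and free of poles.\<close>

lemma facet_hessian_range:
  assumes "y \<in> Po"
  shows "facet_hessian (range e) y ** ginv y = mat 1"
proof -
  have inj: "inj e" using chart by (auto simp: charts_def)
  let ?K = "diag_matrix (\<chi> j. 1 / xc y $ j)"
  have "facet_hessian (range e) y = transpose N ** ?K ** N"
    by (simp add: facet_hessian_def sum.reindex[OF inj] matrix_matrix_mult_def vec_eq_iff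
        transpose_def diag_matrix_def facet_matrix_def facet_coords_def if_distrib mult_ac cong: if_cong)
  moreover have "?K ** diag_matrix (xc y) = mat 1"
    using assms by (auto simp: Po_xc matrix_matrix_mult_def diag_matrix_def vec_eq_iff mat_def
        if_distrib[of "\<lambda>x. x * _"] less_imp_neq[symmetric] cong: if_cong)
  ultimately have "facet_hessian (range e) y ** ginv y = transpose N ** ?K ** (N ** Ni) ** diag_matrix (xc y) ** transpose Ni"
    by (simp add: ginv_def matrix_mul_assoc)
  also have "\<dots> = transpose N ** (?K ** diag_matrix (xc y)) ** transpose Ni"
    by (simp add: NNi matrix_mul_assoc)
  finally show ?thesis by (simp add: \<open>?K ** _ = _\<close> NtNit)
qed

lemma facet_hessian_split: "facet_hessian UNIV y = facet_hessian (range e) y + facet_hessian (- range e) y"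
proof -
  have "(\<Sum>r\<in>UNIV. f r) = (\<Sum>r\<in>range e. f r) + (\<Sum>r\<in>- range e. f r)" for f :: "'r \<Rightarrow> real"
    using sum.subset_diff[of "range e" UNIV f] by (simp add: Compl_eq_Diff_UNIV)
  then show ?thesis by (simp add: facet_hessian_def vec_eq_iff)
qed

lemma smooth_on_facet_hessian: "smooth_on Pe (facet_hessian (- range e))"
  unfolding facet_hessian_def[abs_def] by (intro smooth_intros) (auto simp: Pe_def less_imp_neq[symmetric])

text \<open>This is \<open>G ** ginv\<close> in the interior, since the singular part of
  \<open>G\<close> times \<open>ginv\<close> is the identity; in this form no pole is left on
  \<open>Pe\<close>.\<close>

definition regular_part :: "(real^'n \<Rightarrow> real^'n^'n) \<Rightarrow> real^'n \<Rightarrow> real^'n^'n" where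
  "regular_part H y = mat 1 + (facet_hessian (- range e) y + H y) ** ginv y"

lemma regular_part:
  assumes "y \<in> Po"
  shows "(facet_hessian UNIV y + H y) ** ginv y = regular_part H y"
  by (simp add: facet_hessian_split regular_part_def matrix_add_rdistrib facet_hessian_range[OF assms] add.assoc)

lemma smooth_on_regular_part: "smooth_on Pe H \<Longrightarrow> smooth_on Pe (regular_part H)"
  unfolding regular_part_def[abs_def]
  by (intro smooth_intros smooth_on_facet_hessian smooth_on_ginv) 

text \<open>Positivity gives invertibility: a kernel vector \<open>v\<close> and
  \<open>w = ginv v\<close> satisfy \<open>v = - K w\<close> with \<open>K\<close> positive
  semidefinite, so \<open>w \<bullet> v \<le> 0\<close>. But \<open>w \<bullet> v\<close> is a sum
  of squares with weights \<open>xc y $ j \<ge> 0\<close>. Hence the weighted squares vanish,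
  \<open>w = 0\<close>, and then \<open>v = 0\<close>.\<close>

lemma regular_hessian_canonical:
  "regular_hessian (hessian (canonical_potential L)) (regular_part (\<lambda>y. 0))"
  unfolding regular_hessian_def
proof (intro conjI ballI)
  show "smooth_on Pe (regular_part (\<lambda>y. 0))"
    by (rule smooth_on_regular_part) (rule smooth_on_const)
  fix y assume y: "y \<in> Po"
  show "transpose (hessian (canonical_potential L) y) = hessian (canonical_potential L) y"
    by (simp add: hessian_canonical[OF y] facet_hessian_def transpose_def vec_eq_iff mult.commute)
  show "hessian (canonical_potential L) y ** ginv y = regular_part (\<lambda>y. 0) y"
    using regular_part[OF y, of "\<lambda>y. 0"] by (simp add: hessian_canonical[OF y])
next
  fix y assume y: "y \<in> Pe"
  have "v = 0" if v: "regular_part (\<lambda>y. 0) y *v v = 0" for v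
  proof -
    let ?w = "ginv y *v v" and ?t = "transpose Ni *v v"
    have veq: "v + facet_hessian (- range e) y *v ?w = 0"
      using v by (simp add: regular_part_def matrix_vector_mult_add_rdistrib matrix_vector_mul_assoc)
    have "?w \<bullet> (facet_hessian (- range e) y *v ?w) = (\<Sum>r\<in>- range e. (conormal L r \<bullet> ?w)\<^sup>2 / ell L r y)"
    proof -
      have "?w \<bullet> (facet_hessian (- range e) y *v ?w) =
         (\<Sum>i\<in>UNIV. \<Sum>j\<in>UNIV. \<Sum>r\<in>- range e. (?w $ i * conormal L r $ i) * (conormal L r $ j * ?w $ j) / ell L r y)"
        by (simp add: inner_vec_def matrix_vector_mult_def facet_hessian_def sum_distrib_left sum_distrib_right mult_ac)
      also have "\<dots> = (\<Sum>i\<in>UNIV. \<Sum>r\<in>- range e. \<Sum>j\<in>UNIV. (?w $ i * conormal L r $ i) * (conormal L r $ j * ?w $ j) / ell L r y)"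
        by (intro sum.cong refl sum.swap)
      also have "\<dots> = (\<Sum>r\<in>- range e. \<Sum>i\<in>UNIV. \<Sum>j\<in>UNIV. (?w $ i * conormal L r $ i) * (conormal L r $ j * ?w $ j) / ell L r y)"
        by (rule sum.swap)
      also have "\<dots> = (\<Sum>r\<in>- range e. (conormal L r \<bullet> ?w)\<^sup>2 / ell L r y)"
        by (simp add: inner_vec_def power2_eq_square sum_product sum_divide_distrib mult_ac)
      finally show ?thesis .
    qed
    also have "\<dots> \<ge> 0" using y by (intro sum_nonneg divide_nonneg_pos) (auto simp: Pe_def)
    finally have ge: "?w \<bullet> (facet_hessian (- range e) y *v ?w) \<ge> 0" .
    have "facet_hessian (- range e) y *v ?w = - v" using veq by (simp add: eq_neg_iff_add_eq_0 add.commute)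
    with ge have le: "?w \<bullet> v \<le> 0" by simp
    have "?w \<bullet> v = (\<Sum>j\<in>UNIV. xc y $ j * (?t $ j)\<^sup>2)"
    proof -
      have "?w \<bullet> v = (Ni *v (diag_matrix (xc y) *v ?t)) \<bullet> v"
        by (simp add: ginv_def matrix_vector_mul_assoc matrix_mul_assoc)
      also have "\<dots> = (diag_matrix (xc y) *v ?t) \<bullet> ?t"
        by (metis inner_commute inner_matrix_vector)
      finally show ?thesis by (simp add: diag_matrix_vector inner_vec_def power2_eq_square mult_ac)
    qed
    with le have "(\<Sum>j\<in>UNIV. xc y $ j * (?t $ j)\<^sup>2) = 0"
      using sum_nonneg[of UNIV "\<lambda>j. xc y $ j * (?t $ j)\<^sup>2"] Pe_nonneg[OF y] by simp
    then have "\<forall>j\<in>UNIV. xc y $ j * (?t $ j)\<^sup>2 = 0"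
      using Pe_nonneg[OF y] by (subst (asm) sum_nonneg_eq_0_iff) auto
    then have "diag_matrix (xc y) *v ?t = 0" by (simp add: diag_matrix_vector vec_eq_iff)
    then have "?w = 0" by (simp add: ginv_def matrix_vector_mul_assoc[symmetric])
    with veq show "v = 0" by simp
  qed
  then have "inj ((*v) (regular_part (\<lambda>y. 0) y))"
    by (simp add: matrix_left_invertible_injective[symmetric] matrix_left_invertible_ker)
  then show "det (regular_part (\<lambda>y. 0) y) \<noteq> 0"
    by (simp add: invertible_det_nz[symmetric] invertible_left_inverse matrix_left_invertible_injective)
qed

text \<open>In \<open>det G * det ginv\<close> the factors \<open>ell\<close> of the facets through
  the vertex cancel. The remaining quotient is continuous and nonzero on all of \<open>Pe\<close>,
  and by density it is the determinant of \<open>regular_part H\<close> there.\<close>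

lemma regular_hessian_symplectic:
  assumes H: "smooth_on Pe H" and G: "\<And>y. y \<in> Po \<Longrightarrow> G y = facet_hessian UNIV y + H y"
    and sym: "\<And>y. y \<in> Po \<Longrightarrow> transpose (G y) = G y"
    and \<delta>: "continuous_on Pe \<delta>" "\<And>y. y \<in> Pe \<Longrightarrow> \<delta> y > 0"
    and det: "\<And>y. y \<in> Po \<Longrightarrow> det (G y) = inverse (\<delta> y * (\<Prod>r\<in>UNIV. ell L r y))"
  shows "regular_hessian G (regular_part H)"
  unfolding regular_hessian_def
proof (intro conjI ballI)
  show sm: "smooth_on Pe (regular_part H)" by (rule smooth_on_regular_part[OF H])
  show GW: "G y ** ginv y = regular_part H y" if "y \<in> Po" for y
    using regular_part[OF that] G[OF that] by simp
  fix y assume y: "y \<in> Pe"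
  let ?q = "\<lambda>y. det Ni * det Ni / (\<delta> y * (\<Prod>r\<in>- range e. ell L r y))"
  have pos: "(\<Prod>r\<in>- range e. ell L r y) > 0" if "y \<in> Pe" for y
    using that by (intro prod_pos) (auto simp: Pe_def)
  have eq: "det (regular_part H y) = ?q y"
  proof (rule continuous_on_eq_on_dense[OF _ _ _ Pe_dense y])
    show "continuous_on Pe (\<lambda>y. det (regular_part H y))"
      by (rule smooth_on_continuous[OF smooth_on_det[OF sm]])
    show "continuous_on Pe ?q"
      using pos \<delta>(2) by (intro continuous_intros \<delta>(1)) (auto simp: less_imp_neq[symmetric])
    fix y assume "y \<in> Pe \<inter> Po"
    then have yP: "y \<in> Pe" "y \<in> Po" by auto
    have inj: "inj e" using chart by (auto simp: charts_def)
    have "(\<Prod>r\<in>UNIV. ell L r y) = (\<Prod>j\<in>UNIV. xc y $ j) * (\<Prod>r\<in>- range e. ell L r y)"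
      using prod.subset_diff[of "range e" UNIV "\<lambda>r. ell L r y"]
      by (simp add: Compl_eq_Diff_UNIV prod.reindex[OF inj] facet_coords_def mult.commute)
    moreover have "(\<Prod>j\<in>UNIV. xc y $ j) > 0" using yP(2) by (intro prod_pos) (auto simp: Po_xc)
    moreover have "inverse (d * (a * b)) * (c * c * a) = c * c / (d * b)" if "a > 0" for a b c d :: real
      using that by (simp add: field_simps)
    ultimately show "det (regular_part H y) = ?q y"
      unfolding GW[OF yP(2), symmetric] det_mul det_ginv det[OF yP(2)] by simp
  qed
  have "det Ni \<noteq> 0"
    using arg_cong[OF NNi, of det] by (auto simp: det_mul)
  then show "det (regular_part H y) \<noteq> 0"
    unfolding eq using less_imp_neq[OF pos[OF y]] less_imp_neq[OF \<delta>(2)[OF y]]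
    by (simp only: divide_eq_0_iff mult_eq_0_iff) simp
qed (rule sym)

context
  fixes G W
  assumes reg: "regular_hessian G W"
begin

lemma smooth_W: "smooth_on Pe W" and det_W: "y \<in> Pe \<Longrightarrow> det (W y) \<noteq> 0"
  and sym_G: "y \<in> Po \<Longrightarrow> transpose (G y) = G y" and G_ginv: "y \<in> Po \<Longrightarrow> G y ** ginv y = W y"
  using reg by (auto simp: regular_hessian_def)

lemma smooth_Wi: "smooth_on Pe (\<lambda>y. matrix_inv (W y))"
  by (rule smooth_on_matrix_inv[OF smooth_W det_W])

lemma det_G: "y \<in> Po \<Longrightarrow> det (G y) \<noteq> 0"
  using arg_cong[OF G_ginv, of y det] det_W[of y] Po_Pe by (auto simp: det_mul)

lemma Gi_eq: "y \<in> Po \<Longrightarrow> matrix_inv (G y) = ginv y ** matrix_inv (W y)"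
proof -
  assume y: "y \<in> Po"
  then have yP: "y \<in> Pe" using Po_Pe by auto
  have "G y ** (ginv y ** matrix_inv (W y)) = mat 1"
    by (simp add: matrix_mul_assoc G_ginv[OF y] matrix_inv_right[OF det_W[OF yP]])
  then have "matrix_inv (G y) ** (G y ** (ginv y ** matrix_inv (W y))) = matrix_inv (G y)" by simp
  then show ?thesis by (simp only: matrix_mul_assoc matrix_inv_left[OF det_G[OF y]] matrix_mul_lid)
qed

lemma transpose_Gi: "y \<in> Po \<Longrightarrow> transpose (matrix_inv (G y)) = matrix_inv (G y)"
proof -
  assume y: "y \<in> Po"
  have "transpose (matrix_inv (G y)) ** G y = transpose (G y ** matrix_inv (G y))"
    by (simp add: matrix_transpose_mul sym_G[OF y])
  also have "\<dots> = mat 1" by (simp add: matrix_inv_right[OF det_G[OF y]] transpose_mat)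
  finally have "transpose (matrix_inv (G y)) ** G y ** matrix_inv (G y) = matrix_inv (G y)" by simp
  then show ?thesis by (simp add: matrix_mul_assoc[symmetric] matrix_inv_right[OF det_G[OF y]])
qed

text \<open>Symmetry lets the smooth factor stand on either side of \<open>ginv\<close>;
  \<open>chart_deformation_frame\<close> needs both forms.\<close>

lemma Gi_eq': "y \<in> Po \<Longrightarrow> matrix_inv (G y) = transpose (matrix_inv (W y)) ** ginv y"
  using transpose_Gi[of y] by (simp add: Gi_eq matrix_transpose_mul transpose_ginv)

end

text \<open>The singular factor \<open>ginv\<close> is the same for both potentials and cancels, so
  the ratio of the Hessians extends smoothly to \<open>Pe\<close>.\<close>

lemma regular_hessian_ratio:
  assumes "regular_hessian G W" "regular_hessian G' W'" "y \<in> Po"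
  shows "W y ** matrix_inv (W' y) = G y ** matrix_inv (G' y)"
  by (simp add: Gi_eq[OF assms(2,3)] matrix_mul_assoc G_ginv[OF assms(1,3)])

text \<open>The deformation conjugated to the chart after all cancellations: \<open>\<alpha>\<close>
  is the \<open>dy\<close> part and \<open>\<beta>\<close> is \<open>(D^2u)^-1\<close> applied to
  the \<open>dw\<close> part, where \<open>ginv\<close> absorbs the pole of
  \<open>d\<theta>\<close>. In the output \<open>N ginv\<close> contributes
  \<open>x = radius2 / 4\<close> and turns the coefficients \<open>2 a / radius2\<close> into
  \<open>a / 2\<close>. The parameter \<open>V\<close> stands for \<open>W^-1\<close>.\<close>

definition chart_deformation :: "real^'n^'n \<Rightarrow> real^'n^'n \<Rightarrow> real^'n^'n \<Rightarrow> 'n coords \<Rightarrow> 'n endo" where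
  "chart_deformation V A B p X =
    (let \<alpha> = Ni *v (\<chi> j. (fst p $ j * fst X $ j + snd p $ j * snd X $ j) / 2);
         \<beta> = transpose V *v (Ni *v (\<chi> j. (fst p $ j * snd X $ j - snd p $ j * fst X $ j) / 2));
         l = transpose Ni *v (V *v (A *v \<alpha> + B *v \<beta>));
         k = transpose Ni *v (B *v \<alpha> - A *v \<beta>)
     in (\<chi> j. fst p $ j / 2 * l $ j - snd p $ j / 2 * k $ j, \<chi> j. snd p $ j / 2 * l $ j + fst p $ j / 2 * k $ j))"

lemma smooth_on_chart_deformation:
  assumes "smooth_on Pe V" "smooth_on Pe A" "smooth_on Pe B"
  shows "smooth_on D (\<lambda>p. chart_deformation (V (vertex_moment L e p)) (A (vertex_moment L e p)) (B (vertex_moment L e p)) p X)"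
proof -
  have s: "smooth_on D (\<lambda>p. F (vertex_moment L e p))" if "smooth_on Pe F" for F :: "real^'n \<Rightarrow> real^'n^'n"
    by (rule smooth_on_compose[OF that smooth_on_moment]) (use D_iff in blast)
  show ?thesis
    unfolding chart_deformation_def Let_def
    by (intro smooth_intros s assms)
qed

lemma linear_chart_deformation: "linear (chart_deformation V A B p)"
proof -
  have a: "(\<chi> j. (fst p $ j * fst (X + Y) $ j + snd p $ j * snd (X + Y) $ j) / 2) =
      (\<chi> j. (fst p $ j * fst X $ j + snd p $ j * snd X $ j) / 2) + (\<chi> j. (fst p $ j * fst Y $ j + snd p $ j * snd Y $ j) / 2)"
    "(\<chi> j. (fst p $ j * snd (X + Y) $ j - snd p $ j * fst (X + Y) $ j) / 2) =
      (\<chi> j. (fst p $ j * snd X $ j - snd p $ j * fst X $ j) / 2) + (\<chi> j. (fst p $ j * snd Y $ j - snd p $ j * fst Y $ j) / 2)"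
    for X Y :: "'n coords" by (simp_all add: vec_eq_iff field_simps)
  have s: "(\<chi> j. (fst p $ j * fst (c *\<^sub>R X) $ j + snd p $ j * snd (c *\<^sub>R X) $ j) / 2) =
      c *\<^sub>R (\<chi> j. (fst p $ j * fst X $ j + snd p $ j * snd X $ j) / 2)"
    "(\<chi> j. (fst p $ j * snd (c *\<^sub>R X) $ j - snd p $ j * fst (c *\<^sub>R X) $ j) / 2) =
      c *\<^sub>R (\<chi> j. (fst p $ j * snd X $ j - snd p $ j * fst X $ j) / 2)"
    for c and X :: "'n coords" by (simp_all add: vec_eq_iff field_simps)
  show ?thesis
  proof (rule linearI)
    show "chart_deformation V A B p (X + Y) = chart_deformation V A B p X + chart_deformation V A B p Y" for X Y
      unfolding chart_deformation_def Let_def a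
      by (simp add: prod_eq_iff vec_eq_iff matrix_vector_right_distrib matrix_vector_mult_diff_distrib algebra_simps)
    show "chart_deformation V A B p (c *\<^sub>R X) = c *\<^sub>R chart_deformation V A B p X" for c X
      unfolding chart_deformation_def Let_def s
      by (simp add: prod_eq_iff vec_eq_iff matrix_vector_mult_scaleR matrix_vector_right_distrib
          matrix_vector_mult_diff_distrib algebra_simps)
  qed
qed

lemma chart_deformation_frame:
  assumes reg: "regular_hessian G W" and y: "vertex_moment L e p \<in> Po" and p: "p \<in> D"
  defines "y \<equiv> vertex_moment L e p"
  shows "chart_deformation (matrix_inv (W y)) A B p (chart_frame L (Some e) p X) =
    chart_frame L (Some e) p (block_endo (matrix_inv (G y)) A B X)"
proof -
  let ?V = "matrix_inv (W y)" and ?Gi = "matrix_inv (G y)"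
  note y' = y[folded y_def]
  define F where "F = chart_frame L (Some e) p X"
  have r: "radius2 p j \<noteq> 0" "radius2 p j = fst p $ j * fst p $ j + snd p $ j * snd p $ j" for j
    using radius2_nonzero[OF chart p y] by (simp_all add: radius2_def power2_eq_square)
  have x: "xc y $ j = radius2 p j / 4" for j by (simp add: y_def xc_moment)
  have F: "fst F $ j = 2 * fst p $ j / radius2 p j * (N *v fst X) $ j - snd p $ j / 2 * (transpose Ni *v snd X) $ j"
      "snd F $ j = 2 * snd p $ j / radius2 p j * (N *v fst X) $ j + fst p $ j / 2 * (transpose Ni *v snd X) $ j" for j
    by (simp_all add: F_def)
  have 1: "(fst p $ j * fst F $ j + snd p $ j * snd F $ j) / 2 = (N *v fst X) $ j" for j
  proof -
    have "fst p $ j * fst F $ j + snd p $ j * snd F $ j =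
      2 * (N *v fst X) $ j * ((fst p $ j * fst p $ j + snd p $ j * snd p $ j) / radius2 p j)"
      unfolding F using r(1)[of j] by (simp add: divide_simps) (simp add: algebra_simps)
    then show ?thesis using r(1)[of j] unfolding r(2)[symmetric] by simp
  qed
  have 2: "(fst p $ j * snd F $ j - snd p $ j * fst F $ j) / 2 = xc y $ j * (transpose Ni *v snd X) $ j" for j
  proof -
    have "fst p $ j * snd F $ j - snd p $ j * fst F $ j =
      (fst p $ j * fst p $ j + snd p $ j * snd p $ j) / 2 * (transpose Ni *v snd X) $ j"
      unfolding F using r(1)[of j] by (simp add: divide_simps) (simp add: algebra_simps)
    then show ?thesis unfolding r(2)[symmetric] x by simp
  qed
  have \<alpha>: "Ni *v (\<chi> j. (fst p $ j * fst F $ j + snd p $ j * snd F $ j) / 2) = fst X"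
    unfolding 1 by (simp add: matrix_vector_mul_assoc NiN)
  have "Ni *v (\<chi> j. (fst p $ j * snd F $ j - snd p $ j * fst F $ j) / 2) = Ni *v (N *v (ginv y *v snd X))"
    unfolding 2 N_ginv by simp
  then have \<beta>: "transpose ?V *v (Ni *v (\<chi> j. (fst p $ j * snd F $ j - snd p $ j * fst F $ j) / 2)) = ?Gi *v snd X"
    by (simp add: matrix_vector_mul_assoc NiN Gi_eq'[OF reg y'] matrix_mul_assoc)
  define v where "v = A *v fst X + B *v (?Gi *v snd X)"
  have b1: "fst (block_endo ?Gi A B X) = ginv y *v (?V *v v)"
    by (simp add: v_def block_endo_def Gi_eq[OF reg y'] matrix_vector_mul_assoc matrix_mul_assoc matrix_vector_right_distrib)
  have b2: "snd (block_endo ?Gi A B X) = B *v fst X - A *v (?Gi *v snd X)"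
    by (simp add: block_endo_def matrix_vector_mul_assoc)
  have c1: "2 * a / radius2 p j * (xc y $ j * t) = a / 2 * t" for a t j
    using r(1)[of j] by (simp add: x)
  show ?thesis
    unfolding F_def[symmetric] chart_deformation_def Let_def \<alpha> \<beta> v_def[symmetric]
    by (simp only: chart_frame.simps b1 b2 N_ginv vec_lambda_beta c1)
qed

section \<open>Reading the extension off the real slice of a chart\<close>

lemma orthant_domain_xc: "orthant_domain (xc ` Pe)" and half_square_xc: "half_square a \<in> xc ` Pe \<longleftrightarrow> (a, 0) \<in> D"
proof -
  have hs: "half_square a = xc (vertex_moment L e (a, 0))" for a
    by (simp add: half_square_def vec_eq_iff xc_moment radius2_def)
  have inj: "inj xc" by (metis injI mu_xc)
  show iff: "half_square a \<in> xc ` Pe \<longleftrightarrow> (a, 0) \<in> D" for a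
    unfolding hs D_iff by (simp add: inj_image_mem_iff[OF inj])
  show "orthant_domain (xc ` Pe)"
  proof
    have "xc ` Pe = (\<lambda>x. (\<chi> j. snd (L (e j))) + x) ` ((*v) N ` Pe)"
      by (simp add: image_image xc_eq add.commute)
    then show "convex (xc ` Pe)"
      by (simp only:) (intro convex_translation convex_linear_image convex_Pe matrix_vector_mul_linear)
    show "x $ k \<ge> 0" if "x \<in> xc ` Pe" for x k using that Pe_nonneg by auto
    have "open ((\<lambda>a::real^'n. (a, 0::real^'n)) -` D)"
      by (intro open_vimage open_D continuous_intros)
    then show "open {a. half_square a \<in> xc ` Pe}" by (simp only: iff vimage_def)
  qed
qed

lemma extension_from_chart:
  assumes reg: "regular_hessian G W"
    and T: "\<And>X. smooth_on D (\<lambda>p. T p X)"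
    and rep: "\<And>p. p \<in> D \<Longrightarrow> vertex_moment L e p \<in> Po \<Longrightarrow>
      T p \<circ> chart_frame L (Some e) p = chart_frame L (Some e) p \<circ>
        block_endo (matrix_inv (G (vertex_moment L e p))) (A (vertex_moment L e p)) (B (vertex_moment L e p))"
    and sym: "\<And>y. y \<in> Po \<Longrightarrow> transpose (A y) = A y"
  obtains A' where "smooth_on Pe A'" "\<And>y. y \<in> Po \<Longrightarrow> A' y = A y"
proof -
  interpret orthant_domain "xc ` Pe" by (rule orthant_domain_xc)
  have T_eq: "T p X = chart_deformation (matrix_inv (W (vertex_moment L e p))) (A (vertex_moment L e p))
      (B (vertex_moment L e p)) p X" if p: "p \<in> D" "vertex_moment L e p \<in> Po" for p X
  proof -
    obtain X' where X': "chart_frame L (Some e) p X' = X"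
      by (rule frame_surj) (rule radius2_nonzero[OF chart p])
    show ?thesis
      unfolding X'[symmetric] chart_deformation_frame[OF reg p(2,1)]
      using fun_cong[OF rep[OF p], of X'] by simp
  qed
  define C where "C y = transpose Ni ** matrix_inv (W y) ** A y ** Ni" for y
  \<comment> \<open>On the slice \<open>b = 0\<close> a real vector is radial, so
    \<open>\<beta> = 0\<close>; in the real part of the image only \<open>A\<close> enters, and the
    entry of \<open>C\<close> appears with the weight \<open>a $ i * a $ j / 4\<close>.\<close>
  define t where "t i j a = fst (T (a, 0) (axis j 1, 0)) $ i" for i j a
  have st: "smooth_on R (t i j)" for i j
    unfolding t_def[abs_def]
    by (intro smooth_intros smooth_on_compose[OF T, where f="\<lambda>a. (a, 0)"]) (auto simp: half_square_xc simp del: dom_chart.simps)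
  have pt: "(a, 0) \<in> D" "vertex_moment L e (a, 0) \<in> Po" "vertex_moment L e (a, 0) = mu (half_square a)"
    if a: "a \<in> R" "a \<in> nonvanishing" for a
  proof -
    show D: "(a, 0) \<in> D" using a(1) by (simp add: half_square_xc del: dom_chart.simps)
    show "vertex_moment L e (a, 0) \<in> Po" using a(2) by (simp add: moment_Po_iff[OF D] nonvanishing_def radius2_def)
    show "vertex_moment L e (a, 0) = mu (half_square a)"
      by (simp add: vertex_moment_eq half_square_def radius2_def)
  qed
  have t_eq: "t i j a = a $ i * a $ j * (C (mu (half_square a)) $ i $ j / 4)"
    if a: "a \<in> R" "a \<in> nonvanishing" for a i j
  proof -
    let ?y = "vertex_moment L e (a, 0)"
    have ax: "(\<chi> k. a $ k * axis j 1 $ k / 2) = (a $ j / 2) *\<^sub>R axis j 1"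
      by (simp add: vec_eq_iff axis_def)
    have z: "(\<chi> j. 0) = (0 :: real^'n)" by (simp add: vec_eq_iff)
    have "t i j a = a $ i / 2 * (transpose Ni *v (matrix_inv (W ?y) *v (A ?y *v (Ni *v ((a $ j / 2) *\<^sub>R axis j 1))))) $ i"
      unfolding t_def T_eq[OF pt(1,2)[OF a]] chart_deformation_def Let_def by (simp add: ax z)
    also have "\<dots> = a $ i / 2 * (a $ j / 2) * (C ?y *v axis j 1) $ i"
      by (simp add: C_def matrix_vector_mult_scaleR matrix_vector_mul_assoc matrix_mul_assoc)
    also have "(C ?y *v axis j 1) $ i = C ?y $ i $ j"
      by (simp add: matrix_vector_mult_basis column_def)
    finally show ?thesis by (simp add: pt(3)[OF a])
  qed
  have diag: "t i j a = 0" if "a \<in> R" "i = j" "a $ i = 0" for a i j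
  proof -
    \<comment> \<open>\<open>q b\<close> turns the \<open>i\<close>-th coordinate by a right angle,
      from \<open>b $ i\<close> to \<open>\<i> * b $ i\<close>, and keeps all radii and hence the
      moment point. The vector \<open>(axis i 1, 0)\<close>, radial before, becomes angular.\<close>
    define q where "q b = (((\<chi> k. if k = i then 0 else b $ k), (\<chi> k. if k = i then b $ k else 0)) :: 'n coords)" for b
    have rq: "radius2 (q b) k = radius2 (b, 0) k" for b k by (simp add: q_def radius2_def)
    have mq: "vertex_moment L e (q b) = vertex_moment L e (b, 0)" for b
      by (simp add: vertex_moment_eq rq)
    have qD: "q b \<in> D" if "b \<in> R" for b
      using that unfolding half_square_xc mem_Collect_eq D_iff mq .
    have "smooth_on R q"
      unfolding q_def[abs_def]
    proof (intro smooth_intros)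
      show "smooth_on R (\<lambda>x. if k = i then 0 else x $ k)" for k by (cases "k = i") (auto intro!: smooth_intros)
      show "smooth_on R (\<lambda>x. if k = i then x $ k else 0)" for k by (cases "k = i") (auto intro!: smooth_intros)
    qed
    then have sq: "smooth_on R (\<lambda>b. - (fst (T (q b) (axis i 1, 0)) $ i))"
      by (intro smooth_intros smooth_on_compose[OF T]) (use qD in \<open>simp_all only: image_subset_iff, blast?\<close>)
    have "t i i a = - (fst (T (q a) (axis i 1, 0)) $ i)"
    proof (rule continuous_on_eq_on_dense[OF smooth_on_continuous[OF st] smooth_on_continuous[OF sq] _
          nonvanishing_dense[OF S_open] that(1)])
      fix b assume b': "b \<in> R \<inter> nonvanishing"
      then have b: "b \<in> R" "b \<in> nonvanishing" by auto
      let ?y = "vertex_moment L e (b, 0)"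
      have Po: "vertex_moment L e (q b) \<in> Po" using pt(2)[OF b] by (simp only: mq)
      have y: "?y \<in> Po" using pt(2)[OF b] .
      have 1: "(\<chi> k. (fst (q b) $ k * axis i 1 $ k) / 2) = (0::real^'n)"
        by (auto simp: q_def vec_eq_iff axis_def)
      have 2: "(\<chi> k. - (snd (q b) $ k * axis i 1 $ k) / 2) = (- b $ i / 2) *\<^sub>R axis i 1"
        by (auto simp: q_def vec_eq_iff axis_def)
      have q0: "fst (q b) $ i = 0" "snd (q b) $ i = b $ i" by (auto simp: q_def)
      have "fst (T (q b) (axis i 1, 0)) $ i =
        - (b $ i / 2) * (transpose Ni *v (- (A ?y *v (transpose (matrix_inv (W ?y)) *v (Ni *v ((- b $ i / 2) *\<^sub>R axis i 1)))))) $ i"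
        unfolding T_eq[OF qD[OF b(1)] Po] chart_deformation_def Let_def mq using 1 2 by (simp add: q0)
      \<comment> \<open>Symmetry of \<open>A\<close> identifies the block met here with
        \<open>transpose C\<close>, which has the same diagonal as \<open>C\<close>.\<close>
      also have "\<dots> = - (b $ i / 2 * (b $ i / 2)) * (transpose (C ?y) *v axis i 1) $ i"
        by (simp add: C_def matrix_vector_mult_scaleR matrix_vector_mul_assoc matrix_mul_assoc
            matrix_transpose_mul sym[OF y] matrix_vector_mult_uminus)
      also have "(transpose (C ?y) *v axis i 1) $ i = C ?y $ i $ i"
        by (simp add: matrix_vector_mult_basis column_def transpose_def)
      finally show "t i i b = - (fst (T (q b) (axis i 1, 0)) $ i)"
        by (simp add: t_eq[OF b] pt(3)[OF b])
    qed
    \<comment> \<open>On \<open>a $ i = 0\<close> the two points coincide, so the entry equals its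
      own negative.\<close>
    moreover have "q a = (a, 0)" using that(3) by (auto simp: q_def vec_eq_iff)
    ultimately show ?thesis using that(2) by (simp add: t_def)
  qed
  have "\<exists>c. smooth_on (xc ` Pe) c \<and> (\<forall>x\<in>xc ` Pe. (\<forall>k. x $ k > 0) \<longrightarrow> c x = C (mu x) $ i $ j / 4)" for i j
  proof (rule smooth_factor_through_square[OF st])
    show "t i j a = a $ i * a $ j * (C (mu (half_square a)) $ i $ j / 4)"
      if "a \<in> R" "a \<in> nonvanishing" for a by (rule t_eq[OF that])
    show "t i j a = 0" if "a \<in> R" "i = j" "a $ i = 0" for a by (rule diag[OF that])
  qed blast
  then obtain c where c: "\<And>i j. smooth_on (xc ` Pe) (c i j)"
    "\<And>i j x. x \<in> xc ` Pe \<Longrightarrow> (\<And>k. x $ k > 0) \<Longrightarrow> c i j x = C (mu x) $ i $ j / 4" by metis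
  define C' where "C' y = (\<chi> i j. 4 * c i j (xc y))" for y
  have "smooth_on Pe C'"
    unfolding C'_def[abs_def] by (intro smooth_intros smooth_on_compose[OF c(1)]) auto
  then have "smooth_on Pe (\<lambda>y. W y ** transpose N ** C' y ** N)"
    by (intro smooth_intros smooth_W[OF reg])
  moreover have "W y ** transpose N ** C' y ** N = A y" if y: "y \<in> Po" for y
  proof -
    have yP: "y \<in> Pe" using y Po_Pe by auto
    have "4 * c i j (xc y) = C y $ i $ j" for i j
      using c(2)[of "xc y" i j] y yP by (simp add: Po_xc)
    then have "C' y = C y" by (simp add: C'_def vec_eq_iff)
    then have "W y ** transpose N ** C' y ** N =
        W y ** (transpose N ** transpose Ni) ** matrix_inv (W y) ** A y ** (Ni ** N)"
      by (simp add: C_def matrix_mul_assoc)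
    then show ?thesis
      by (simp add: NtNit NiN matrix_inv_right[OF det_W[OF reg yP]])
  qed
  ultimately show thesis by (rule that)
qed

end


section \<open>Gluing and the equivalence\<close>

lemma cmat_mult: "cmat (A ** B) = cmat A ** cmat B" for A :: "real^'n^'m" and B :: "real^'k^'n"
  by (simp add: cmat_def matrix_matrix_mult_def vec_eq_iff)

lemma transpose_cmat: "transpose (cmat A) = cmat (transpose A)"
  by (simp add: cmat_def transpose_def vec_eq_iff)

lemma smooth_on_cmat [smooth_intros]:
  fixes f :: "'a::real_normed_vector \<Rightarrow> real^'n^'m"
  shows "smooth_on S f \<Longrightarrow> smooth_on S (\<lambda>x. cmat (f x))"
  unfolding cmat_def by (intro smooth_intros)

text \<open>As both Hessians are symmetric, \<open>M\<close> relates them on the left and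
  \<open>transpose M\<close> on the right. That \<open>M\<close> extends smoothly near a vertex
  comes from \<open>regular_hessian_ratio\<close>.\<close>

lemma hess_conj_change:
  assumes "transpose (hessian u y) = hessian u y" "transpose (hessian v y) = hessian v y"
    and "det (hessian u y) \<noteq> 0"
  defines "M \<equiv> hessian v y ** matrix_inv (hessian u y)"
  shows "hess_conj v \<xi> y = cmat M ** hess_conj u \<xi> y ** cmat (transpose M)"
proof -
  have 1: "hessian v y = M ** hessian u y"
    by (simp add: M_def matrix_mul_assoc[symmetric] matrix_inv_left[OF assms(3)])
  then have 2: "hessian v y = hessian u y ** transpose M"
    using assms(1,2) by (metis matrix_transpose_mul)
  have "hess_conj v \<xi> y = cmat (M ** hessian u y) ** \<xi> y ** cmat (hessian u y ** transpose M)"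
    unfolding hess_conj_def by (simp only: 1[symmetric] 2[symmetric])
  then show ?thesis by (simp add: cmat_mult hess_conj_def matrix_mul_assoc)
qed

lemma transpose_hess_conj:
  assumes "transpose (hessian u y) = hessian u y" "transpose (\<xi> y) = \<xi> y"
  shows "transpose (hess_conj u \<xi> y) = hess_conj u \<xi> y"
  by (simp add: hess_conj_def matrix_transpose_mul transpose_cmat assms matrix_mul_assoc)

lemma higgs_symmetric:
  assumes "transpose (hessian u y) = hessian u y" "transpose (\<xi> y) = \<xi> y"
  shows "transpose (higgs_A u \<xi> y) = higgs_A u \<xi> y" "transpose (higgs_B u \<xi> y) = higgs_B u \<xi> y"
  using transpose_hess_conj[of u y \<xi>, OF assms]
  by (simp_all add: higgs_A_def higgs_B_def transpose_def vec_eq_iff)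

lemma potential_J_eq: "potential_J u y X = (- (matrix_inv (hessian u y) *v snd X), hessian u y *v fst X)"
  by (cases X) (simp add: potential_J_def)

lemma matrix_uminus_mult: "(- A) ** B = - (A ** B)" "A ** (- B) = - (A ** B)" "(- A) *v x = - (A *v x)"
  for A :: "real^'m^'n" and B :: "real^'k^'m"
  by (simp_all add: matrix_matrix_mult_def matrix_vector_mult_def vec_eq_iff sum_negf)

text \<open>Applying \<open>J\<close> afterwards multiplies \<open>A - iB\<close> by
  \<open>-i\<close>, applying it first multiplies by \<open>i\<close>. The opposite signs give
  anticommutation, and the first formula lets \<open>A\<close> and \<open>B\<close> exchange
  roles.\<close>

lemma potential_J_block_endo:
  fixes u :: "real^'n \<Rightarrow> real"
  assumes "det (hessian u y) \<noteq> 0"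
  defines "Gi \<equiv> matrix_inv (hessian u y)"
  shows "potential_J u y (block_endo Gi A B X) = block_endo Gi (- B) A X"
    and "block_endo Gi A B (potential_J u y X) = - block_endo Gi (- B) A X"
proof -
  have G: "hessian u y ** Gi = mat 1" "Gi ** hessian u y = mat 1"
    unfolding Gi_def using assms(1) by (simp_all add: matrix_inv_right matrix_inv_left)
  show "potential_J u y (block_endo Gi A B X) = block_endo Gi (- B) A X"
    unfolding potential_J_eq Gi_def[symmetric]
    by (simp add: block_endo_def matrix_vector_right_distrib matrix_vector_mult_diff_distrib
        matrix_vector_mul_assoc matrix_mul_assoc matrix_uminus_mult G)
  have "(C ** Gi) *v (hessian u y *v x) = C *v x" for C :: "real^'n^'n" and x :: "real^'n"
    by (simp add: matrix_vector_mul_assoc matrix_mul_assoc[symmetric] G)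
  then show "block_endo Gi A B (potential_J u y X) = - block_endo Gi (- B) A X"
    unfolding potential_J_eq Gi_def[symmetric]
    by (simp add: block_endo_def matrix_vector_mult_uminus matrix_uminus_mult) (simp add: matrix_vector_mul_assoc)
qed

text \<open>In \<open>omega\<close> the symmetric Hessian meets its inverse and drops out; what is
  left cancels by the symmetry of \<open>A\<close> and \<open>B\<close>.\<close>

lemma omega_block_endo:
  assumes G: "det (hessian u y) \<noteq> 0" "transpose (hessian u y) = hessian u y"
    and A: "transpose A = A" and B: "transpose B = B"
  defines "Gi \<equiv> matrix_inv (hessian u y)"
  shows "omega (potential_J u y X) (block_endo Gi A B Y) + omega (block_endo Gi A B X) (potential_J u y Y) = 0"
proof -
  have *: "hessian u y ** Gi = mat 1" unfolding Gi_def using G by (simp add: matrix_inv_right)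
  have GG: "(hessian u y *v v) \<bullet> (Gi *v w) = v \<bullet> w" for v w
  proof -
    have "(hessian u y *v v) \<bullet> (Gi *v w) = v \<bullet> (hessian u y *v (Gi *v w))"
      by (simp only: inner_matrix_vector[of v] G)
    then show ?thesis by (simp add: matrix_vector_mul_assoc *)
  qed
  have GG': "(Gi *v w) \<bullet> (hessian u y *v v) = w \<bullet> v" for v w
    using GG[of v w] by (simp add: inner_commute)
  have block: "block_endo Gi A B Z = (Gi *v (A *v fst Z + B *v (Gi *v snd Z)), B *v fst Z - A *v (Gi *v snd Z))" for Z
    by (simp add: block_endo_def matrix_vector_right_distrib matrix_vector_mul_assoc matrix_mul_assoc)
  have sA: "(A *v v) \<bullet> w = v \<bullet> (A *v w)" and sB: "(B *v v) \<bullet> w = v \<bullet> (B *v w)" for v w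
    by (simp_all only: inner_matrix_vector[of v] A B)
  show ?thesis
    unfolding potential_J_eq Gi_def[symmetric] block omega_def fst_conv snd_conv GG GG'
    by (simp add: inner_add_left inner_add_right inner_diff_left inner_diff_right sA sB)
qed

section \<open>Gluing local extensions over the polytope\<close>

context delzant_polytope
begin

definition piece :: "('n, 'r) chart \<Rightarrow> (real^'n) set" where
  "piece c = (case c of None \<Rightarrow> Po | Some e \<Rightarrow> vertex_chart.Pe L e)"

lemma piece_relopen: "c \<in> charts L \<Longrightarrow> \<exists>U. open U \<and> piece c = P \<inter> U"
proof (cases c)
  case None
  then show ?thesis using interior_subset[of P] by (auto simp: piece_def intro!: exI[of _ Po])
next
  case (Some e)
  then show "c \<in> charts L \<Longrightarrow> \<exists>U. open U \<and> piece c = P \<inter> U"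
    using vertex_chart.Pe_relopen[OF vertex_chartI, of e] by (simp add: piece_def)
qed

lemma relopen_dense:
  assumes "open U"
  shows "P \<inter> U \<subseteq> closure (P \<inter> U \<inter> Po)"
proof -
  have "P \<inter> U \<subseteq> U \<inter> closure Po"
    using convex_closure_interior[OF convex_P Po_nonempty] closure_subset[of P] by auto
  also have "\<dots> \<subseteq> closure (U \<inter> Po)" by (rule open_Int_closure_subset[OF assms])
  also have "U \<inter> Po \<subseteq> P \<inter> U \<inter> Po" using interior_subset[of P] by auto
  finally show ?thesis using closure_mono by blast
qed

text \<open>Read off from \<open>charts_cover\<close> by projecting to the moment
  coordinate.\<close>

lemma piece_cover:
  assumes "y \<in> P"
  obtains c where "c \<in> charts L" "y \<in> piece c"
proof -
  have "toric_point L y 0 \<in> toric_manifold L" using assms by (auto simp: toric_manifold_def)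
  then obtain c p where c: "c \<in> charts L" "p \<in> dom_chart L c" "toric_point L y 0 = param L c p"
    using charts_cover[OF delzant] by blast
  have "y = chart_moment L c p" using arg_cong[OF c(3), of fst] by (simp add: fst_param)
  then have "y \<in> piece c"
  proof (cases c)
    case (Some e)
    then show ?thesis
      using c \<open>y = _\<close> vertex_chart.D_iff[OF vertex_chartI, of e p] by (simp add: piece_def del: dom_chart.simps)
  qed (use c in \<open>auto simp: piece_def\<close>)
  with c(1) show thesis by (rule that)
qed

text \<open>Extensions over two pieces agree in the interior, which is dense in the relatively open
  overlap, hence on the overlap; so they glue.\<close>

lemma extends_smoothlyI:
  fixes f :: "real^'n \<Rightarrow> 'b::real_normed_vector"
  assumes f: "smooth_on Po f"
    and loc: "\<And>e. Some e \<in> charts L \<Longrightarrow> \<exists>F. smooth_on (vertex_chart.Pe L e) F \<and> (\<forall>y\<in>Po. F y = f y)"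
  shows "extends_smoothly L f"
proof -
  have "\<forall>c\<in>charts L. \<exists>F. smooth_on (piece c) F \<and> (\<forall>y\<in>Po. F y = f y)"
  proof
    fix c assume "c \<in> charts L"
    then show "\<exists>F. smooth_on (piece c) F \<and> (\<forall>y\<in>Po. F y = f y)"
      using f loc by (cases c) (auto simp: piece_def)
  qed
  from bchoice[OF this] obtain K where
    K: "\<And>c. c \<in> charts L \<Longrightarrow> smooth_on (piece c) (K c)"
      "\<And>c y. c \<in> charts L \<Longrightarrow> y \<in> Po \<Longrightarrow> K c y = f y"
    by blast
  have "\<forall>y\<in>P. \<exists>c. c \<in> charts L \<and> y \<in> piece c" using piece_cover by metis
  from bchoice[OF this] obtain i where i: "\<And>y. y \<in> P \<Longrightarrow> i y \<in> charts L" "\<And>y. y \<in> P \<Longrightarrow> y \<in> piece (i y)"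
    by blast
  have agree: "K c y = K c' y" if c: "c \<in> charts L" "c' \<in> charts L" and y: "y \<in> piece c" "y \<in> piece c'" for c c' y
  proof -
    obtain U U' where U: "open U" "piece c = P \<inter> U" "open U'" "piece c' = P \<inter> U'"
      using piece_relopen c by meson
    let ?V = "P \<inter> (U \<inter> U')"
    show ?thesis
    proof (rule continuous_on_eq_on_dense[of ?V])
      show "continuous_on ?V (K c)" "continuous_on ?V (K c')"
        using K(1)[OF c(1)] K(1)[OF c(2)] U
        by (auto intro!: smooth_on_continuous intro: smooth_on_subset)
      show "?V \<subseteq> closure (?V \<inter> Po)" using U by (intro relopen_dense) auto
    qed (use y U K(2) c in auto)
  qed
  define F where "F y = K (i y) y" for y
  have "smooth_on P F"
  proof (rule smooth_on_local[OF thick_P])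
    fix x assume x: "x \<in> P"
    obtain U where U: "open U" "piece (i x) = P \<inter> U" using piece_relopen[OF i(1)[OF x]] by blast
    have "smooth_on (P \<inter> U) F"
      using K(1)[OF i(1)[OF x]] unfolding U(2)
      by (rule smooth_on_cong) (use agree i x U in \<open>auto simp: F_def\<close>)
    with U i(2)[OF x] show "\<exists>U. open U \<and> x \<in> U \<and> smooth_on (P \<inter> U) F" by blast
  qed
  moreover have "F y = f y" if "y \<in> Po" for y
    using K(2) i(1) that interior_subset[of P] by (auto simp: F_def)
  ultimately show ?thesis unfolding extends_smoothly_def by blast
qed

lemma smooth_on_facet_hessian_Po: "smooth_on Po (facet_hessian UNIV)"
  unfolding facet_hessian_def[abs_def] by (intro smooth_intros) (auto simp: Po_iff less_imp_neq[symmetric])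

end

section \<open>The two implications for a fixed potential\<close>

locale toric_potential = delzant_polytope L
  for L :: "('n::finite, 'r::finite) facet_data" +
  fixes u :: "real^'n \<Rightarrow> real" and \<xi> :: "real^'n \<Rightarrow> complex^'n^'n"
  assumes potential: "symplectic_potential L u" and higgs: "higgs_tensor L \<xi>"
begin

text \<open>The smooth part of \<open>D^2u\<close>, fixed once by choice so that all vertices refer
  to the same function.\<close>

definition regular_hess :: "real^'n \<Rightarrow> real^'n^'n" where
  "regular_hess = (SOME H. smooth_on P H \<and> (\<forall>y\<in>Po. hessian u y = facet_hessian UNIV y + H y))"

lemma regular_hess:
  "smooth_on P regular_hess" "y \<in> Po \<Longrightarrow> hessian u y = facet_hessian UNIV y + regular_hess y"
proof -
  from potential obtain h where h: "smooth_on P h" "\<And>y. y \<in> P \<Longrightarrow> u y = canonical_potential L y + h y"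
    unfolding symplectic_potential_def by blast
  obtain H where "smooth_on P H" "\<And>y. y \<in> Po \<Longrightarrow> hessian u y = facet_hessian UNIV y + H y"
    by (rule hessian_symplectic[OF h]) blast+
  then have "\<exists>H. smooth_on P H \<and> (\<forall>y\<in>Po. hessian u y = facet_hessian UNIV y + H y)" by blast
  from someI_ex[OF this] show "smooth_on P regular_hess"
    "y \<in> Po \<Longrightarrow> hessian u y = facet_hessian UNIV y + regular_hess y"
    unfolding regular_hess_def by blast+
qed

lemma sym_hess: "y \<in> Po \<Longrightarrow> transpose (hessian u y) = hessian u y"
  using potential by (simp add: symplectic_potential_def positive_definite_def)

lemma sym_\<xi>: "y \<in> Po \<Longrightarrow> transpose (\<xi> y) = \<xi> y"
  using higgs by (simp add: higgs_tensor_def)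

lemma delta:
  obtains \<delta> where "continuous_on P \<delta>" "\<And>y. y \<in> P \<Longrightarrow> \<delta> y > 0"
    "\<And>y. y \<in> Po \<Longrightarrow> det (hessian u y) = inverse (\<delta> y * (\<Prod>r\<in>UNIV. ell L r y))"
  using potential unfolding symplectic_potential_def by blast

lemma det_hess: "y \<in> Po \<Longrightarrow> det (hessian u y) \<noteq> 0"
proof -
  assume y: "y \<in> Po"
  obtain \<delta> where \<delta>: "\<And>y. y \<in> P \<Longrightarrow> \<delta> y > 0"
    "\<And>y. y \<in> Po \<Longrightarrow> det (hessian u y) = inverse (\<delta> y * (\<Prod>r\<in>UNIV. ell L r y))" by (rule delta) blast
  have "(\<Prod>r\<in>UNIV. ell L r y) > 0" using y by (intro prod_pos) (auto simp: Po_iff)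
  moreover have "\<delta> y > 0" using y interior_subset \<delta>(1) by blast
  ultimately have "\<delta> y * (\<Prod>r\<in>UNIV. ell L r y) > 0" by simp
  then show ?thesis unfolding \<delta>(2)[OF y] by (metis less_irrefl nonzero_imp_inverse_nonzero)
qed

lemma smooth_on_hess: "smooth_on Po (hessian u)"
  by (rule smooth_on_cong[OF smooth_on_add[OF smooth_on_facet_hessian_Po
        smooth_on_subset[OF regular_hess(1) interior_subset]]]) (rule regular_hess(2))

lemma smooth_on_hess_conj:
  "smooth_on Po (hessian v) \<Longrightarrow> smooth_on Po (hess_conj v \<xi>)"
  unfolding hess_conj_def[abs_def] using higgs by (intro smooth_intros) (auto simp: higgs_tensor_def)

lemma sym_higgs:
  assumes "y \<in> Po"
  shows "transpose (higgs_A u \<xi> y) = higgs_A u \<xi> y" "transpose (higgs_B u \<xi> y) = higgs_B u \<xi> y"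
  by (rule higgs_symmetric[of u y \<xi>, OF sym_hess[OF assms] sym_\<xi>[OF assms]])+

lemma regular_vertex:
  assumes "Some e \<in> charts L"
  shows "vertex_chart.regular_hessian L e (hessian u) (vertex_chart.regular_part L e regular_hess)"
proof -
  interpret vertex_chart L e by (rule vertex_chartI[OF assms])
  obtain \<delta> where \<delta>: "continuous_on P \<delta>" "\<And>y. y \<in> P \<Longrightarrow> \<delta> y > 0"
    "\<And>y. y \<in> Po \<Longrightarrow> det (hessian u y) = inverse (\<delta> y * (\<Prod>r\<in>UNIV. ell L r y))"
    by (rule delta) blast
  show ?thesis
    by (rule regular_hessian_symplectic[OF smooth_on_subset[OF regular_hess(1) Pe_P] regular_hess(2) sym_hess
          continuous_on_subset[OF \<delta>(1) Pe_P] _ \<delta>(3)]) (use \<delta>(2) Pe_P in auto)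
qed

lemma extension_of_deformation:
  assumes J: "complex_structure_of L u J" and J': "deformation_of L J J'"
    and r: "restricts_to L J' (higgs_deformation u \<xi>)"
  shows "extends_smoothly L (hess_conj (canonical_potential L) \<xi>)"
proof (rule extends_smoothlyI)
  have "smooth_on Po (hessian (canonical_potential L))"
    by (rule smooth_on_cong[OF smooth_on_facet_hessian_Po]) (rule hessian_canonical)
  then show "smooth_on Po (hess_conj (canonical_potential L) \<xi>)" by (rule smooth_on_hess_conj)
next
  fix e assume e: "Some e \<in> charts L"
  interpret vertex_chart L e by (rule vertex_chartI[OF e])
  have rep: "represents J (potential_J u)" "represents J' (higgs_deformation u \<xi>)"
    using J J' r by (auto intro!: represents_restriction
        simp: complex_structure_of_def deformation_of_def smooth_endo_field_def)
  have lin: "linear (J (Some e) p)" if "p \<in> D" for p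
    using J e that unfolding complex_structure_of_def smooth_endo_field_def by blast
  have sm: "smooth_on D (\<lambda>p. J (Some e) p X)" "smooth_on D (\<lambda>p. J' (Some e) p X)" for X
    using J J' e unfolding complex_structure_of_def deformation_of_def smooth_endo_field_def by blast+
  note reg = regular_vertex[OF e]
  let ?Gi = "\<lambda>y. matrix_inv (hessian u y)"
  have rep1: "J' (Some e) p \<circ> chart_frame L (Some e) p = chart_frame L (Some e) p \<circ>
      block_endo (?Gi (vertex_moment L e p)) (higgs_A u \<xi> (vertex_moment L e p)) (higgs_B u \<xi> (vertex_moment L e p))"
    if p: "p \<in> D" "vertex_moment L e p \<in> Po" for p
    using rep(2) e p unfolding represents_def higgs_deformation_eq by fastforce
  obtain A where A: "smooth_on Pe A" "\<And>y. y \<in> Po \<Longrightarrow> A y = higgs_A u \<xi> y"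
    by (rule extension_from_chart[OF reg sm(2) rep1 sym_higgs(1)]) blast+
  have rep2: "(\<lambda>X. J (Some e) p (J' (Some e) p X)) \<circ> chart_frame L (Some e) p = chart_frame L (Some e) p \<circ>
      block_endo (?Gi (vertex_moment L e p)) (- higgs_B u \<xi> (vertex_moment L e p)) (higgs_A u \<xi> (vertex_moment L e p))"
    if p: "p \<in> D" "vertex_moment L e p \<in> Po" for p
  proof
    fix X
    let ?y = "vertex_moment L e p"
    let ?b = "block_endo (?Gi ?y) (higgs_A u \<xi> ?y) (higgs_B u \<xi> ?y)"
    have "J (Some e) p \<circ> chart_frame L (Some e) p = chart_frame L (Some e) p \<circ> potential_J u ?y"
      using rep(1) e p unfolding represents_def by fastforce
    from fun_cong[OF this, of "?b X"] fun_cong[OF rep1[OF p], of X]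
    show "((\<lambda>X. J (Some e) p (J' (Some e) p X)) \<circ> chart_frame L (Some e) p) X = (chart_frame L (Some e) p \<circ>
      block_endo (?Gi ?y) (- higgs_B u \<xi> ?y) (higgs_A u \<xi> ?y)) X"
      unfolding comp_apply potential_J_block_endo(1)[OF det_hess[OF p(2)]] by (simp del: chart_frame.simps)
  qed
  have sm': "smooth_on D (\<lambda>p. J (Some e) p (J' (Some e) p X))" for X
    by (rule smooth_on_linear_family[OF lin sm])
  have sB: "transpose (- higgs_B u \<xi> y) = - higgs_B u \<xi> y" if "y \<in> Po" for y
    using sym_higgs(2)[OF that] by (simp add: transpose_def vec_eq_iff)
  obtain B where B: "smooth_on Pe B" "\<And>y. y \<in> Po \<Longrightarrow> B y = - higgs_B u \<xi> y"
    by (rule extension_from_chart[OF reg sm' rep2 sB]) blast+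
  let ?W = "regular_part regular_hess" and ?Wc = "regular_part (\<lambda>y. 0)"
  \<comment> \<open>In the interior \<open>M\<close> is the Hessian of the canonical potential times
    \<open>(D^2u)^-1\<close>, the factor of \<open>hess_conj_change\<close>.\<close>
  define M where "M y = ?Wc y ** matrix_inv (?W y)" for y
  \<comment> \<open>\<open>B\<close> extends \<open>- higgs_B\<close>, hence the plus sign:
    \<open>H\<close> extends \<open>hess_conj u \<xi>\<close>.\<close>
  define H where "H y = (\<chi> i j. complex_of_real (A y $ i $ j) + \<i> * complex_of_real (B y $ i $ j))" for y
  have "smooth_on Pe M" unfolding M_def[abs_def]
    by (intro smooth_intros smooth_Wi[OF reg] smooth_W[OF regular_hessian_canonical])
  moreover have "smooth_on Pe H" unfolding H_def[abs_def] by (intro smooth_intros A B)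
  ultimately have "smooth_on Pe (\<lambda>y. cmat (M y) ** H y ** cmat (transpose (M y)))"
    by (intro smooth_intros)
  moreover have "cmat (M y) ** H y ** cmat (transpose (M y)) = hess_conj (canonical_potential L) \<xi> y"
    if y: "y \<in> Po" for y
  proof -
    have "H y = hess_conj u \<xi> y"
      by (simp add: H_def A(2)[OF y] B(2)[OF y] higgs_A_def higgs_B_def vec_eq_iff complex_eq_iff)
    then show ?thesis
      unfolding M_def regular_hessian_ratio[OF regular_hessian_canonical reg y]
      using hess_conj_change[OF sym_hess[OF y] sym_G[OF regular_hessian_canonical y] det_hess[OF y]] by simp
  qed
  ultimately show "\<exists>F. smooth_on Pe F \<and> (\<forall>y\<in>Po. F y = hess_conj (canonical_potential L) \<xi> y)" by blast
qed

lemma deformation_of_extension: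
  assumes J: "complex_structure_of L u J"
    and ext: "extends_smoothly L (hess_conj (canonical_potential L) \<xi>)"
  obtains J' where "deformation_of L J J'" "torus_invariant L J'" "restricts_to L J' (higgs_deformation u \<xi>)"
proof -
  obtain F where F: "smooth_on P F" "\<And>y. y \<in> Po \<Longrightarrow> F y = hess_conj (canonical_potential L) \<xi> y"
    using ext unfolding extends_smoothly_def by blast
  let ?W = "\<lambda>e. vertex_chart.regular_part L e regular_hess"
  let ?Wc = "\<lambda>e. vertex_chart.regular_part L e (\<lambda>y. 0)"
  \<comment> \<open>The opposite ratio, \<open>D^2u\<close> times the inverse Hessian of the
    canonical potential, leads from the given extension to one of
    \<open>hess_conj u \<xi>\<close>.\<close>
  define H where "H e y = cmat (?W e y ** matrix_inv (?Wc e y)) ** F y ** cmat (transpose (?W e y ** matrix_inv (?Wc e y)))" for e y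
  define A where "A e y = (\<chi> i j. Re (H e y $ i $ j))" for e y
  define B where "B e y = (\<chi> i j. - Im (H e y $ i $ j))" for e y
  \<comment> \<open>Defined chart by chart with no compatibility built in; that follows from
    \<open>represents\<close>, since all local expressions come from the same function of
    \<open>y\<close>.\<close>
  define T :: "('n, 'r) endo_field" where
    "T c p = (case c of None \<Rightarrow> higgs_deformation u \<xi> (fst p)
      | Some e \<Rightarrow> vertex_chart.chart_deformation L e (matrix_inv (?W e (vertex_moment L e p)))
          (A e (vertex_moment L e p)) (B e (vertex_moment L e p)) p)" for c p
  have AB: "smooth_on (vertex_chart.Pe L e) (A e)" "smooth_on (vertex_chart.Pe L e) (B e)"
    "\<And>y. y \<in> Po \<Longrightarrow> A e y = higgs_A u \<xi> y" "\<And>y. y \<in> Po \<Longrightarrow> B e y = higgs_B u \<xi> y"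
    if e: "Some e \<in> charts L" for e
  proof -
    interpret vertex_chart L e by (rule vertex_chartI[OF e])
    note reg = regular_vertex[OF e]
    have "smooth_on Pe (H e)"
      unfolding H_def[abs_def]
      by (intro smooth_intros smooth_on_subset[OF F(1) Pe_P] smooth_W[OF reg] smooth_Wi[OF regular_hessian_canonical])
    then show "smooth_on Pe (A e)" "smooth_on Pe (B e)"
      unfolding A_def[abs_def] B_def[abs_def]
      by (auto intro!: smooth_on_vec_lambda smooth_on_minus smooth_on_Re smooth_on_Im smooth_on_nth)
    have "H e y = hess_conj u \<xi> y" if y: "y \<in> Po" for y
      unfolding H_def regular_hessian_ratio[OF reg regular_hessian_canonical y] F(2)[OF y]
      using hess_conj_change[OF sym_G[OF regular_hessian_canonical y] sym_hess[OF y]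
          det_G[OF regular_hessian_canonical y]] by simp
    then show "A e y = higgs_A u \<xi> y" "B e y = higgs_B u \<xi> y" if "y \<in> Po" for y
      using that by (simp_all add: A_def B_def higgs_A_def higgs_B_def)
  qed
  have smT: "smooth_reps T"
    unfolding smooth_reps_def
  proof (intro ballI conjI allI)
    fix c assume c: "c \<in> charts L"
    show "linear (T c p)" for p
    proof (cases c)
      case None
      have "linear (block_endo Gi A B)" for Gi A B :: "real^'n^'n"
        by (rule linearI) (simp_all add: block_endo_def matrix_vector_right_distrib matrix_vector_mult_scaleR algebra_simps)
      then show ?thesis by (simp add: T_def None higgs_deformation_eq)
    next
      case (Some e)
      then show ?thesis using vertex_chart.linear_chart_deformation[OF vertex_chartI] c by (simp add: T_def)
    qed
    show "smooth_on (dom_chart L c) (\<lambda>p. T c p X)" for X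
    proof (cases c)
      case None
      have s: "smooth_on (Po \<times> UNIV) (\<lambda>p::'n coords. K (fst p))" if "smooth_on Po K" for K :: "real^'n \<Rightarrow> real^'n^'n"
        by (rule smooth_on_compose[OF that smooth_on_fst[OF smooth_on_id]]) auto
      have "smooth_on Po (higgs_A u \<xi>)" "smooth_on Po (higgs_B u \<xi>)"
        unfolding higgs_A_def[abs_def] higgs_B_def[abs_def]
        by (intro smooth_intros smooth_on_hess_conj smooth_on_hess)+
      note AB = this[THEN s]
      have "smooth_on (Po \<times> UNIV) (\<lambda>p::'n coords. matrix_inv (hessian u (fst p)))"
        by (rule s[OF smooth_on_matrix_inv[OF smooth_on_hess det_hess]])
      with AB have "smooth_on (Po \<times> UNIV) (\<lambda>p::'n coords. higgs_deformation u \<xi> (fst p) X)"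
        unfolding higgs_deformation_eq block_endo_def
        by (intro smooth_on_Pair smooth_on_add smooth_on_diff smooth_on_matrix_vector_mult
            smooth_on_matrix_matrix_mult smooth_on_const)
      then show ?thesis by (simp add: None T_def)
    next
      case (Some e)
      then interpret vertex_chart L e using c by (intro vertex_chartI) simp
      have e: "Some e \<in> charts L" using c Some by simp
      show ?thesis
        unfolding Some T_def option.case
        by (rule smooth_on_chart_deformation[OF smooth_Wi[OF regular_vertex[OF e]] AB(1,2)[OF e]])
    qed
  qed
  have repT: "represents T (higgs_deformation u \<xi>)"
    unfolding represents_def
  proof (intro ballI impI)
    fix c p assume c: "c \<in> charts L" and p: "p \<in> dom_chart L c" "chart_moment L c p \<in> Po"
    show "T c p \<circ> chart_frame L c p = chart_frame L c p \<circ> higgs_deformation u \<xi> (chart_moment L c p)"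
    proof (cases c)
      case None
      then show ?thesis by (simp add: T_def fun_eq_iff)
    next
      case (Some e)
      then interpret vertex_chart L e using c by (intro vertex_chartI) simp
      have e: "Some e \<in> charts L" and pD: "p \<in> D" and y: "vertex_moment L e p \<in> Po" using c p Some by auto
      show ?thesis
        unfolding Some T_def option.case chart_moment.simps higgs_deformation_eq AB(3,4)[OF e y]
        using chart_deformation_frame[OF regular_vertex[OF e] y pD] by (simp only: fun_eq_iff comp_apply) simp
    qed
  qed
  \<comment> \<open>The value \<open>t = 0\<close> yields the tensor law, all values together yield
    torus invariance.\<close>
  have pres: "preserved_by L (act t) T" for t by (rule represents_preserved[OF smT repT])
  have "smooth_endo_field L T"
    using smT pres[of 0] by (simp add: smooth_endo_field_def smooth_reps_def act_0)
  moreover have "J c p (T c p X) + T c p (J c p X) = 0"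
    "omega (J c p X) (T c p Y) + omega (T c p X) (J c p Y) = 0"
    if c: "c \<in> charts L" "p \<in> dom_chart L c" for c p X Y
  proof -
    have repJ: "represents J (potential_J u)"
      using J by (auto intro!: represents_restriction simp: complex_structure_of_def smooth_endo_field_def)
    have smJ: "smooth_reps J"
      using J by (simp add: smooth_reps_def complex_structure_of_def smooth_endo_field_def)
    have anti: "potential_J u y (higgs_deformation u \<xi> y X) + higgs_deformation u \<xi> y (potential_J u y X) = 0"
      if "y \<in> Po" for y X
      unfolding higgs_deformation_eq potential_J_block_endo[OF det_hess[OF that]] by simp
    have om: "omega (potential_J u y X) (higgs_deformation u \<xi> y Y) + omega (higgs_deformation u \<xi> y X) (potential_J u y Y) = 0"
      if "y \<in> Po" for y X Y
      unfolding higgs_deformation_eq by (rule omega_block_endo[OF det_hess[OF that] sym_hess[OF that] sym_higgs[OF that]])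
    show "J c p (T c p X) + T c p (J c p X) = 0"
      by (rule represents_deformation(1)[OF smJ repJ smT repT anti om c])
    show "omega (J c p X) (T c p Y) + omega (T c p X) (J c p Y) = 0"
      by (rule represents_deformation(2)[OF smJ repJ smT repT anti om c])
  qed
  ultimately have "deformation_of L J T" unfolding deformation_of_def by blast
  moreover have "torus_invariant L T" using pres by (simp add: torus_invariant_def)
  moreover have "restricts_to L T (higgs_deformation u \<xi>)" by (simp add: restricts_to_def T_def)
  ultimately show thesis by (rule that)
qed

end

theorem proposition1p14:
  fixes L :: "('n::finite, 'r::finite) facet_data"
    and u :: "real^'n \<Rightarrow> real"
    and J :: "('n, 'r) endo_field"
    and \<xi> :: "real^'n \<Rightarrow> complex^'n^'n"
  assumes "delzant L"
    and "symplectic_potential L u"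
    and "complex_structure_of L u J"
    and "higgs_tensor L \<xi>"
  shows "(\<exists>J'. deformation_of L J J' \<and> torus_invariant L J' \<and>
            restricts_to L J' (higgs_deformation u \<xi>))
         \<longleftrightarrow> extends_smoothly L (hess_conj (canonical_potential L) \<xi>)"
proof -
  interpret toric_potential L u \<xi>
    by unfold_locales (fact assms)+
  show ?thesis
    using extension_of_deformation[OF assms(3)] deformation_of_extension[OF assms(3)] by blast
qed

end
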